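(* Let $X$ be a finite dimensional $\mathrm{CAT}(0)$ cube complex of finite staircase length, and let $\Gamma$ be a group acting on $X$ via combinatorial automorphisms. Let $\ell\in\mathbb{N}_{>0}$, let $s\in X_{\mathcal{H}}^{(\ell)}$ be an $\mathcal{H}$-segment of length $\ell$ (a tightly nested sequence of halfspaces), and let $f_s$ be the median quasimorphism for $s$. If $\alpha_1\in H_{\Gamma,b}^{n}(X;\mathbb{R})$ and $\alpha_2\in H_{\Gamma,b}^{m}(X;\mathbb{R})$ are non-transverse to the orbit $\Gamma s$, then the cup products $\alpha_1 \cup [\delta^1f_s]$ and $[\delta^1f_s]\cup \alpha_2$ as well as the Massey triple product $\langle \alpha_1, [\delta^1f_s], \alpha_2 \rangle$ are trivial.
   Context: Equivariant bounded cohomology: for a discrete group $\Gamma$ acting on a $\mathrm{CAT}(0)$ cube complex $X$ with vertex set $V$, $C^n_{\Gamma,b}(X;\mathbb{R})=\ell^\infty(V^{n+1},\mathbb{R})^\Gamma$ is the space of bounded functions invariant under the diagonal action, with the simplicial coboundary $\delta^n f(x_0,\ldots,x_{n+1})=\sum_{i=0}^{n+1}(-1)^i f(x_0,\ldots,\widehat{x_i},\ldots,x_{n+1})$; its cohomology is $H^*_{\Gamma,b}(X;\mathbb{R})$. The cup product is induced by $(f\cup g)(x_0,\ldots,x_{p+q})=f(x_0,\ldots,x_p)\,g(x_p,\ldots,x_{p+q})$. Massey triple product: let $\alpha_1\in H_{\Gamma,b}^p$, $\alpha\in H_{\Gamma,b}^k$, $\alpha_2\in H_{\Gamma,b}^q$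 with $\alpha_1\cup\alpha=0$ and $\alpha\cup\alpha_2=0$. Then $\langle\alpha_1,\alpha,\alpha_2\rangle\subset H^{p+q+k-1}_{\Gamma,b}(X;\mathbb{R})$ is the set of all classes $(-1)^k[(-1)^p\omega_1\cup\beta_2-\beta_1\cup\omega_2]$ where $\omega_1,\omega,\omega_2$ are cocycles representing $\alpha_1,\alpha,\alpha_2$, and $\beta_1,\beta_2$ are bounded $\Gamma$-invariant cochains with $\delta\beta_1=\omega_1\cup\omega$ and $\delta\beta_2=\omega\cup\omega_2$. It is called trivial if it contains the zero class. Cube complexes and halfspaces: a $\mathrm{CAT}(0)$ cube complex is a simply connected cubical complex whose vertex links are flag complexes; its dimension is the highest dimension of a cube. Let $(V,E)$ be the graph given by its $1$-skeleton (a median graph) with graph metric $D$. For an edge $e=\{\alpha,\omega\}\in E$, the gate map $g_e\colon V\to\{\alpha,\omega\}$ sends $x$ to whichever of $\alpha,\omega$ is closer to $x$ (well-defined as $(V,E)$ is median). The sets $g_e^{-1}(\alpha)$ and $g_e^{-1}(\omega)$ are called halfspaces, and $e$ is dual to them. $X_{\mathcal{H}}$ is the set of all halfspaces. The complement of a halfspace $h$ is $\overline{h}=V\setminus h$, again a halfspace. Halfspaces $h_1,h_2$ are transverse, $h_1\pitchfork h_2$, if $h_1\cap h_2$, $h_1\cap\overline{h_2}$, $\overline{h_1}\cap h_2$ and $\overline{h_1}\cap\overline{h_2}$ are all non-empty. For $x,y\in V$, $[x,y]_{\mathcal{H}}$ is the set of halfspaces $h$ with $y\in h$ and $x\in\overline{h}$.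 Segments: two halfspaces $h_1\supsetneq h_2$ are tightly nested if there is no halfspace $h$ with $h_1\supsetneq h\supsetneq h_2$. An $\mathcal{H}$-segment of length $\ell$ is a sequence $(h_1\supset\cdots\supset h_\ell)$ of halfspaces in which consecutive ones are tightly nested; $X_{\mathcal{H}}^{(\ell)}$ is the set of those. The group $\Gamma$ acts on $X_{\mathcal{H}}^{(\ell)}$; elements of the orbit $\Gamma s$ are called translates of $s$. Median quasimorphism: $f_s\colon V\times V\to\mathbb{R}$ assigns to $(x,y)$ the number of translates of $s$ all of whose halfspaces lie in $[x,y]_{\mathcal{H}}$ minus the number of translates of $s$ all of whose halfspaces lie in $[y,x]_{\mathcal{H}}$. For $X$ finite dimensional of finite staircase length, $\delta^1f_s$ is bounded, hence defines a class $[\delta^1f_s]\in H^2_{\Gamma,b}(X;\mathbb{R})$. Staircases: for $\sigma\in\mathbb{N}$, a length-$\sigma$ staircase in $X$ is a pair of proper chains of halfspaces $(h_1\supset\cdots\supset h_\sigma,\ k_1\supset\cdots\supset k_\sigma)$ such that $h_i\pitchfork k_j$ for all $i\in\{1,\ldots,\sigma\}$ and $j\in\{1,\ldots,i-1\}$, and $h_i\supsetneq k_i$ for all $i\in\{1,\ldots,\sigma\}$. The staircase length of $X$ is the maximal length of a staircase in $X$ ($\infty$ if there is no maximum). Heads, tails, non-transversality: let $s=(h_1\supset\cdots\supset h_\ell)\in X_{\mathcal{H}}^{(\ell)}$. A vertex $\alpha$ is a head of $s$ if $\alpha\in\overline{h_1}$ and $\alpha$ is an endpoint of an edge dual to $h_1$;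 a vertex $\omega$ is a tail of $s$ if $\omega\in h_\ell$ and $\omega$ is an endpoint of an edge dual to $h_\ell$. Let $\alpha(s)$, $\omega(s)$ be the sets of heads and tails. A cochain $\kappa\in C^n_{\Gamma,b}(X;\mathbb{R})$ and $s$ are non-transverse if for all $x_1,\ldots,x_n\in V$ the value $\kappa(\alpha,x_1,\ldots,x_n)$ is constant over $\alpha\in\alpha(s)$ and the value $\kappa(\omega,x_1,\ldots,x_n)$ is constant over $\omega\in\omega(s)$. $\kappa$ is non-transverse to a set of segments if it is non-transverse to each of them. A class in $H^n_{\Gamma,b}(X;\mathbb{R})$ is non-transverse to such a set if it admits a representative cocycle that is.
   Formalization: The degrees n and m are taken to be positive; in degree 0 the claim fails, since the constant class 1 is non-transverse to every orbit but 1 ∪ [δ¹f_s] = [δ¹f_s] can be nonzero (a free group acting on its Cayley tree, s the segment of the word ab). *)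

theory Defs
  imports
    "HOL-Analysis.Analysis"
    "HOL-Library.Extended_Nat"
    "HOL-Algebra.Group_Action"
begin

section \<open>Cubical complexes\<close>

text \<open>
  In a cubical complex the closed cubes are embedded and two of them meet in a common face or not
  at all, so a cube is determined by its set of vertices.  A complex is therefore
  encoded by the set \<open>K\<close> of the vertex sets of its cubes, of all dimensions.  The vertices of the
  standard \<open>n\<close>-cube are the subsets of \<open>{..<n}\<close> (a subset records which coordinates are 1), and its
  nonempty faces are the intervals \<open>{I..J}\<close> of the inclusion order.
\<close>

definition std_cube_faces :: "nat \<Rightarrow> nat set set set" where
  "std_cube_faces n = {{I..J} | I J. I \<subseteq> J \<and> J \<subseteq> {..<n}}"

text \<open>The chart \<open>c\<close> identifies \<open>C\<close> with the standard \<open>n\<close>-cube; its faces are exactly the cubes of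
  \<open>K\<close> contained in \<open>C\<close>.\<close>

definition cube_chart :: "'v set set \<Rightarrow> nat \<Rightarrow> (nat set \<Rightarrow> 'v) \<Rightarrow> 'v set \<Rightarrow> bool" where
  "cube_chart K n c C \<longleftrightarrow>
     inj_on c (Pow {..<n}) \<and> c ` Pow {..<n} = C \<and>
     {D \<in> K. D \<subseteq> C} = (\<lambda>F. c ` F) ` std_cube_faces n"

definition cubical_complex :: "'v set set \<Rightarrow> bool" where
  "cubical_complex K \<longleftrightarrow>
     (\<forall>C\<in>K. \<exists>n c. cube_chart K n c C) \<and>
     (\<forall>C\<in>K. \<forall>D\<in>K. C \<inter> D = {} \<or> C \<inter> D \<in> K)"

definition vertices :: "'v set set \<Rightarrow> 'v set" where
  "vertices K = \<Union>K"

definition edges :: "'v set set \<Rightarrow> 'v set set" where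
  "edges K = {e \<in> K. card e = 2}"

definition cc_dimension :: "'v set set \<Rightarrow> enat" where
  "cc_dimension K = Sup {enat n | n C c. C \<in> K \<and> cube_chart K n c C}"

text \<open>
  The point of a cube with coordinates \<open>t\<close> in \<open>[0,1]^n\<close> is represented by its multilinear
  barycentric coordinates: the function on vertices that is the product of the \<open>t i\<close> and
  \<open>1 - t i\<close> at the vertices of the cube and 0 elsewhere.  This is injective on each cube, compatible
  with passing to faces, and independent of the chart, so the set of all these functions is the
  union of the cubes glued along common faces.  It carries the subspace topology of the product
  topology.  As the coordinates are nonnegative and sum to 1, this is the metric topology of the
  realization, for which a finite dimensional complex is CAT(0); its homotopy type is also that of
  the weak topology.
\<close>

definition cube_point :: "nat \<Rightarrow> (nat set \<Rightarrow> 'v) \<Rightarrow> (nat \<Rightarrow> real) \<Rightarrow> 'v \<Rightarrow> real" where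
  "cube_point n c t =
     (\<lambda>v. \<Sum>A\<in>{A \<in> Pow {..<n}. c A = v}. (\<Prod>i\<in>A. t i) * (\<Prod>i\<in>{..<n} - A. 1 - t i))"

definition realization :: "'v set set \<Rightarrow> ('v \<Rightarrow> real) set" where
  "realization K =
     {cube_point n c t | n c C t. C \<in> K \<and> cube_chart K n c C \<and> (\<forall>i<n. 0 \<le> t i \<and> t i \<le> 1)}"

text \<open>The vertices of the link of \<open>v\<close> are the edges at \<open>v\<close>; each cube containing \<open>v\<close> contributes
  the simplex formed by its edges at \<open>v\<close> (the empty simplex for the cube \<open>{v}\<close>).\<close>

definition vertex_link :: "'v set set \<Rightarrow> 'v \<Rightarrow> 'v set set set" where
  "vertex_link K v = {{e \<in> edges K. v \<in> e \<and> e \<subseteq> C} | C. C \<in> K \<and> v \<in> C}"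

definition flag_complex :: "'a set set \<Rightarrow> bool" where
  "flag_complex L \<longleftrightarrow>
     (\<forall>S. finite S \<and> S \<subseteq> \<Union>L \<and> (\<forall>a\<in>S. \<forall>b\<in>S. a \<noteq> b \<longrightarrow> {a, b} \<in> L) \<longrightarrow> S \<in> L)"

definition CAT0_cube_complex :: "'v set set \<Rightarrow> bool" where
  "CAT0_cube_complex K \<longleftrightarrow>
     cubical_complex K \<and> simply_connected (realization K) \<and>
     (\<forall>v\<in>vertices K. flag_complex (vertex_link K v))"

definition combinatorial_action ::
  "('g, 'r) monoid_scheme \<Rightarrow> 'v set set \<Rightarrow> ('g \<Rightarrow> 'v \<Rightarrow> 'v) \<Rightarrow> bool" where
  "combinatorial_action G K \<phi> \<longleftrightarrow>
     group_action G (vertices K) \<phi> \<and> (\<forall>g\<in>carrier G. \<forall>C\<in>K. \<phi> g ` C \<in> K)"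

section \<open>Halfspaces\<close>

definition walk :: "'v set set \<Rightarrow> 'v list \<Rightarrow> bool" where
  "walk K p \<longleftrightarrow> p \<noteq> [] \<and> set p \<subseteq> vertices K \<and> successively (\<lambda>u v. {u, v} \<in> edges K) p"

definition graph_dist :: "'v set set \<Rightarrow> 'v \<Rightarrow> 'v \<Rightarrow> nat" where
  "graph_dist K x y = (LEAST n. \<exists>p. walk K p \<and> length p = Suc n \<and> hd p = x \<and> last p = y)"

definition gate :: "'v set set \<Rightarrow> 'v set \<Rightarrow> 'v \<Rightarrow> 'v" where
  "gate K e x = arg_min_on (graph_dist K x) e"

text \<open>\<open>dual_edge K e h\<close> also expresses that \<open>h\<close> is one of the two halfspaces defined by \<open>e\<close>.\<close>

definition dual_edge :: "'v set set \<Rightarrow> 'v set \<Rightarrow> 'v set \<Rightarrow> bool" where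
  "dual_edge K e h \<longleftrightarrow> e \<in> edges K \<and> (\<exists>a\<in>e. h = {x \<in> vertices K. gate K e x = a})"

definition halfspaces :: "'v set set \<Rightarrow> 'v set set" where
  "halfspaces K = {h. \<exists>e. dual_edge K e h}"

definition hcompl :: "'v set set \<Rightarrow> 'v set \<Rightarrow> 'v set" where
  "hcompl K h = vertices K - h"

definition transverse :: "'v set set \<Rightarrow> 'v set \<Rightarrow> 'v set \<Rightarrow> bool" where
  "transverse K h k \<longleftrightarrow>
     h \<inter> k \<noteq> {} \<and> h \<inter> hcompl K k \<noteq> {} \<and> hcompl K h \<inter> k \<noteq> {} \<and> hcompl K h \<inter> hcompl K k \<noteq> {}"

definition hinterval :: "'v set set \<Rightarrow> 'v \<Rightarrow> 'v \<Rightarrow> 'v set set" where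
  "hinterval K x y = {h \<in> halfspaces K. y \<in> h \<and> x \<in> hcompl K h}"

definition proper_chain :: "'v set set \<Rightarrow> 'v set list \<Rightarrow> bool" where
  "proper_chain K hs \<longleftrightarrow> set hs \<subseteq> halfspaces K \<and> successively (\<lambda>h k. k \<subset> h) hs"

definition staircase :: "'v set set \<Rightarrow> 'v set list \<Rightarrow> 'v set list \<Rightarrow> bool" where
  "staircase K hs ks \<longleftrightarrow>
     length hs = length ks \<and> proper_chain K hs \<and> proper_chain K ks \<and>
     (\<forall>i<length hs. \<forall>j<i. transverse K (hs ! i) (ks ! j)) \<and>
     (\<forall>i<length hs. ks ! i \<subset> hs ! i)"

definition staircase_length :: "'v set set \<Rightarrow> enat" where
  "staircase_length K = Sup {enat (length hs) | hs ks. staircase K hs ks}"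

definition tightly_nested :: "'v set set \<Rightarrow> 'v set \<Rightarrow> 'v set \<Rightarrow> bool" where
  "tightly_nested K h1 h2 \<longleftrightarrow> h2 \<subset> h1 \<and> \<not> (\<exists>h\<in>halfspaces K. h2 \<subset> h \<and> h \<subset> h1)"

definition segments :: "'v set set \<Rightarrow> nat \<Rightarrow> 'v set list set" where
  "segments K l =
     {s. length s = l \<and> set s \<subseteq> halfspaces K \<and> successively (tightly_nested K) s}"

definition translates ::
  "('g, 'r) monoid_scheme \<Rightarrow> ('g \<Rightarrow> 'v \<Rightarrow> 'v) \<Rightarrow> 'v set list \<Rightarrow> 'v set list set" where
  "translates G \<phi> s = orbit G (\<lambda>g. map (\<lambda>h. \<phi> g ` h)) s"

definition heads :: "'v set set \<Rightarrow> 'v set list \<Rightarrow> 'v set" where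
  "heads K s = {a \<in> hcompl K (hd s). \<exists>e. dual_edge K e (hd s) \<and> a \<in> e}"

definition tails :: "'v set set \<Rightarrow> 'v set list \<Rightarrow> 'v set" where
  "tails K s = {w \<in> last s. \<exists>e. dual_edge K e (last s) \<and> w \<in> e}"

section \<open>Equivariant bounded cohomology\<close>

text \<open>A function on \<open>V^{n+1}\<close> is encoded as a function on lists that vanishes outside the lists of
  length \<open>n + 1\<close> over \<open>V\<close>, so that equality of cochains is equality of functions.\<close>

definition tuples :: "'v set set \<Rightarrow> nat \<Rightarrow> 'v list set" where
  "tuples K n = {xs. length xs = n \<and> set xs \<subseteq> vertices K}"

definition cochains ::
  "('g, 'r) monoid_scheme \<Rightarrow> 'v set set \<Rightarrow> ('g \<Rightarrow> 'v \<Rightarrow> 'v) \<Rightarrow> nat \<Rightarrow> ('v list \<Rightarrow> real) set" where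
  "cochains G K \<phi> n =
     {f. (\<forall>xs. xs \<notin> tuples K (n + 1) \<longrightarrow> f xs = 0) \<and>
         (\<exists>B. \<forall>xs\<in>tuples K (n + 1). \<bar>f xs\<bar> \<le> B) \<and>
         (\<forall>g\<in>carrier G. \<forall>xs\<in>tuples K (n + 1). f (map (\<phi> g) xs) = f xs)}"

definition coboundary :: "'v set set \<Rightarrow> nat \<Rightarrow> ('v list \<Rightarrow> real) \<Rightarrow> 'v list \<Rightarrow> real" where
  "coboundary K n f =
     (\<lambda>xs. if xs \<in> tuples K (n + 2)
           then \<Sum>i\<le>n + 1. (-1) ^ i * f (take i xs @ drop (Suc i) xs) else 0)"

definition cocycles ::
  "('g, 'r) monoid_scheme \<Rightarrow> 'v set set \<Rightarrow> ('g \<Rightarrow> 'v \<Rightarrow> 'v) \<Rightarrow> nat \<Rightarrow> ('v list \<Rightarrow> real) set" where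
  "cocycles G K \<phi> n = {f \<in> cochains G K \<phi> n. coboundary K n f = (\<lambda>_. 0)}"

definition coboundaries ::
  "('g, 'r) monoid_scheme \<Rightarrow> 'v set set \<Rightarrow> ('g \<Rightarrow> 'v \<Rightarrow> 'v) \<Rightarrow> nat \<Rightarrow> ('v list \<Rightarrow> real) set" where
  "coboundaries G K \<phi> n =
     (case n of 0 \<Rightarrow> {\<lambda>_. 0} | Suc m \<Rightarrow> coboundary K m ` cochains G K \<phi> m)"

definition cohomologous ::
  "('g, 'r) monoid_scheme \<Rightarrow> 'v set set \<Rightarrow> ('g \<Rightarrow> 'v \<Rightarrow> 'v) \<Rightarrow> nat \<Rightarrow> ('v list \<Rightarrow> real) rel" where
  "cohomologous G K \<phi> n =
     {(f, g). f \<in> cocycles G K \<phi> n \<and> g \<in> cocycles G K \<phi> n \<and>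
              (\<lambda>xs. f xs - g xs) \<in> coboundaries G K \<phi> n}"

definition cohomology ::
  "('g, 'r) monoid_scheme \<Rightarrow> 'v set set \<Rightarrow> ('g \<Rightarrow> 'v \<Rightarrow> 'v) \<Rightarrow> nat \<Rightarrow> ('v list \<Rightarrow> real) set set" where
  "cohomology G K \<phi> n = cocycles G K \<phi> n // cohomologous G K \<phi> n"

text \<open>If \<open>f\<close> is not a bounded invariant cocycle, then \<open>coclass G K \<phi> n f\<close> is empty, which is not
  an element of the cohomology.\<close>

definition coclass ::
  "('g, 'r) monoid_scheme \<Rightarrow> 'v set set \<Rightarrow> ('g \<Rightarrow> 'v \<Rightarrow> 'v) \<Rightarrow> nat \<Rightarrow> ('v list \<Rightarrow> real) \<Rightarrow>
     ('v list \<Rightarrow> real) set" where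
  "coclass G K \<phi> n f = cohomologous G K \<phi> n `` {f}"

definition null_class ::
  "('g, 'r) monoid_scheme \<Rightarrow> 'v set set \<Rightarrow> ('g \<Rightarrow> 'v \<Rightarrow> 'v) \<Rightarrow> nat \<Rightarrow> ('v list \<Rightarrow> real) set" where
  "null_class G K \<phi> n = coclass G K \<phi> n (\<lambda>_. 0)"

definition cup ::
  "'v set set \<Rightarrow> nat \<Rightarrow> nat \<Rightarrow> ('v list \<Rightarrow> real) \<Rightarrow> ('v list \<Rightarrow> real) \<Rightarrow> 'v list \<Rightarrow> real" where
  "cup K p q f g =
     (\<lambda>xs. if xs \<in> tuples K (p + q + 1) then f (take (p + 1) xs) * g (drop p xs) else 0)"

text \<open>The cup product of two classes is the class of the cup product of representatives; the union
  runs over the choices of representatives, all of which give the same class.\<close>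

definition cup_class ::
  "('g, 'r) monoid_scheme \<Rightarrow> 'v set set \<Rightarrow> ('g \<Rightarrow> 'v \<Rightarrow> 'v) \<Rightarrow> nat \<Rightarrow> nat \<Rightarrow>
     ('v list \<Rightarrow> real) set \<Rightarrow> ('v list \<Rightarrow> real) set \<Rightarrow> ('v list \<Rightarrow> real) set" where
  "cup_class G K \<phi> p q a b = (\<Union>f\<in>a. \<Union>g\<in>b. coclass G K \<phi> (p + q) (cup K p q f g))"

text \<open>Here \<open>a1\<close>, \<open>a\<close>, \<open>a2\<close> have degrees \<open>p\<close>, \<open>k\<close>, \<open>q\<close>.  Because of the subtraction on natural
  numbers this is meaningful for \<open>k \<ge> 1\<close> only.\<close>

definition massey ::
  "('g, 'r) monoid_scheme \<Rightarrow> 'v set set \<Rightarrow> ('g \<Rightarrow> 'v \<Rightarrow> 'v) \<Rightarrow> nat \<Rightarrow> nat \<Rightarrow> nat \<Rightarrow>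
     ('v list \<Rightarrow> real) set \<Rightarrow> ('v list \<Rightarrow> real) set \<Rightarrow> ('v list \<Rightarrow> real) set \<Rightarrow>
     ('v list \<Rightarrow> real) set set" where
  "massey G K \<phi> p k q a1 a a2 =
     {coclass G K \<phi> (p + q + k - 1)
        (\<lambda>xs. (-1) ^ k * ((-1) ^ p * cup K p (k + q - 1) w1 b2 xs - cup K (p + k - 1) q b1 w2 xs))
      | w1 w w2 b1 b2.
        w1 \<in> a1 \<and> w \<in> a \<and> w2 \<in> a2 \<and>
        b1 \<in> cochains G K \<phi> (p + k - 1) \<and> b2 \<in> cochains G K \<phi> (k + q - 1) \<and>
        coboundary K (p + k - 1) b1 = cup K p k w1 w \<and>
        coboundary K (k + q - 1) b2 = cup K k q w w2}"

definition median_quasimorphism ::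
  "('g, 'r) monoid_scheme \<Rightarrow> 'v set set \<Rightarrow> ('g \<Rightarrow> 'v \<Rightarrow> 'v) \<Rightarrow> 'v set list \<Rightarrow> 'v \<Rightarrow> 'v \<Rightarrow> real" where
  "median_quasimorphism G K \<phi> s x y =
     real (card {t \<in> translates G \<phi> s. set t \<subseteq> hinterval K x y}) -
     real (card {t \<in> translates G \<phi> s. set t \<subseteq> hinterval K y x})"

definition median_cochain ::
  "('g, 'r) monoid_scheme \<Rightarrow> 'v set set \<Rightarrow> ('g \<Rightarrow> 'v \<Rightarrow> 'v) \<Rightarrow> 'v set list \<Rightarrow> 'v list \<Rightarrow> real" where
  "median_cochain G K \<phi> s =
     (\<lambda>xs. if xs \<in> tuples K 2 then median_quasimorphism G K \<phi> s (xs ! 0) (xs ! 1) else 0)"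

definition median_class ::
  "('g, 'r) monoid_scheme \<Rightarrow> 'v set set \<Rightarrow> ('g \<Rightarrow> 'v \<Rightarrow> 'v) \<Rightarrow> 'v set list \<Rightarrow> ('v list \<Rightarrow> real) set" where
  "median_class G K \<phi> s = coclass G K \<phi> 2 (coboundary K 1 (median_cochain G K \<phi> s))"

definition non_transverse :: "'v set set \<Rightarrow> nat \<Rightarrow> ('v list \<Rightarrow> real) \<Rightarrow> 'v set list \<Rightarrow> bool" where
  "non_transverse K n \<kappa> s \<longleftrightarrow>
     (\<forall>xs\<in>tuples K n.
        (\<forall>a\<in>heads K s. \<forall>a'\<in>heads K s. \<kappa> (a # xs) = \<kappa> (a' # xs)) \<and>
        (\<forall>w\<in>tails K s. \<forall>w'\<in>tails K s. \<kappa> (w # xs) = \<kappa> (w' # xs)))"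

definition non_transverse_class ::
  "'v set set \<Rightarrow> nat \<Rightarrow> ('v list \<Rightarrow> real) set \<Rightarrow> 'v set list set \<Rightarrow> bool" where
  "non_transverse_class K n a T \<longleftrightarrow> (\<exists>\<kappa>\<in>a. \<forall>t\<in>T. non_transverse K n \<kappa> t)"

end

(*
  For a translate t of s with a head z, let K_t(x_0, ..., x_(n-1)) = kappa(z, x_0, ..., x_(n-1)).
  As kappa is a cocycle, K_t is a primitive of kappa, and non-transversality makes it equivariant
  in t.  Write f_s as the sum over the translates t of the contributions mu_t.  Then the sum of
  K_t cup (delta mu_t) is a primitive of kappa cup (delta f_s), symmetrically for the product on
  the other side, and the sum of K1_t cup (delta mu_t) cup K2_t is, up to sign, a primitive of the
  Massey product cochain.  These primitives are bounded because (delta mu_t)(x, y, z) is nonzero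
  only if t lies inside an interval between two of the vertices x, y and z, and some but not all
  halfspaces of t contain the remaining one; the number of these t is bounded, by Ramsey's
  theorem, in terms of the dimension (antichains) and the staircase length (chains).

  The geometry of halfspaces rests on two facts: any two geodesics with common endpoints are
  related by flips across squares, and the quadrangle condition.  Reduced edge paths modulo flips
  form a set-valued local system on the complex by flagness of the links; simple connectedness of
  the realization makes its monodromy trivial, so reduced paths are unique modulo flips.
*)
theory Submission
  imports Defs "HOL-Library.Ramsey"
begin

section \<open>Paths up to square flips\<close>

text \<open>Up to sign, the obvious primitive is the cup product of \<open>\<kappa>\<close> with the
  median quasimorphism itself, but it is unbounded, and removing this defect shapes the argument. By
  the Leibniz rule, for each translate \<open>t\<close> the products of \<open>\<kappa>\<close> with
  \<open>\<mu> t\<close> and of \<open>cone \<kappa> n t\<close> with \<open>d\<mu> t\<close> agree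
  up to sign and up to the coboundary of the product of \<open>cone \<kappa> n t\<close> with
  \<open>\<mu> t\<close>. The latter can only be used translate by translate, as the apex of the
  cone depends on \<open>t\<close>; it trades the unbounded factor for one that is nonzero for
  boundedly many translates at each tuple. Both one-sided primitives keep the same factor
  \<open>d\<mu> t\<close>, which is why coning on both sides compares them. On the geometric side
  neither bipartiteness nor the median property of the graph is given, so distances cannot serve as
  a starting point. Reducedness of a path is therefore defined by flips alone, and only the
  uniqueness of reduced paths identifies their lengths with distances.\<close>

locale cubed_graph =
  fixes adj :: "'v \<Rightarrow> 'v \<Rightarrow> bool"
    and sq :: "'v \<Rightarrow> 'v \<Rightarrow> 'v \<Rightarrow> 'v \<Rightarrow> bool"
  assumes adj_sym: "adj u v \<Longrightarrow> adj v u"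
    and sq_adj: "sq a b c d \<Longrightarrow> adj a b"
    and sq_neq: "sq a b c d \<Longrightarrow> a \<noteq> c"
    and sq_rot: "sq a b c d \<Longrightarrow> sq b c d a"
    and sq_refl: "sq a b c d \<Longrightarrow> sq a d c b"
    and sq_unique: "sq a b c d \<Longrightarrow> sq a b c d' \<Longrightarrow> d = d'"
    and sq_cube: "sq v a x b \<Longrightarrow> sq v b y c \<Longrightarrow> sq v a z c \<Longrightarrow>
      \<exists>w. sq a x w z \<and> sq b x w y \<and> sq c y w z"
begin

lemma sq_sides: "sq a b c d \<Longrightarrow> adj a b \<and> adj b c \<and> adj c d \<and> adj d a"
  using sq_adj sq_rot by blast

lemma sq_diagonals: "sq a b c d \<Longrightarrow> a \<noteq> c \<and> b \<noteq> d"
  using sq_neq sq_rot by blast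

section \<open>Flip equivalence and cancellation of a common last step\<close>

inductive flip_equiv :: "'v list \<Rightarrow> 'v list \<Rightarrow> bool" where
  fe_refl: "flip_equiv p p"
| fe_trans: "flip_equiv p q \<Longrightarrow> flip_equiv q r \<Longrightarrow> flip_equiv p r"
| fe_Cons: "flip_equiv p q \<Longrightarrow> flip_equiv (v # p) (v # q)"
| fe_flip: "sq v u x a \<Longrightarrow> flip_equiv (x # u # v # p) (x # a # v # p)"

lemma flip_equiv_sym: "flip_equiv p q \<Longrightarrow> flip_equiv q p"
  by (induction rule: flip_equiv.induct) (auto intro: flip_equiv.intros sq_refl)

lemma flip_equiv_length: "flip_equiv p q \<Longrightarrow> length p = length q"
  by (induction rule: flip_equiv.induct) auto

lemma flip_equiv_hd: "flip_equiv p q \<Longrightarrow> hd p = hd q"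
  by (induction rule: flip_equiv.induct) auto

lemma flip_equiv_last: "flip_equiv p q \<Longrightarrow> last p = last q"
  by (induction rule: flip_equiv.induct) (auto dest: flip_equiv_length)

text \<open>Paths are lists read backwards: the head is the endpoint.\<close>

definition joins :: "'v \<Rightarrow> 'v list \<Rightarrow> 'v list \<Rightarrow> bool" where
  "joins x p p' \<longleftrightarrow> (hd p = hd p' \<and> flip_equiv p p') \<or>
     (\<exists>v q. sq v (hd p) x (hd p') \<and> flip_equiv p (hd p # v # q) \<and> flip_equiv p' (hd p' # v # q))"

text \<open>The squares below \<open>x\<close> provide two ways \<open>v\<close> and
  \<open>v'\<close> to descend from the middle endpoint, and the claim for shorter paths closes
  these to a third square there. Three squares at one vertex span a cube, and its far corner is a
  common descent of the two outer paths.\<close>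

lemma joins_trans:
  assumes IH: "\<And>y r r'. Suc (length r) = length p \<Longrightarrow> r \<noteq> [] \<Longrightarrow> flip_equiv (y # r) (y # r') \<Longrightarrow> joins y r r'"
    and 12: "joins x pa pb" and 23: "joins x pb pc"
    and len: "length pa = length p" "length pb = length p" "length pc = length p"
  shows "joins x pa pc"
proof -
  consider (eq1) "hd pa = hd pb" "flip_equiv pa pb" | (eq2) "hd pb = hd pc" "flip_equiv pb pc"
    | (sq) v q v' q' where "sq v (hd pa) x (hd pb)" "flip_equiv pa (hd pa # v # q)"
        "flip_equiv pb (hd pb # v # q)" "sq v' (hd pb) x (hd pc)" "flip_equiv pb (hd pb # v' # q')"
        "flip_equiv pc (hd pc # v' # q')"
    using 12 23 unfolding joins_def by metis
  then show ?thesis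
  proof cases
    case eq1
    then show ?thesis using 23 unfolding joins_def by (metis flip_equiv.fe_trans)
  next
    case eq2
    then show ?thesis using 12 unfolding joins_def
      by (metis flip_equiv.fe_trans flip_equiv_sym)
  next
    case sq
    define e f g where "e = hd pa" and "f = hd pb" and "g = hd pc"
    note s = sq[folded e_def f_def g_def]
    have "flip_equiv (f # v # q) (f # v' # q')"
      using s(3,5) flip_equiv.fe_trans flip_equiv_sym by blast
    moreover have "Suc (length (v # q)) = length p"
      using flip_equiv_length[OF s(3)] len by simp
    ultimately have "joins f (v # q) (v' # q')"
      by (intro IH) auto
    then consider (eq) "v = v'" "flip_equiv (v # q) (v' # q')"
      | (cube) y r where "sq y v f v'" "flip_equiv (v # q) (v # y # r)" "flip_equiv (v' # q') (v' # y # r)"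
      unfolding joins_def by auto
    then show ?thesis
    proof cases
      case eq
      \<comment> \<open>Three corners determine a square, so equal descents from the middle endpoint
        leave only one possible opposite corner.\<close>
      have "e = g"
        using s(1,4) eq(1) by (metis sq_unique sq_refl sq_rot)
      moreover have "flip_equiv pa pc"
        using s(2,6) eq \<open>e = g\<close> by (metis flip_equiv.fe_trans flip_equiv.fe_Cons flip_equiv_sym)
      ultimately show ?thesis
        unfolding joins_def e_def g_def by simp
    next
      case cube
      have "sq f v e x" "sq f v y v'" "sq f x g v'"
        using s(1,4) cube(1) sq_rot sq_refl by blast+
      \<comment> \<open>The three squares meet at \<open>f\<close> in the directions
        \<open>v\<close>, \<open>x\<close> and \<open>v'\<close>; \<open>w\<close> is the corner of
        their cube opposite to \<open>f\<close>.\<close>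
      then obtain w where w: "sq v e w y" "sq x e w g" "sq v' g w y"
        using sq_cube[of f v e x g v' y] sq_refl sq_rot by blast
      have "flip_equiv pa (e # v # y # r)"
        using s(2) cube(2) by (metis flip_equiv.fe_trans flip_equiv.fe_Cons)
      moreover have "flip_equiv (e # v # y # r) (e # w # y # r)"
        by (rule flip_equiv.fe_flip) (metis w(1) sq_rot sq_refl)
      ultimately have 1: "flip_equiv pa (e # w # y # r)"
        by (rule flip_equiv.fe_trans)
      have "flip_equiv pc (g # v' # y # r)"
        using s(6) cube(3) by (metis flip_equiv.fe_trans flip_equiv.fe_Cons)
      moreover have "flip_equiv (g # v' # y # r) (g # w # y # r)"
        by (rule flip_equiv.fe_flip) (metis w(3) sq_rot sq_refl)
      ultimately have 2: "flip_equiv pc (g # w # y # r)"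
        by (rule flip_equiv.fe_trans)
      have "sq w e x g"
        using w(2) sq_rot sq_refl by blast
      then show ?thesis
        using 1 2 unfolding joins_def e_def g_def by blast
    qed
  qed
qed

text \<open>Transitivity is the only critical rule, and it consumes the claim for paths that are one
  vertex shorter. Hence an induction on the length is wrapped around the rule induction; flips
  preserve the length, so the inner induction can keep it fixed as \<open>n\<close>.\<close>

lemma flip_equiv_joins:
  assumes "flip_equiv w w'" "w = x # p" "p \<noteq> []" "w' = x # p'"
  shows "joins x p p'"
  using assms
proof (induction "length p" arbitrary: x p p' w w' rule: less_induct)
  case less
  have IH: "joins y r r'" if "Suc (length r) = length p" "r \<noteq> []" "flip_equiv (y # r) (y # r')" for y r r'
    using less.hyps[of r "y # r" "y # r'" y r'] that by simp
  define n where "n = length p"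
  have "flip_equiv w w' \<Longrightarrow> \<forall>x p p'. w = x # p \<longrightarrow> p \<noteq> [] \<longrightarrow> w' = x # p' \<longrightarrow> length p = n \<longrightarrow> joins x p p'" for w w'
  proof (induction rule: flip_equiv.induct)
    case (fe_refl p)
    then show ?case by (auto simp: joins_def intro: flip_equiv.fe_refl)
  next
    case (fe_trans p1 p2 p3)
    show ?case
    proof (intro allI impI)
      fix x q1 q3 assume *: "p1 = x # q1" "q1 \<noteq> []" "p3 = x # q3" "length q1 = n"
      obtain q2 where q2: "p2 = x # q2"
        using flip_equiv_hd[OF fe_trans(1)] flip_equiv_length[OF fe_trans(1)] * by (cases p2) auto
      have l: "length q2 = n" "length q3 = n"
        using flip_equiv_length[OF fe_trans(1)] flip_equiv_length[OF fe_trans(2)] * q2 by auto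
      then have "q2 \<noteq> []" using * by auto
      show "joins x q1 q3"
        using joins_trans[OF IH, where x = x and pa = q1 and pb = q2 and pc = q3] fe_trans(3,4) * q2 l \<open>q2 \<noteq> []\<close> by (auto simp: n_def)
    qed
  next
    case (fe_Cons p q v)
    then show ?case by (auto simp: joins_def flip_equiv_hd)
  next
    case (fe_flip v u x a p)
    then show ?case by (auto simp: joins_def intro!: flip_equiv.fe_refl exI[of _ v])
  qed
  then show ?case using less.prems n_def by blast
qed

lemma flip_equiv_ConsD: "flip_equiv (x # p) (x # p') \<Longrightarrow> p \<noteq> [] \<Longrightarrow> joins x p p'"
  using flip_equiv_joins by blast

text \<open>In the other alternative of \<open>joins\<close> the two heads are opposite corners of a
  square and therefore distinct.\<close>

lemma flip_equiv_cancel: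
  assumes "flip_equiv (x # p) (x # p')" "p \<noteq> []" "hd p = hd p'"
  shows "flip_equiv p p'"
  using flip_equiv_ConsD[OF assms(1,2)] assms(3) sq_diagonals unfolding joins_def by metis

lemma flip_equiv_diamond:
  assumes "flip_equiv (x # a # p) (x # b # p')" "a \<noteq> b"
  obtains v q where "sq v a x b" "flip_equiv (a # p) (a # v # q)" "flip_equiv (b # p') (b # v # q)"
  using flip_equiv_ConsD[OF assms(1)] assms(2) unfolding joins_def by auto

section \<open>Reduced edge paths\<close>

definition down :: "'v list \<Rightarrow> 'v set" where
  "down p = {u. \<exists>q. flip_equiv p (hd p # u # q)}"

lemma down_cong: "flip_equiv p p' \<Longrightarrow> down p = down p'"
  unfolding down_def by (metis flip_equiv_sym flip_equiv.fe_trans flip_equiv_hd)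

text \<open>Whether a step may be added depends on the flip class and not on the path: it is
  forbidden as soon as some representative arrives from the vertex to which the step would
  return.\<close>

inductive reduced :: "'v list \<Rightarrow> bool" where
  single: "reduced [v]"
| step: "reduced (v # p) \<Longrightarrow> adj v w \<Longrightarrow> w \<notin> down (v # p) \<Longrightarrow> reduced (w # v # p)"

inductive_cases reduced_CCE: "reduced (w # v # p)"

lemma reduced_tl: "reduced (w # p) \<Longrightarrow> p \<noteq> [] \<Longrightarrow> reduced p"
  by (cases p) (auto elim: reduced_CCE)

lemma reduced_ne: "reduced p \<Longrightarrow> p \<noteq> []"
  by (auto elim: reduced.cases)

text \<open>If the flipped path had a cancelling step, then a flip through the same square,
  respectively the diamond over \<open>a\<close>, would exhibit a cancelling step in the original
  path.\<close>

lemma not_down_flip: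
  assumes "sq v u x a" "u \<notin> down (v # p)" "x \<notin> down (u # v # p)"
  shows "a \<notin> down (v # p)" "x \<notin> down (a # v # p)"
proof -
  show a: "a \<notin> down (v # p)"
  proof
    assume "a \<in> down (v # p)"
    then obtain r where "flip_equiv (v # p) (v # a # r)" unfolding down_def by auto
    then have "flip_equiv (u # v # p) (u # v # a # r)" by (rule flip_equiv.fe_Cons)
    moreover have "flip_equiv (u # v # a # r) (u # x # a # r)"
      by (rule flip_equiv.fe_flip) (metis assms(1) sq_rot sq_refl)
    ultimately show False
      using assms(3) unfolding down_def by (auto dest: flip_equiv.fe_trans)
  qed
  show "x \<notin> down (a # v # p)"
  proof
    assume "x \<in> down (a # v # p)"
    then obtain r where r: "flip_equiv (a # v # p) (a # x # r)" unfolding down_def by auto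
    have "v \<noteq> x" using assms(1) sq_diagonals by blast
    then obtain y q where "sq y v a x" "flip_equiv (v # p) (v # y # q)"
      using flip_equiv_diamond[OF r] by metis
    moreover have "sq v a x u" using assms(1) sq_refl by blast
    ultimately have "flip_equiv (v # p) (v # u # q)"
      using sq_unique sq_rot by metis
    then show False using assms(2) unfolding down_def by auto
  qed
qed

lemma reduced_cong_aux: "flip_equiv p p' \<Longrightarrow> reduced p \<longleftrightarrow> reduced p'"
proof (induction rule: flip_equiv.induct)
  case (fe_Cons p q v)
  have dn: "down p = down q" "hd p = hd q" "length p = length q"
    using down_cong[OF fe_Cons(1)] flip_equiv_hd[OF fe_Cons(1)] flip_equiv_length[OF fe_Cons(1)] by auto
  show ?case
  proof (cases p)
    case Nil
    then show ?thesis using dn by simp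
  next
    case (Cons a p')
    then obtain q' where "q = a # q'" using dn by (cases q) auto
    then show ?thesis using Cons dn fe_Cons.IH
      by (auto elim!: reduced_CCE intro!: reduced.step)
  qed
next
  case (fe_flip v u x a p)
  have "reduced (x # a # v # p)" if "reduced (x # u # v # p)" "sq v u x a" for x u v p a
  proof -
    have "reduced (v # p)" "u \<notin> down (v # p)" "x \<notin> down (u # v # p)"
      using that(1) by (auto elim!: reduced_CCE)
    then show ?thesis
      using not_down_flip[OF that(2)] sq_sides[OF that(2)] by (auto intro!: reduced.step adj_sym)
  qed
  then show ?case using fe_flip sq_refl by blast
qed auto

lemma reduced_cong: "flip_equiv p p' \<Longrightarrow> reduced p \<Longrightarrow> reduced p'"
  using reduced_cong_aux by blast

section \<open>The local system of classes of reduced paths\<close>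

definition path_class :: "'v list \<Rightarrow> 'v list set" where
  "path_class p = {q. flip_equiv p q}"

lemma path_class_eq: "path_class p = path_class q \<longleftrightarrow> flip_equiv p q"
  unfolding path_class_def
  by (metis flip_equiv.fe_refl flip_equiv.fe_trans flip_equiv_sym mem_Collect_eq subsetI subset_antisym)

definition fibre :: "'v \<Rightarrow> 'v \<Rightarrow> 'v list set set" where
  "fibre b v = {path_class p |p. reduced p \<and> hd p = v \<and> last p = b}"

text \<open>Continuation of a class across the edge from \<open>v\<close> to \<open>w\<close>: the
  last step is deleted if some representative arrives from \<open>w\<close>, and a step to
  \<open>w\<close> is appended otherwise. The chosen representative in the second branch is
  immaterial, since appending respects flips.\<close>

definition move :: "'v \<Rightarrow> 'v \<Rightarrow> 'v list set \<Rightarrow> 'v list set" where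
  "move v w X = (if \<exists>q. v # w # q \<in> X then {r. v # r \<in> X \<and> hd r = w \<and> r \<noteq> []} else path_class (w # (SOME p. p \<in> X)))"

text \<open>Cancellation is what makes the set in the deleting branch of \<open>move\<close> a
  single flip class.\<close>

lemma move_down:
  assumes "flip_equiv p (v # w # q)"
  shows "move v w (path_class p) = path_class (w # q)"
proof -
  have "{r. v # r \<in> path_class p \<and> hd r = w \<and> r \<noteq> []} = path_class (w # q)"
  proof safe
    fix r assume r: "v # r \<in> path_class p" "w = hd r" "r \<noteq> []"
    then have "flip_equiv (v # w # q) (v # r)"
      using assms unfolding path_class_def by (metis flip_equiv.fe_trans flip_equiv_sym mem_Collect_eq)
    then show "r \<in> path_class (hd r # q)"
      using flip_equiv_cancel r unfolding path_class_def by fastforce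
  next
    fix r assume "r \<in> path_class (w # q)"
    then have r: "flip_equiv (w # q) r" by (simp add: path_class_def)
    then show "v # r \<in> path_class p"
      using assms unfolding path_class_def by (metis flip_equiv.fe_Cons flip_equiv.fe_trans mem_Collect_eq)
    show "hd r = w" using flip_equiv_hd[OF r] by simp
  next
    assume "[] \<in> path_class (w # q)" then show False
      by (auto simp: path_class_def dest: flip_equiv_length)
  qed
  moreover have "v # w # q \<in> path_class p" using assms by (simp add: path_class_def)
  ultimately show ?thesis unfolding move_def by auto
qed

lemma move_up:
  assumes "hd p = v" "w \<notin> down p"
  shows "move v w (path_class p) = path_class (w # p)"
proof -
  have "\<not> (\<exists>q. v # w # q \<in> path_class p)"
    using assms unfolding down_def path_class_def by auto
  moreover have "(SOME q. q \<in> path_class p) \<in> path_class p"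
    by (rule someI[of _ p]) (simp add: path_class_def flip_equiv.fe_refl)
  then have "path_class (w # (SOME q. q \<in> path_class p)) = path_class (w # p)"
    unfolding path_class_eq by (simp add: path_class_def flip_equiv.fe_Cons flip_equiv_sym)
  ultimately show ?thesis unfolding move_def by simp
qed

lemma reduced_cases:
  assumes "reduced p" "hd p = v"
  obtains (up) "w \<notin> down p" | (dn) q where "flip_equiv p (v # w # q)" "reduced (v # w # q)"
  using assms reduced_cong unfolding down_def by blast

text \<open>An appended step can be deleted again, and a step deleted from a reduced path may be
  appended again; so the moves across an edge in its two directions are mutually inverse.\<close>

lemma move_fibre:
  assumes "X \<in> fibre b v" "adj v w"
  shows "move v w X \<in> fibre b w" "move w v (move v w X) = X"
proof -
  obtain p where p: "X = path_class p" "reduced p" "hd p = v" "last p = b"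
    using assms unfolding fibre_def by auto
  have "move v w X \<in> fibre b w \<and> move w v (move v w X) = X"
    using p(2,3)
  proof (cases rule: reduced_cases[where w=w])
    case up
    have m: "move v w X = path_class (w # p)" using move_up p up by simp
    obtain p' where p': "p = v # p'" using p(2,3) reduced_ne by (cases p) auto
    have "reduced (w # p)" using p p' up assms(2) by (auto intro: reduced.step)
    moreover have "move w v (path_class (w # p)) = path_class p"
      using move_down[of "w # p" w v p'] p' flip_equiv.fe_refl by auto
    ultimately show ?thesis using m p p' unfolding fibre_def by auto
  next
    case (dn q)
    have m: "move v w X = path_class (w # q)" using move_down p dn by simp
    have "reduced (w # q)" "v \<notin> down (w # q)" using dn(2) by (auto elim: reduced_CCE)
    moreover have "last (w # q) = b" using flip_equiv_last[OF dn(1)] p by simp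
    moreover have "path_class (v # w # q) = path_class p"
      using dn(1) path_class_eq flip_equiv_sym by blast
    ultimately show ?thesis using m p move_up[of "w # q" w v] unfolding fibre_def by auto
  qed
  then show "move v w X \<in> fibre b w" "move w v (move v w X) = X" by auto
qed

text \<open>If the route over \<open>u\<close> appends twice, then so does the route over
  \<open>a\<close>, and the results differ by one flip. If it appends and then deletes, the diamond
  over \<open>u\<close> shows that the other route deletes and then appends, with the same
  outcome.\<close>

lemma move_flat_up:
  assumes p: "reduced p" "hd p = v" and sq: "sq v u x a" and u: "u \<notin> down p"
  shows "move u x (move v u (path_class p)) = move a x (move v a (path_class p))"
proof -
  obtain p' where p': "p = v # p'" using p reduced_ne by (cases p) auto
  have up: "move v u (path_class p) = path_class (u # p)" using move_up u p by simp
  have red: "reduced (u # p)" using p p' u sq_sides[OF sq] by (auto intro: reduced.step)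
  show ?thesis
  proof (cases "x \<in> down (u # p)")
    case False
    have "a \<notin> down p" "x \<notin> down (a # p)"
      using not_down_flip sq u False p' by auto
    then have "move a x (move v a (path_class p)) = path_class (x # a # p)"
      using move_up[of p v a] move_up[of "a # p" a x] p by simp
    moreover have "move u x (move v u (path_class p)) = path_class (x # u # p)"
      using up move_up[of "u # p" u x] False by simp
    ultimately show ?thesis
      using flip_equiv.fe_flip[OF sq] p' path_class_eq by auto
  next
    case True
    then obtain r where r: "flip_equiv (u # v # p') (u # x # r)" using p' unfolding down_def by auto
    obtain y q where q: "sq y v u x" "flip_equiv (v # p') (v # y # q)" "flip_equiv (x # r) (x # y # q)"
      using flip_equiv_diamond[OF r] sq_diagonals[OF sq] by metis
    have "y = a" using q(1) sq by (metis sq_unique sq_rot)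
    note q = q[unfolded this]
    have l: "move u x (move v u (path_class p)) = path_class (x # a # q)"
      using up move_down[of "u # p" u x "a # q"] r q(3) p'
      by (metis flip_equiv.fe_Cons flip_equiv.fe_trans)
    have dn: "move v a (path_class p) = path_class (a # q)" using move_down q(2) p' by simp
    have "reduced (u # x # a # q)"
      using red r q(3) p' by (metis reduced_cong flip_equiv.fe_Cons flip_equiv.fe_trans)
    then have "x \<notin> down (a # q)" by (auto elim!: reduced_CCE)
    then have "move a x (path_class (a # q)) = path_class (x # a # q)" by (intro move_up) auto
    then show ?thesis using l dn by simp
  qed
qed

text \<open>When the steps to \<open>u\<close> and to \<open>a\<close> both delete, the diamond over
  \<open>v\<close> is a square on \<open>u\<close>, \<open>v\<close>, \<open>a\<close>, whose fourth
  corner can only be \<open>x\<close>.\<close>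

lemma move_flat:
  assumes X: "X \<in> fibre b v" and sq: "sq v u x a"
  shows "move u x (move v u X) = move a x (move v a X)"
proof -
  obtain p where p: "X = path_class p" "reduced p" "hd p = v"
    using X unfolding fibre_def by auto
  consider "u \<notin> down p" | "a \<notin> down p" | "u \<in> down p" "a \<in> down p" by blast
  then show ?thesis
  proof cases
    case 1
    then show ?thesis using move_flat_up[OF p(2,3) sq] p(1) by simp
  next
    case 2
    then show ?thesis using move_flat_up[OF p(2,3) sq_refl[OF sq]] p(1) by simp
  next
    case 3
    then obtain q r where q: "flip_equiv p (v # u # q)" "flip_equiv p (v # a # r)"
      using p(3) unfolding down_def by auto
    then have "flip_equiv (v # u # q) (v # a # r)"
      using flip_equiv.fe_trans flip_equiv_sym by blast
    then obtain y t where t: "sq y u v a" "flip_equiv (u # q) (u # y # t)" "flip_equiv (a # r) (a # y # t)"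
      using flip_equiv_diamond sq_diagonals[OF sq] by metis
    have "y = x" using t(1) sq by (metis sq_unique sq_rot sq_refl)
    note t = t[unfolded this]
    have "move v u X = path_class (u # q)" "move v a X = path_class (a # r)"
      using p q move_down by auto
    then show ?thesis using move_down[OF t(2)] move_down[OF t(3)] by simp
  qed
qed

text \<open>Along a reduced path a flat section that starts with the trivial path can only append.
  Its value at a vertex is thus the class of every reduced path ending there, and this is how a
  global section forces uniqueness.\<close>

lemma section_reduced:
  assumes s: "\<And>v w. adj v w \<Longrightarrow> s w = move v w (s v)" "s b = path_class [b]"
    and "reduced p" "last p = b"
  shows "s (hd p) = path_class p"
  using assms(3,4)
proof (induction rule: reduced.induct)
  case (single v)
  then show ?case using s by simp
next
  case (step v p w)
  then have "s w = move v w (path_class (v # p))" using s(1)[of v w] by simp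
  also have "\<dots> = path_class (w # v # p)" using step by (intro move_up) auto
  finally show ?case by simp
qed

lemma reduced_single_fibre: "path_class [b] \<in> fibre b b"
  unfolding fibre_def by (auto intro!: exI[of _ "[b]"] reduced.single)

end

section \<open>Cubes, squares and links\<close>

abbreviation adjacent :: "'v set set \<Rightarrow> 'v \<Rightarrow> 'v \<Rightarrow> bool" where
  "adjacent K u v \<equiv> {u, v} \<in> edges K"

definition square :: "'v set set \<Rightarrow> 'v \<Rightarrow> 'v \<Rightarrow> 'v \<Rightarrow> 'v \<Rightarrow> bool" where
  "square K a b c d \<longleftrightarrow> {a, b, c, d} \<in> K \<and> card {a, b, c, d} = 4 \<and>
     adjacent K a b \<and> adjacent K b c \<and> adjacent K c d \<and> adjacent K d a"

lemma adjacent_sym: "adjacent K u v \<Longrightarrow> adjacent K v u"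
  by (simp add: insert_commute)

lemma adjacent_neq: "adjacent K u v \<Longrightarrow> u \<noteq> v"
  by (auto simp: edges_def)

lemma adjacent_vertices: "adjacent K u v \<Longrightarrow> u \<in> vertices K \<and> v \<in> vertices K"
  by (auto simp: edges_def vertices_def)

lemma square_rotate: "square K a b c d \<Longrightarrow> square K b c d a"
  unfolding square_def by (simp add: insert_commute)

lemma square_reflect: "square K a b c d \<Longrightarrow> square K a d c b"
  unfolding square_def by (simp add: insert_commute)

lemma square_distinct: "square K a b c d \<Longrightarrow> distinct [a, b, c, d]"
  unfolding square_def by (auto simp: card_insert_if split: if_splits)

section \<open>Charts of cubes\<close>

lemma sym_diff_interval:
  assumes "I \<subseteq> J"
  shows "(\<lambda>X. sym_diff X A) ` {I..J} = {sym_diff I A \<inter> sym_diff J A..sym_diff I A \<union> sym_diff J A}"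
proof -
  have "Y \<in> (\<lambda>X. sym_diff X A) ` {I..J}"
    if "Y \<in> {sym_diff I A \<inter> sym_diff J A..sym_diff I A \<union> sym_diff J A}" for Y
    using that assms by (intro image_eqI[of _ _ "sym_diff Y A"]) auto
  moreover have "sym_diff X A \<in> {sym_diff I A \<inter> sym_diff J A..sym_diff I A \<union> sym_diff J A}"
    if "X \<in> {I..J}" for X
    using that by auto
  ultimately show ?thesis by blast
qed

lemma sym_diff_std_cube_faces:
  assumes "A \<subseteq> {..<n}" "F \<in> std_cube_faces n"
  shows "(\<lambda>X. sym_diff X A) ` F \<in> std_cube_faces n"
proof -
  obtain I J where IJ: "F = {I..J}" "I \<subseteq> J" "J \<subseteq> {..<n}"
    using assms(2) unfolding std_cube_faces_def by blast
  show ?thesis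
    unfolding IJ(1) sym_diff_interval[OF IJ(2)] std_cube_faces_def
    using IJ(2,3) assms(1) by blast
qed

text \<open>Switching the coordinates in \<open>A\<close> is an involution of the standard cube that
  preserves faces and exchanges \<open>A\<close> with the origin. Arguments at a vertex may
  therefore assume that its label is \<open>{}\<close>.\<close>

lemma cube_chart_recenter:
  assumes c: "cube_chart K n c C" and A: "A \<subseteq> {..<n}"
  shows "cube_chart K n (\<lambda>I. c (sym_diff I A)) C"
proof -
  define T where "T X = sym_diff X A" for X
  have TT: "T (T X) = X" for X unfolding T_def by auto
  have TP: "T ` Pow {..<n} = Pow {..<n}"
  proof -
    have "T X \<in> Pow {..<n}" if "X \<in> Pow {..<n}" for X using that A unfolding T_def by auto
    then show ?thesis using TT by (metis image_subsetI imageI subsetI subset_antisym)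
  qed
  have "inj_on (\<lambda>I. c (T I)) (Pow {..<n})"
  proof -
    have "inj_on T (Pow {..<n})" by (rule inj_on_inverseI[of _ T]) (rule TT)
    moreover have "inj_on c (T ` Pow {..<n})" using c unfolding TP cube_chart_def by blast
    ultimately show ?thesis using comp_inj_on unfolding comp_def by blast
  qed
  moreover have "(\<lambda>I. c (T I)) ` Pow {..<n} = C"
    using c unfolding cube_chart_def image_image[of c T, symmetric] TP by blast
  moreover have "(\<lambda>F. (\<lambda>I. c (T I)) ` F) ` std_cube_faces n = (\<lambda>F. c ` F) ` std_cube_faces n"
  proof -
    have "(\<lambda>F. T ` F) ` std_cube_faces n = std_cube_faces n"
    proof -
      have T: "T ` F \<in> std_cube_faces n" if "F \<in> std_cube_faces n" for F
        using sym_diff_std_cube_faces[OF A that] unfolding T_def .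
      have TT': "T ` (T ` F) = F" for F by (simp add: image_image TT)
      show ?thesis
      proof (intro subset_antisym subsetI)
        show "F \<in> (\<lambda>F. T ` F) ` std_cube_faces n" if "F \<in> std_cube_faces n" for F
          using T[OF that] TT'[of F] by (metis imageI)
      qed (use T in auto)
    qed
    moreover have "(\<lambda>F. c ` F) ` ((\<lambda>F. T ` F) ` std_cube_faces n) =
        (\<lambda>F. (\<lambda>I. c (T I)) ` F) ` std_cube_faces n"
      by (simp add: image_image)
    ultimately show ?thesis by simp
  qed
  ultimately show ?thesis using c unfolding cube_chart_def T_def by simp
qed

context
  fixes K :: "'v set set"
  assumes cub: "cubical_complex K"
begin

lemma cube_inter: "C \<in> K \<Longrightarrow> D \<in> K \<Longrightarrow> v \<in> C \<Longrightarrow> v \<in> D \<Longrightarrow> C \<inter> D \<in> K"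
  using cub unfolding cubical_complex_def by blast

lemma cube_chart_at:
  assumes "C \<in> K" "v \<in> C"
  obtains n c where "cube_chart K n c C" "c {} = v"
proof -
  obtain n c where c: "cube_chart K n c C"
    using cub assms(1) unfolding cubical_complex_def by blast
  then obtain A where "A \<subseteq> {..<n}" "c A = v"
    using assms(2) unfolding cube_chart_def by blast
  have "sym_diff {} A = A" by simp
  then show ?thesis using that[OF cube_chart_recenter[OF c \<open>A \<subseteq> {..<n}\<close>]] \<open>c A = v\<close> by simp
qed

end

lemma cube_chart_mem: "cube_chart K n c C \<Longrightarrow> I \<subseteq> {..<n} \<Longrightarrow> c I \<in> C"
  unfolding cube_chart_def by blast

lemma cube_chart_eq_iff:
  "cube_chart K n c C \<Longrightarrow> I \<subseteq> {..<n} \<Longrightarrow> J \<subseteq> {..<n} \<Longrightarrow> c I = c J \<longleftrightarrow> I = J"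
  unfolding cube_chart_def by (auto dest: inj_onD)

lemma cube_chart_card: "cube_chart K n c C \<Longrightarrow> finite C \<and> card C = 2 ^ n"
  unfolding cube_chart_def by (metis card_Pow card_image card_lessThan finite_Pow_iff finite_imageI finite_lessThan)

lemma cube_chart_face:
  assumes "cube_chart K n c C" "I \<subseteq> J" "J \<subseteq> {..<n}"
  shows "c ` {I..J} \<in> K"
  using assms unfolding cube_chart_def std_cube_faces_def by blast

lemma cube_chart_subcube:
  assumes "cube_chart K n c C" "D \<in> K" "D \<subseteq> C"
  obtains I J where "I \<subseteq> J" "J \<subseteq> {..<n}" "D = c ` {I..J}"
proof -
  have "D \<in> (\<lambda>F. c ` F) ` std_cube_faces n" using assms unfolding cube_chart_def by blast
  then show ?thesis using that unfolding std_cube_faces_def by blast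
qed

lemma cube_chart_edge:
  assumes c: "cube_chart K n c C" and "I \<subseteq> {..<n}" "j < n" "j \<notin> I"
  shows "adjacent K (c I) (c (insert j I))"
proof -
  have "{I..insert j I} = {I, insert j I}" by auto
  then have "{c I, c (insert j I)} \<in> K"
    using cube_chart_face[OF c, of I "insert j I"] assms by auto
  moreover have "c I \<noteq> c (insert j I)"
    using cube_chart_eq_iff[OF c, of I "insert j I"] assms by auto
  ultimately show ?thesis unfolding edges_def by auto
qed

text \<open>An edge is a face \<open>{I..J}\<close> with two elements; if \<open>J\<close> had a
  further coordinate besides \<open>j\<close>, then \<open>insert j I\<close> would be a third
  vertex of this face.\<close>

lemma cube_chart_edgeE:
  assumes c: "cube_chart K n c C" and e: "adjacent K u w" "u \<in> C" "w \<in> C"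
  obtains I j where "I \<subseteq> {..<n}" "j < n" "j \<notin> I" "{u, w} = {c I, c (insert j I)}"
proof -
  have "{u, w} \<in> K" "{u, w} \<subseteq> C" using e by (auto simp: edges_def)
  then obtain I J where IJ: "I \<subseteq> J" "J \<subseteq> {..<n}" "{u, w} = c ` {I..J}"
    by (rule cube_chart_subcube[OF c])
  have "{I..J} \<subseteq> Pow {..<n}" using order_trans[OF _ IJ(2)] by fastforce
  then have "inj_on c {I..J}"
    using c unfolding cube_chart_def by (blast intro: inj_on_subset)
  then have two: "card {I..J} = 2"
    using e(1) IJ(3) unfolding edges_def by (metis (mono_tags, lifting) card_image mem_Collect_eq)
  then have "I \<noteq> J" by auto
  then obtain j where j: "j \<in> J" "j \<notin> I" using IJ by blast
  have "J = insert j I"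
  proof (rule ccontr)
    assume "J \<noteq> insert j I"
    then have "card {I, insert j I, J} = 3" using j \<open>I \<noteq> J\<close> by (auto simp: card_insert_if)
    moreover have "{I, insert j I, J} \<subseteq> {I..J}" using IJ j by auto
    moreover have "finite {I..J}" using two by (metis card.infinite zero_neq_numeral)
    ultimately have "3 \<le> card {I..J}" using card_mono by metis
    then show False using two by simp
  qed
  then have "{I..J} = {I, insert j I}" by auto
  then show ?thesis using that[of I j] IJ j by auto
qed

lemma cube_chart_edge_at:
  assumes c: "cube_chart K n c C" "c {} = v" and e: "adjacent K v w" "w \<in> C"
  obtains j where "j < n" "w = c {j}"
proof -
  have "v \<in> C" using cube_chart_mem[OF c(1), of "{}"] c(2) by simp
  then obtain I j where I: "I \<subseteq> {..<n}" "j < n" "j \<notin> I" "{v, w} = {c I, c (insert j I)}"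
    using cube_chart_edgeE[OF c(1) e(1) _ e(2)] by metis
  have "c {} \<noteq> c (insert j I)" using cube_chart_eq_iff[OF c(1), of "{}" "insert j I"] I by auto
  then have "c {} = c I" "w = c (insert j I)" using I(4) c(2) by (auto simp: doubleton_eq_iff)
  then have "I = {}" using cube_chart_eq_iff[OF c(1), of "{}" I] I by auto
  then show ?thesis using that I \<open>w = _\<close> by simp
qed

lemma cube_chart_star:
  assumes c: "cube_chart K n c C" "c {} = v"
  shows "{e \<in> edges K. v \<in> e \<and> e \<subseteq> C} = (\<lambda>j. {v, c {j}}) ` {..<n}"
proof (intro subset_antisym subsetI)
  fix e assume "e \<in> {e \<in> edges K. v \<in> e \<and> e \<subseteq> C}"
  then have e: "e \<in> edges K" "v \<in> e" "e \<subseteq> C" by auto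
  then have "card e = 2" by (simp add: edges_def)
  then obtain w where w: "e = {v, w}" using e(2) by (metis card_2_iff doubleton_eq_iff insertE singletonD)
  then obtain j where "j < n" "w = c {j}" using cube_chart_edge_at[OF c] e by blast
  then show "e \<in> (\<lambda>j. {v, c {j}}) ` {..<n}" using w by blast
next
  fix e assume "e \<in> (\<lambda>j. {v, c {j}}) ` {..<n}"
  then obtain j where j: "j < n" "e = {v, c {j}}" by blast
  then show "e \<in> {e \<in> edges K. v \<in> e \<and> e \<subseteq> C}"
    using cube_chart_edge[OF c(1), of "{}" j] cube_chart_mem[OF c(1), of "{}"]
      cube_chart_mem[OF c(1), of "{j}"] c(2) by auto
qed

lemma card_four:
  "a \<noteq> b \<Longrightarrow> a \<noteq> c \<Longrightarrow> a \<noteq> d \<Longrightarrow> b \<noteq> c \<Longrightarrow> b \<noteq> d \<Longrightarrow> c \<noteq> d \<Longrightarrow> card {a, b, c, d} = 4"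
  by simp

lemma cube_chart_square:
  assumes c: "cube_chart K n c C" and I: "I \<subseteq> {..<n}" "j < n" "k < n" "j \<notin> I" "k \<notin> I" "j \<noteq> k"
  shows "square K (c I) (c (insert j I)) (c (insert k (insert j I))) (c (insert k I))"
proof -
  have "{I..insert k (insert j I)} = {I, insert j I, insert k (insert j I), insert k I}"
  proof -
    have "X \<in> {I, insert j I, insert k (insert j I), insert k I}"
      if "X \<in> {I..insert k (insert j I)}" for X
      using that by (cases "j \<in> X"; cases "k \<in> X") auto
    moreover have "{I, insert j I, insert k (insert j I), insert k I} \<subseteq> {I..insert k (insert j I)}"
      by auto
    ultimately show ?thesis by blast
  qed
  then have "{c I, c (insert j I), c (insert k (insert j I)), c (insert k I)} \<in> K"
    using cube_chart_face[OF c, of I "insert k (insert j I)"] I by auto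
  moreover have "card {c I, c (insert j I), c (insert k (insert j I)), c (insert k I)} = 4"
  proof -
    have eq: "c I \<noteq> c J'" if "\<exists>i<n. i \<in> I \<longleftrightarrow> i \<notin> J'" "I \<subseteq> {..<n}" "J' \<subseteq> {..<n}" for I J'
      using cube_chart_eq_iff[OF c that(2,3)] that(1) by blast
    have "c I \<noteq> c (insert j I)" "c I \<noteq> c (insert k (insert j I))" "c I \<noteq> c (insert k I)"
      "c (insert j I) \<noteq> c (insert k (insert j I))" "c (insert j I) \<noteq> c (insert k I)"
      "c (insert k (insert j I)) \<noteq> c (insert k I)"
      by (rule eq; use I in blast)+
    then show ?thesis by (rule card_four)
  qed
  moreover have "adjacent K (c (insert k I)) (c (insert k (insert j I)))"
    using cube_chart_edge[OF c, of "insert k I" j] I by (simp add: insert_commute)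
  ultimately show ?thesis
    unfolding square_def
    using cube_chart_edge[OF c, of I j] cube_chart_edge[OF c, of "insert j I" k]
      cube_chart_edge[OF c, of I k] I by (auto simp: insert_commute)
qed

section \<open>Squares and flag links\<close>

context
  fixes K :: "'v set set"
  assumes cub: "cubical_complex K"
begin

lemma square_chart:
  assumes "square K v a x b"
  obtains c where "cube_chart K 2 c {v, a, x, b}" "c {} = v"
proof -
  have C: "{v, a, x, b} \<in> K" and 4: "card {v, a, x, b} = 4"
    using assms unfolding square_def by auto
  obtain n c where c: "cube_chart K n c {v, a, x, b}" "c {} = v"
    using cube_chart_at[OF cub C, of v] by blast
  have "(2::nat) ^ n = 2 ^ 2" using cube_chart_card[OF c(1)] 4 by simp
  then have "n = 2" using power_inject_exp[of "2::nat" n 2] by simp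
  then show ?thesis using that c by blast
qed

text \<open>The two squares meet in a cube with at least three vertices. The number of vertices of a
  cube is a power of two, hence at least four here, and the intersection is all of either
  square.\<close>

lemma square_unique:
  assumes "square K a b c d" "square K a b c d'"
  shows "d = d'"
proof -
  let ?S = "{a, b, c, d}" and ?S' = "{a, b, c, d'}"
  have S: "?S \<in> K" "?S' \<in> K" "card ?S = 4" "card ?S' = 4" using assms unfolding square_def by auto
  have "?S \<inter> ?S' \<in> K" using cube_inter[OF cub S(1,2), of a] by simp
  then obtain n e where "cube_chart K n e (?S \<inter> ?S')"
    using cub unfolding cubical_complex_def by blast
  then have n: "card (?S \<inter> ?S') = 2 ^ n" using cube_chart_card by blast
  have "card {a, b, c} \<le> card (?S \<inter> ?S')" by (rule card_mono) auto
  moreover have "card {a, b, c} = 3" using square_distinct[OF assms(1)] by simp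
  ultimately have "3 \<le> (2::nat) ^ n" using n by simp
  moreover have "(2::nat) ^ n \<noteq> 3" by (cases n) (auto, presburger)
  ultimately have "4 \<le> card (?S \<inter> ?S')" using n by simp
  then have "?S \<inter> ?S' = ?S"
    using S(3) by (intro card_seteq) auto
  then show ?thesis using square_distinct[OF assms(1)] by auto
qed

lemma square_star:
  assumes "square K v a x b"
  shows "{e \<in> edges K. v \<in> e \<and> e \<subseteq> {v, a, x, b}} = {{v, a}, {v, b}}"
proof -
  obtain c where c: "cube_chart K 2 c {v, a, x, b}" "c {} = v"
    using square_chart[OF assms] .
  have adj: "adjacent K v a" "adjacent K v b"
    using assms unfolding square_def by (auto simp: insert_commute)
  obtain i j where i: "i < 2" "a = c {i}" and j: "j < 2" "b = c {j}"
    using cube_chart_edge_at[OF c adj(1)] cube_chart_edge_at[OF c adj(2)] by (metis insert_iff)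
  have "i \<noteq> j" using i j square_distinct[OF assms] by auto
  then have 2: "{..<2} = {i, j}" using i(1) j(1) by auto
  have "(\<lambda>j. {v, c {j}}) ` {..<2} = {{v, a}, {v, b}}" unfolding 2 i(2) j(2) by simp
  then show ?thesis using cube_chart_star[OF c] by (rule trans[rotated])
qed

lemma vertex_link_edge:
  assumes "adjacent K v a"
  shows "{{v, a}} \<in> vertex_link K v"
proof -
  have "{e \<in> edges K. v \<in> e \<and> e \<subseteq> {v, a}} = {{v, a}}"
  proof -
    have "e = {v, a}" if "e \<in> edges K" "e \<subseteq> {v, a}" for e
      using that adjacent_neq[OF assms] unfolding edges_def
      by (metis (mono_tags, lifting) card_2_iff card_subset_eq finite.emptyI finite_insert mem_Collect_eq)
    then show ?thesis using assms by auto
  qed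
  moreover have "{v, a} \<in> K" using assms by (simp add: edges_def)
  ultimately show ?thesis unfolding vertex_link_def by blast
qed

lemma vertex_link_square:
  assumes "square K v a x b"
  shows "{{v, a}, {v, b}} \<in> vertex_link K v"
proof -
  have "{v, a, x, b} \<in> K" using assms unfolding square_def by blast
  then have "{e \<in> edges K. v \<in> e \<and> e \<subseteq> {v, a, x, b}} \<in> vertex_link K v"
    unfolding vertex_link_def by (intro CollectI exI[of _ "{v, a, x, b}"]) simp
  then show ?thesis by (simp only: square_star[OF assms])
qed

text \<open>The squares join the edges from \<open>v\<close> to \<open>S\<close> pairwise in the
  link, so flagness makes these edges one simplex, and a simplex of the link is the set of all edges
  at \<open>v\<close> inside some cube. Counting them gives the dimension of that cube.\<close>

lemma flag_cube:
  assumes flag: "flag_complex (vertex_link K v)" and fin: "finite S"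
    and nbr: "\<And>a. a \<in> S \<Longrightarrow> adjacent K v a"
    and sq: "\<And>a b. a \<in> S \<Longrightarrow> b \<in> S \<Longrightarrow> a \<noteq> b \<Longrightarrow> \<exists>x. square K v a x b"
  obtains n c C where "C \<in> K" "cube_chart K n c C" "c {} = v" "S = (\<lambda>j. c {j}) ` {..<n}"
    "card S = n"
proof -
  define E where "E = (\<lambda>a. {v, a}) ` S"
  have "E \<in> vertex_link K v"
  proof -
    have "E \<subseteq> \<Union> (vertex_link K v)" using vertex_link_edge nbr unfolding E_def by blast
    moreover have "{e, f} \<in> vertex_link K v" if ef: "e \<in> E" "f \<in> E" "e \<noteq> f" for e f
    proof -
      obtain a b where "a \<in> S" "b \<in> S" "e = {v, a}" "f = {v, b}" using ef unfolding E_def by blast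
      then show ?thesis using vertex_link_square sq ef(3) by metis
    qed
    moreover have "finite E" using fin unfolding E_def by simp
    ultimately have "finite E \<and> E \<subseteq> \<Union> (vertex_link K v) \<and>
        (\<forall>e\<in>E. \<forall>f\<in>E. e \<noteq> f \<longrightarrow> {e, f} \<in> vertex_link K v)" by blast
    then show ?thesis by (rule flag[unfolded flag_complex_def, THEN spec, THEN mp])
  qed
  then obtain C where C: "C \<in> K" "v \<in> C" "E = {e \<in> edges K. v \<in> e \<and> e \<subseteq> C}"
    unfolding vertex_link_def by (elim CollectE exE conjE) simp
  obtain n c where c: "cube_chart K n c C" "c {} = v" using cube_chart_at[OF cub C(1,2)] .
  have E: "(\<lambda>a. {v, a}) ` S = (\<lambda>j. {v, c {j}}) ` {..<n}"
    using C(3) unfolding E_def cube_chart_star[OF c] .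
  have vS: "v \<notin> S" using nbr adjacent_neq by metis
  have S: "S = (\<lambda>j. c {j}) ` {..<n}"
  proof safe
    fix a assume "a \<in> S"
    then have "{v, a} \<in> (\<lambda>j. {v, c {j}}) ` {..<n}" using E by blast
    then show "a \<in> (\<lambda>j. c {j}) ` {..<n}" using vS \<open>a \<in> S\<close> by (auto simp: doubleton_eq_iff)
  next
    fix j assume "j < n"
    then have "{v, c {j}} \<in> (\<lambda>a. {v, a}) ` S" using E by blast
    moreover have "c {j} \<noteq> v" using cube_chart_eq_iff[OF c(1), of "{j}" "{}"] c(2) \<open>j < n\<close> by auto
    ultimately show "c {j} \<in> S" by (auto simp: doubleton_eq_iff)
  qed
  have "inj_on (\<lambda>j. c {j}) {..<n}"
    by (rule inj_onI) (use cube_chart_eq_iff[OF c(1)] in force)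
  then have "card S = n" unfolding S by (simp add: card_image)
  then show ?thesis using that C(1) c S by blast
qed

text \<open>This is the cube axiom of \<open>cubed_graph\<close>. The cube spanned by the three
  directions has squares of its own at \<open>v\<close>, and the given squares agree with them
  because three corners determine the fourth.\<close>

lemma square_cube:
  assumes flag: "flag_complex (vertex_link K v)"
    and sq: "square K v a x b" "square K v b y d" "square K v a z d"
  shows "\<exists>w. square K a x w z \<and> square K b x w y \<and> square K d y w z"
proof -
  have dist: "a \<noteq> b" "b \<noteq> d" "a \<noteq> d" using sq square_distinct by force+
  have sqs: "\<exists>x. square K v a' x b'" if "a' \<in> {a, b, d}" "b' \<in> {a, b, d}" "a' \<noteq> b'" for a' b'
    using that sq(1,2,3) sq[THEN square_reflect] by (elim insertE emptyE) blast+
  have nbr: "adjacent K v a'" if "a' \<in> {a, b, d}" for a'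
    using that sq sq[THEN square_reflect] unfolding square_def by blast
  have "finite {a, b, d}" by simp
  then obtain n c C where C: "C \<in> K" "cube_chart K n c C" "c {} = v"
      "{a, b, d} = (\<lambda>j. c {j}) ` {..<n}"
    by (rule flag_cube[OF flag _ nbr sqs])
  have "\<exists>i<n. a' = c {i}" if "a' \<in> {a, b, d}" for a'
    using that unfolding C(4) by auto
  then obtain i j k where ijk: "i < n" "j < n" "k < n" "a = c {i}" "b = c {j}" "d = c {k}"
    by (meson insertCI)
  have d: "i \<noteq> j" "j \<noteq> k" "i \<noteq> k" using dist ijk by auto
  have s: "square K v (c {p}) (c {p, q}) (c {q})" if "p < n" "q < n" "p \<noteq> q" for p q
    using cube_chart_square[OF C(2), of "{}" p q] that C(3) by (simp add: insert_commute)
  have "x = c {i, j}" "y = c {j, k}" "z = c {i, k}"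
  proof -
    have opp: "p = q" if "square K v e p f" "square K v e q f" for e f p q
      using that[THEN square_rotate, THEN square_rotate, THEN square_rotate] by (rule square_unique)
    show "x = c {i, j}" using opp[of a x b "c {i, j}"] sq(1) s[of i j] ijk d by simp
    show "y = c {j, k}" using opp[of b y d "c {j, k}"] sq(2) s[of j k] ijk d by simp
    show "z = c {i, k}" using opp[of a z d "c {i, k}"] sq(3) s[of i k] ijk d by simp
  qed
  note xyz = this
  have "square K (c {i}) (c {j, i}) (c {k, j, i}) (c {k, i})"
    using ijk(1-3) d by (intro cube_chart_square[OF C(2)]) auto
  then have 1: "square K a x (c {i, j, k}) z"
    using xyz ijk(4) by (simp add: insert_commute[of j i] insert_commute[of k i] insert_commute[of k j])
  have "square K (c {j}) (c {i, j}) (c {k, i, j}) (c {k, j})"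
    using ijk(1-3) d by (intro cube_chart_square[OF C(2)]) auto
  then have 2: "square K b x (c {i, j, k}) y"
    using xyz ijk(5) by (simp add: insert_commute[of k i] insert_commute[of k j])
  have "square K (c {k}) (c {j, k}) (c {i, j, k}) (c {i, k})"
    using ijk(1-3) d by (intro cube_chart_square[OF C(2)]) auto
  then have 3: "square K d y (c {i, j, k}) z"
    using xyz ijk(6) by simp
  from 1 2 3 show ?thesis by (intro exI conjI)
qed

lemma cubed_graph:
  assumes "\<And>v. v \<in> vertices K \<Longrightarrow> flag_complex (vertex_link K v)"
  shows "cubed_graph (adjacent K) (square K)"
proof
  fix a b c d d' assume sq: "square K a b c d"
  show "adjacent K a b" using sq unfolding square_def by blast
  show "a \<noteq> c" using square_distinct[OF sq] by simp
  show "square K b c d a" using square_rotate[OF sq] .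
  show "square K a d c b" using square_reflect[OF sq] .
  show "d = d'" if "square K a b c d'" using square_unique sq that .
next
  fix v a x b y c z
  assume sq: "square K v a x b" "square K v b y c" "square K v a z c"
  have "v \<in> vertices K" using sq(1) unfolding square_def vertices_def by blast
  from square_cube[OF assms[OF this] sq]
  show "\<exists>w. square K a x w z \<and> square K b x w y \<and> square K c y w z" .
next
  fix u v assume uv: "adjacent K u v"
  show "adjacent K v u" using adjacent_sym[OF uv] .
qed

end

section \<open>Local systems on a cubical complex\<close>

locale local_system =
  fixes K :: "'v set set" and F :: "'v \<Rightarrow> 'x set" and A :: "'v \<Rightarrow> 'v \<Rightarrow> 'x \<Rightarrow> 'x"
  assumes cub: "cubical_complex K"
    and A_mem: "adjacent K v w \<Longrightarrow> x \<in> F v \<Longrightarrow> A v w x \<in> F w"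
    and A_inv: "adjacent K v w \<Longrightarrow> x \<in> F v \<Longrightarrow> A w v (A v w x) = x"
    and A_flat: "square K v u w a \<Longrightarrow> x \<in> F v \<Longrightarrow> A u w (A v u x) = A a w (A v a x)"
begin

definition flat_section :: "'v set \<Rightarrow> ('v \<Rightarrow> 'x) \<Rightarrow> bool" where
  "flat_section C s \<longleftrightarrow> (\<forall>v\<in>C. s v \<in> F v) \<and> (\<forall>v\<in>C. \<forall>w\<in>C. adjacent K v w \<longrightarrow> A v w (s v) = s w)"

lemma flat_section_subset: "flat_section C s \<Longrightarrow> D \<subseteq> C \<Longrightarrow> flat_section D s"
  unfolding flat_section_def by blast

text \<open>The section is extended one coordinate at a time: labels containing \<open>k\<close>
  receive the values transported along the edges in direction \<open>k\<close>. Flatness around the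
  squares spanned by \<open>k\<close> and an older direction makes the new half of the cube flat as
  well.\<close>

lemma chart_section:
  assumes c: "cube_chart K n c C" and x: "x \<in> F (c {})" and "k \<le> n"
  shows "\<exists>g. g {} = x \<and> (\<forall>I. I \<subseteq> {..<k} \<longrightarrow> g I \<in> F (c I)) \<and>
    (\<forall>I j. I \<subseteq> {..<k} \<longrightarrow> j < k \<longrightarrow> j \<notin> I \<longrightarrow> A (c I) (c (insert j I)) (g I) = g (insert j I))"
  using \<open>k \<le> n\<close>
proof (induction k)
  case 0
  then show ?case using x by (auto intro!: exI[of _ "\<lambda>_. x"])
next
  case (Suc k)
  then obtain g where g: "g {} = x" "\<And>I. I \<subseteq> {..<k} \<Longrightarrow> g I \<in> F (c I)"
    "\<And>I j. I \<subseteq> {..<k} \<Longrightarrow> j < k \<Longrightarrow> j \<notin> I \<Longrightarrow> A (c I) (c (insert j I)) (g I) = g (insert j I)"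
    by auto
  define g' where "g' I = (if k \<in> I then A (c (I - {k})) (c I) (g (I - {k})) else g I)" for I
  have low: "I \<subseteq> {..<k}" if "I \<subseteq> {..<Suc k}" "k \<notin> I" for I
    using that by (auto simp: less_Suc_eq)
  have low': "I - {k} \<subseteq> {..<k}" if "I \<subseteq> {..<Suc k}" for I
    using that by (auto simp: less_Suc_eq)
  have adjk: "adjacent K (c (I - {k})) (c I)" if "I \<subseteq> {..<Suc k}" "k \<in> I" for I
  proof -
    have "I - {k} \<subseteq> {..<n}" using low'[OF that(1)] Suc.prems by force
    then show ?thesis
      using cube_chart_edge[OF c, of "I - {k}" k] Suc.prems that(2) by (simp add: insert_absorb)
  qed
  have mem: "g' I \<in> F (c I)" if I: "I \<subseteq> {..<Suc k}" for I
    using A_mem[OF adjk[OF I]] g(2)[OF low'[OF I]] g(2)[OF low[OF I]] unfolding g'_def by auto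
  have step: "A (c I) (c (insert j I)) (g' I) = g' (insert j I)"
    if I: "I \<subseteq> {..<Suc k}" "j < Suc k" "j \<notin> I" for I j
  proof (cases "j = k")
    case True
    then show ?thesis using I(3) by (simp add: g'_def)
  next
    case jk: False
    show ?thesis
    proof (cases "k \<in> I")
      case False
      then show ?thesis using g(3)[of I j] low[OF I(1) False] I jk by (simp add: g'_def)
    next
      case True
      define J where "J = I - {k}"
      have J: "J \<subseteq> {..<k}" "I = insert k J" "k \<notin> J" "insert j I - {k} = insert j J" "j \<notin> J"
        using low'[OF I(1)] True jk I(3) unfolding J_def by auto
      have "J \<subseteq> {..<n}" using J(1) Suc.prems by force
      then have "square K (c J) (c (insert k J)) (c (insert j (insert k J))) (c (insert j J))"
        using cube_chart_square[OF c, of J k j] J jk I(2) Suc.prems by simp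
      from A_flat[OF this g(2)[OF J(1)]]
      show ?thesis using g(3)[OF J(1), of j] J I jk unfolding g'_def J_def[symmetric]
        by (simp add: insert_commute)
    qed
  qed
  show ?case
    using mem step g(1) by (intro exI[of _ g']) (auto simp: g'_def)
qed

lemma flat_section_exists:
  assumes "C \<in> K" "v \<in> C" "x \<in> F v"
  obtains s where "flat_section C s" "s v = x"
proof -
  obtain n c where c: "cube_chart K n c C" "c {} = v" using cube_chart_at[OF cub assms(1,2)] .
  obtain g where g: "g {} = x" "\<And>I. I \<subseteq> {..<n} \<Longrightarrow> g I \<in> F (c I)"
    "\<And>I j. I \<subseteq> {..<n} \<Longrightarrow> j < n \<Longrightarrow> j \<notin> I \<Longrightarrow> A (c I) (c (insert j I)) (g I) = g (insert j I)"
    using chart_section[OF c(1), of x n] assms(3) c(2) by auto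
  define s where "s = g \<circ> inv_into (Pow {..<n}) c"
  have s: "s (c I) = g I" if "I \<subseteq> {..<n}" for I
    using c(1) that unfolding s_def cube_chart_def by simp
  have "flat_section C s"
    unfolding flat_section_def
  proof (intro conjI ballI impI)
    fix u assume "u \<in> C"
    then obtain I where "I \<subseteq> {..<n}" "u = c I" using c(1) unfolding cube_chart_def by blast
    then show "s u \<in> F u" using g(2) s by simp
  next
    fix u w assume uw: "u \<in> C" "w \<in> C" "adjacent K u w"
    obtain I j where I: "I \<subseteq> {..<n}" "j < n" "j \<notin> I" "{u, w} = {c I, c (insert j I)}"
      using cube_chart_edgeE[OF c(1) uw(3,1,2)] .
    have st: "s (c I) = g I" "s (c (insert j I)) = g (insert j I)" using s I by simp_all
    have up: "A (c I) (c (insert j I)) (s (c I)) = s (c (insert j I))" using g(3) I st by simp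
    have down: "A (c (insert j I)) (c I) (s (c (insert j I))) = s (c I)"
      unfolding up[symmetric] using A_inv[OF cube_chart_edge[OF c(1) I(1-3)], of "s (c I)"] g(2)[OF I(1)] st
      by simp
    from I(4) consider "u = c I \<and> w = c (insert j I)" | "w = c I \<and> u = c (insert j I)"
      by (auto simp: doubleton_eq_iff)
    then show "A u w (s u) = s w" using up down by cases simp_all
  qed
  moreover have "s v = x" using s[of "{}"] g(1) c(2) by simp
  ultimately show ?thesis using that by blast
qed

lemma flat_section_unique:
  assumes "C \<in> K" "flat_section C s" "flat_section C t" "v \<in> C" "w \<in> C" "s v = t v"
  shows "s w = t w"
proof -
  obtain n c where c: "cube_chart K n c C" "c {} = v" using cube_chart_at[OF cub assms(1,4)] .
  obtain I where I: "I \<subseteq> {..<n}" "w = c I" using c(1) assms(5) unfolding cube_chart_def by blast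
  have "finite I" using I(1) finite_subset by blast
  then have "I \<subseteq> {..<n} \<longrightarrow> s (c I) = t (c I)"
  proof induction
    case empty
    then show ?case using assms(6) c(2) by simp
  next
    case (insert j I)
    show ?case
    proof
      assume I: "insert j I \<subseteq> {..<n}"
      have e: "adjacent K (c I) (c (insert j I))" using cube_chart_edge[OF c(1)] I insert(2) by auto
      have m: "c I \<in> C" "c (insert j I) \<in> C" using cube_chart_mem[OF c(1)] I by auto
      have "s (c (insert j I)) = A (c I) (c (insert j I)) (s (c I))"
        using assms(2) e m unfolding flat_section_def by simp
      also have "\<dots> = A (c I) (c (insert j I)) (t (c I))" using insert(3) I by simp
      also have "\<dots> = t (c (insert j I))" using assms(3) e m unfolding flat_section_def by simp
      finally show "s (c (insert j I)) = t (c (insert j I))" .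
    qed
  qed
  then show ?thesis using I by simp
qed

text \<open>Parallel transport between any two vertices of a common cube, not only along an edge.
  The choice hides a cube and a flat section on it; the result depends on neither.\<close>

definition transport :: "'v \<Rightarrow> 'v \<Rightarrow> 'x \<Rightarrow> 'x" where
  "transport v w x = (SOME y. \<exists>C\<in>K. \<exists>s. v \<in> C \<and> w \<in> C \<and> flat_section C s \<and> s v = x \<and> s w = y)"

text \<open>Two cubes containing both vertices intersect in a cube, and there a flat section is
  determined by one value.\<close>

lemma transport_eq:
  assumes "C \<in> K" "v \<in> C" "w \<in> C" "flat_section C s"
  shows "transport v w (s v) = s w"
proof -
  have "\<exists>D\<in>K. \<exists>t. v \<in> D \<and> w \<in> D \<and> flat_section D t \<and> t v = s v \<and> t w = transport v w (s v)"
    unfolding transport_def by (rule someI_ex) (use assms in blast)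
  then obtain D t where D: "D \<in> K" "v \<in> D" "w \<in> D" "flat_section D t" "t v = s v" "t w = transport v w (s v)"
    by blast
  have "C \<inter> D \<in> K" using cube_inter[OF cub assms(1) D(1) assms(2) D(2)] .
  then have "t w = s w"
    by (rule flat_section_unique[of "C \<inter> D" t s v w])
      (use assms D flat_section_subset in auto)
  then show ?thesis using D(6) by simp
qed

lemma transport_mem:
  assumes "C \<in> K" "v \<in> C" "w \<in> C" "x \<in> F v"
  shows "transport v w x \<in> F w"
proof -
  obtain s where s: "flat_section C s" "s v = x" using flat_section_exists[OF assms(1,2,4)] .
  then show ?thesis using transport_eq[OF assms(1-3) s(1)] assms(3) unfolding flat_section_def by auto
qed

lemma transport_transport:
  assumes "C \<in> K" "u \<in> C" "v \<in> C" "w \<in> C" "x \<in> F u"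
  shows "transport v w (transport u v x) = transport u w x"
proof -
  obtain s where s: "flat_section C s" "s u = x" using flat_section_exists[OF assms(1,2,5)] .
  then show ?thesis using transport_eq[OF _ _ _ s(1)] assms by metis
qed

lemma transport_same:
  assumes "C \<in> K" "v \<in> C" "x \<in> F v"
  shows "transport v v x = x"
proof -
  obtain s where s: "flat_section C s" "s v = x" using flat_section_exists[OF assms] .
  then show ?thesis using transport_eq[OF assms(1,2,2) s(1)] by simp
qed

lemma transport_adjacent:
  assumes "adjacent K v w" "x \<in> F v"
  shows "transport v w x = A v w x"
proof -
  have C: "{v, w} \<in> K" using assms by (simp add: edges_def)
  obtain s where s: "flat_section {v, w} s" "s v = x" using flat_section_exists[OF C _ assms(2)] by blast
  then show ?thesis using transport_eq[OF C _ _ s(1), of v w] assms(1) unfolding flat_section_def by simp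
qed

end

section \<open>Trivial monodromy over a simply connected realization\<close>

lemma cube_point_at:
  assumes c: "cube_chart K n c C" and A: "A \<subseteq> {..<n}"
  shows "cube_point n c t (c A) = (\<Prod>i\<in>A. t i) * (\<Prod>i\<in>{..<n} - A. 1 - t i)"
proof -
  have "{B \<in> Pow {..<n}. c B = c A} = {A}"
    using cube_chart_eq_iff[OF c] A by blast
  then show ?thesis unfolding cube_point_def by simp
qed

lemma cube_point_outside:
  assumes "cube_chart K n c C" "v \<notin> C"
  shows "cube_point n c t v = 0"
proof -
  have "{B \<in> Pow {..<n}. c B = v} = {}"
    using assms unfolding cube_chart_def by blast
  then show ?thesis unfolding cube_point_def by (simp only: sum.empty)
qed

text \<open>Positivity of the coordinate at \<open>v\<close> defines the open star of
  \<open>v\<close>. Vertices whose stars share a point thus lie in one cube, which is what permits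
  transport between them.\<close>

lemma realization_support:
  assumes "p \<in> realization K"
  obtains C where "C \<in> K" "\<And>v. p v > 0 \<Longrightarrow> v \<in> C"
proof -
  obtain n c C t where C: "p = cube_point n c t" "C \<in> K" "cube_chart K n c C"
    using assms unfolding realization_def by blast
  then show ?thesis using that[OF C(2)] cube_point_outside[OF C(3)] by force
qed

lemma realization_positive:
  assumes "p \<in> realization K"
  obtains v where "p v > 0"
proof -
  obtain n c C t where C: "p = cube_point n c t" "cube_chart K n c C" and t: "\<And>i. i < n \<Longrightarrow> 0 \<le> t i \<and> t i \<le> 1"
    using assms unfolding realization_def by blast
  \<comment> \<open>Rounding up every positive coordinate selects a corner at which all factors of
    the product are positive.\<close>
  define A where "A = {i. i < n \<and> t i > 0}"
  have A: "A \<subseteq> {..<n}" unfolding A_def by auto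
  have "(\<Prod>i\<in>A. t i) > 0" by (rule prod_pos) (simp add: A_def)
  moreover have "(\<Prod>i\<in>{..<n} - A. 1 - t i) > 0"
    by (rule prod_pos) (use t in \<open>force simp: A_def\<close>)
  ultimately have "p (c A) > 0" unfolding C(1) cube_point_at[OF C(2) A] by simp
  then show ?thesis by (rule that)
qed

text \<open>Coordinates of the point at parameter \<open>s\<close> on an edge. With equal ends this
  is a vertex, which occurs below as \<open>edge_point v v 0\<close>.\<close>

definition edge_point :: "'v \<Rightarrow> 'v \<Rightarrow> real \<Rightarrow> 'v \<Rightarrow> real" where
  "edge_point u w s v = (if u = v then 1 - s else 0) + (if w = v then s else 0)"

lemma edge_point_realization:
  assumes cub: "cubical_complex K" and e: "adjacent K u w" and s: "0 \<le> s" "s \<le> 1"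
  shows "edge_point u w s \<in> realization K"
proof -
  have C: "{u, w} \<in> K" "card {u, w} = 2" using e by (auto simp: edges_def)
  obtain n c where c: "cube_chart K n c {u, w}" "c {} = u" using cube_chart_at[OF cub C(1)] by blast
  have "(2::nat) ^ n = 2 ^ 1" using cube_chart_card[OF c(1)] C(2) by simp
  then have n: "n = 1" using power_inject_exp[of "2::nat" n 1] by simp
  note c = c[unfolded n]
  obtain j where "j < 1" "w = c {j}" using cube_chart_edge_at[OF c e] by blast
  then have w: "w = c {0}" by simp
  have "edge_point u w s v = cube_point 1 c (\<lambda>_. s) v" for v
  proof -
    consider "v = u" | "v = w" | "v \<notin> {u, w}" by blast
    then show ?thesis
    proof cases
      case 1
      then show ?thesis
        using cube_point_at[OF c(1), of "{}" "\<lambda>_. s"] c(2) adjacent_neq[OF e] by (simp add: edge_point_def)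
    next
      case 2
      then show ?thesis
        using cube_point_at[OF c(1), of "{0}" "\<lambda>_. s"] w adjacent_neq[OF e] by (simp add: edge_point_def)
    next
      case 3
      then show ?thesis using cube_point_outside[OF c(1) 3, of "\<lambda>_. s"] by (auto simp: edge_point_def)
    qed
  qed
  then have "edge_point u w s = cube_point 1 c (\<lambda>_. s)" by blast
  then show ?thesis using c(1) C(1) s unfolding realization_def by blast
qed

lemma vertex_point_realization:
  assumes cub: "cubical_complex K" and "v \<in> vertices K"
  shows "edge_point v v 0 \<in> realization K"
proof -
  obtain C where "C \<in> K" "v \<in> C" using assms(2) unfolding vertices_def by blast
  then obtain n c where c: "cube_chart K n c C" "c {} = v" using cube_chart_at[OF cub] by metis
  have "c ` {{}..{}} \<in> K" by (rule cube_chart_face[OF c(1)]) auto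
  then have C: "{v} \<in> K" using c(2) by simp
  obtain n c where c: "cube_chart K n c {v}" "c {} = v" using cube_chart_at[OF cub C] by blast
  have "(2::nat) ^ n = 2 ^ 0" using cube_chart_card[OF c(1)] by simp
  then have n: "n = 0" using power_inject_exp[of "2::nat" n 0] by simp
  note c = c[unfolded n]
  have "edge_point v v 0 u = cube_point 0 c (\<lambda>_. 0) u" for u
    using cube_point_at[OF c(1), of "{}" "\<lambda>_. 0"] cube_point_outside[OF c(1), of u "\<lambda>_. 0"] c(2)
    by (cases "u = v") (auto simp: edge_point_def)
  then have "edge_point v v 0 = cube_point 0 c (\<lambda>_. 0)" by blast
  then show ?thesis using c(1) C unfolding realization_def by blast
qed

text \<open>The Lebesgue number lemma for the preimages of the open stars. The claim covers every
  large \<open>N\<close>, so that the mesh can be adapted to the length of an edge loop.\<close>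

lemma star_grid:
  fixes h :: "real \<times> real \<Rightarrow> 'v \<Rightarrow> real"
  assumes cont: "continuous_on ({0..1} \<times> {0..1}) h"
    and pos: "\<And>z. z \<in> {0..1} \<times> {0..1} \<Longrightarrow> \<exists>v. h z v > 0"
  shows "\<exists>M>0. \<forall>N\<ge>M. \<forall>i<N. \<forall>j<N.
      \<exists>v. \<forall>z\<in>{real i / N..real (Suc i) / N} \<times> {real j / N..real (Suc j) / N}. h z v > 0"
proof -
  let ?S = "({0..1} \<times> {0..1}) :: (real \<times> real) set"
  have "\<exists>U. open U \<and> U \<inter> ?S = {z \<in> ?S. h z v > 0}" for v
  proof -
    have "continuous_on ?S (\<lambda>z. h z v)" using continuous_on_product_then_coordinatewise[OF cont] .
    moreover have "open ({0<..} :: real set)" by simp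
    ultimately obtain U where "open U" "U \<inter> ?S = (\<lambda>z. h z v) -` {0<..} \<inter> ?S"
      unfolding continuous_on_open_invariant by metis
    then show ?thesis by (intro exI[of _ U]) auto
  qed
  then obtain U where U: "\<And>v. open (U v)" "\<And>v. U v \<inter> ?S = {z \<in> ?S. h z v > 0}" by metis
  have cov: "?S \<subseteq> \<Union> (range U)" using pos U(2) by blast
  have comp: "compact ?S" by (intro compact_Times compact_Icc)
  have "range U \<noteq> {}" "\<And>B. B \<in> range U \<Longrightarrow> open B" using U(1) by auto
  from Lebesgue_number_lemma[OF comp this(1) cov this(2)] obtain \<delta> where \<delta>: "\<delta> > 0" "\<And>T. T \<subseteq> ?S \<Longrightarrow> diameter T < \<delta> \<Longrightarrow> \<exists>B\<in>range U. T \<subseteq> B"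
    by blast
  \<comment> \<open>A grid square of side \<open>1 / N\<close> has diameter at most
    \<open>2 / N\<close>, by adding the differences of the two coordinates.\<close>
  obtain M :: nat where M: "2 / \<delta> < real M" using reals_Archimedean2 by blast
  have M0: "M > 0"
  proof (rule ccontr)
    assume "\<not> M > 0"
    then show False using M \<delta>(1) by (simp add: field_simps)
  qed
  show ?thesis
  proof (intro exI[of _ M] conjI allI impI M0)
    fix N i j assume N: "N \<ge> M" and ij: "i < N" "j < N"
    let ?T = "{real i / N..real (Suc i) / N} \<times> {real j / N..real (Suc j) / N}"
    have N0: "N > 0" using N M0 by simp
    have small: "2 / real N < \<delta>"
    proof -
      have "2 / \<delta> < real N" using M N by linarith
      then show ?thesis using \<delta>(1) N0 by (simp add: field_simps)
    qed
    have T: "?T \<subseteq> ?S"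
    proof -
      have "real (Suc i) / N \<le> 1" "real (Suc j) / N \<le> 1" using ij N0 by (auto simp: field_simps)
      moreover have "0 \<le> real i / N" "0 \<le> real j / N" by simp_all
      ultimately show ?thesis by (intro Sigma_mono) (simp_all only: atLeastatMost_subset_iff simp_thms)
    qed
    have "diameter ?T \<le> 2 / real N"
    proof (rule diameter_le)
      show "?T \<noteq> {} \<or> 0 \<le> 2 / real N" by simp
      fix x y assume "x \<in> ?T" "y \<in> ?T"
      then obtain a b a' b' where xy: "x = (a, b)" "y = (a', b')"
        "a \<in> {real i / N..real (Suc i) / N}" "a' \<in> {real i / N..real (Suc i) / N}"
        "b \<in> {real j / N..real (Suc j) / N}" "b' \<in> {real j / N..real (Suc j) / N}"
        by blast
      have w: "real (Suc k) / N = real k / N + 1 / N" for k by (simp add: add_divide_distrib)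
      have "norm (x - y) \<le> norm (a - a') + norm (b - b')"
        unfolding xy using norm_Pair_le[of "a - a'" "b - b'"] by simp
      also have "\<dots> \<le> 1 / N + 1 / N" using xy(3-6) unfolding w by (intro add_mono) (auto simp: abs_le_iff)
      finally show "norm (x - y) \<le> 2 / real N" by simp
    qed
    then have "diameter ?T < \<delta>" using small by linarith
    then obtain v where "?T \<subseteq> U v" using \<delta>(2)[OF T] by blast
    then show "\<exists>v. \<forall>z\<in>?T. h z v > 0" using U(2) T by blast
  qed
qed

text \<open>The edge path \<open>p\<close> run through at constant speed, written as a sum of hat
  functions centred at the parameters \<open>k / n\<close>. Continuity is then immediate, without
  gluing segments.\<close>

definition hat_path :: "nat \<Rightarrow> (nat \<Rightarrow> 'v) \<Rightarrow> real \<Rightarrow> 'v \<Rightarrow> real" where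
  "hat_path n p t v = (\<Sum>k\<le>n. if p k = v then max 0 (1 - \<bar>n * t - k\<bar>) else 0)"

lemma continuous_on_hat_path: "continuous_on S (hat_path n p)"
proof (rule continuous_on_coordinatewise_then_product)
  fix v
  have "continuous_on S (\<lambda>t. if p k = v then max 0 (1 - \<bar>n * t - k\<bar>) else 0)" for k :: nat
    by (cases "p k = v") (auto intro!: continuous_intros)
  then show "continuous_on S (\<lambda>t. hat_path n p t v)"
    unfolding hat_path_def by (intro continuous_on_sum)
qed

lemma hat_path_segment:
  assumes k: "k < n" and t: "real k \<le> n * t" "n * t \<le> real (Suc k)"
  shows "hat_path n p t = edge_point (p k) (p (Suc k)) (n * t - k)"
proof
  fix v
  have "(\<Sum>i\<le>n. if p i = v then max 0 (1 - \<bar>n * t - i\<bar>) else 0) =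
      (\<Sum>i\<in>{k, Suc k}. if p i = v then max 0 (1 - \<bar>n * t - i\<bar>) else 0)"
  proof (rule sum.mono_neutral_right)
    show "\<forall>i\<in>{..n} - {k, Suc k}. (if p i = v then max 0 (1 - \<bar>n * t - i\<bar>) else 0) = 0"
    proof
      fix i assume i: "i \<in> {..n} - {k, Suc k}"
      then consider "Suc i \<le> k" | "Suc (Suc k) \<le> i" by force
      then have "1 \<le> \<bar>n * t - i\<bar>"
      proof cases
        case 1
        then have "real i + 1 \<le> real k" by linarith
        then show ?thesis using t by linarith
      next
        case 2
        then have "real k + 2 \<le> real i" by linarith
        then show ?thesis using t by linarith
      qed
      then show "(if p i = v then max 0 (1 - \<bar>n * t - i\<bar>) else 0) = 0" by simp
    qed
  qed (use k in auto)
  then show "hat_path n p t v = edge_point (p k) (p (Suc k)) (n * t - k) v"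
    unfolding hat_path_def edge_point_def using t by (auto simp: abs_if)
qed

context local_system
begin

primrec along :: "(nat \<Rightarrow> 'v) \<Rightarrow> 'x \<Rightarrow> nat \<Rightarrow> 'x" where
  "along p x 0 = x"
| "along p x (Suc k) = A (p k) (p (Suc k)) (along p x k)"

lemma along_mem:
  assumes "\<And>k. k < n \<Longrightarrow> adjacent K (p k) (p (Suc k))" "x \<in> F (p 0)" "k \<le> n"
  shows "along p x k \<in> F (p k)"
  using assms(3) by (induction k) (auto simp: assms A_mem)

lemma transport_back:
  assumes "C \<in> K" "u \<in> C" "v \<in> C" "x \<in> F u" "y \<in> F u" "transport u v x = transport u v y"
  shows "x = y"
  using transport_transport[OF assms(1,2,3,2)] transport_same[OF assms(1,2)] assms(4-6) by metis

text \<open>The small squares of a grid on the domain of a contraction of the loop are labelled by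
  vertices whose open stars contain their images.  The labels of the four squares around a grid
  point lie in a common cube, so transporting from label to label is consistent.\<close>

lemma along_closed:
  assumes sc: "simply_connected (realization K)"
    and n: "n > 0" and p: "\<And>k. k < n \<Longrightarrow> adjacent K (p k) (p (Suc k))" "p n = p 0"
    and x: "x \<in> F (p 0)"
  shows "along p x n = x"
proof -
  let ?R = "realization K" and ?\<gamma> = "hat_path n p"
  define b where "b = p 0"
  have seg: "\<exists>k<n. real k \<le> n * t \<and> n * t \<le> real (Suc k)" if "t \<in> {0..1}" for t :: real
  proof (cases "t = 1")
    case True
    then show ?thesis using n by (intro exI[of _ "n - 1"]) auto
  next
    case False
    then have t: "0 \<le> t" "t < 1" using that by auto
    define k where "k = nat \<lfloor>n * t\<rfloor>"
    have "0 \<le> n * t" "n * t < n" using t n by auto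
    then have "real k \<le> n * t" "n * t \<le> real (Suc k)" "k < n"
      unfolding k_def by linarith+
    then show ?thesis by blast
  qed
  have \<gamma>R: "?\<gamma> t \<in> ?R" if t: "t \<in> {0..1}" for t
  proof -
    obtain k where k: "k < n" "real k \<le> n * t" "n * t \<le> real (Suc k)" using seg[OF t] by blast
    show ?thesis unfolding hat_path_segment[OF k]
      using edge_point_realization[OF cub p(1)[OF k(1)]] k by simp
  qed
  have \<gamma>0: "?\<gamma> 0 v > 0 \<longleftrightarrow> v = b" for v
    using hat_path_segment[of 0 n 0 p] n by (auto simp: edge_point_def b_def)
  have \<gamma>1: "?\<gamma> 1 = ?\<gamma> 0"
    using hat_path_segment[of 0 n 0 p] hat_path_segment[of "n - 1" n 1 p] n p(2)
    by (auto simp: edge_point_def)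
  have "homotopic_loops ?R ?\<gamma> (\<lambda>_. ?\<gamma> 0)"
  proof -
    have "path ?\<gamma>" unfolding path_def by (rule continuous_on_hat_path)
    moreover have "pathfinish ?\<gamma> = pathstart ?\<gamma>" using \<gamma>1 by (simp add: pathfinish_def pathstart_def)
    moreover have "path_image ?\<gamma> \<subseteq> ?R" using \<gamma>R unfolding path_image_def by blast
    moreover have "path (\<lambda>_. ?\<gamma> 0)" "pathfinish (\<lambda>_. ?\<gamma> 0) = pathstart (\<lambda>_. ?\<gamma> 0)"
      "path_image (\<lambda>_. ?\<gamma> 0) \<subseteq> ?R"
      using \<gamma>R[of 0] by (auto simp: path_def pathfinish_def pathstart_def path_image_def)
    ultimately show ?thesis using sc unfolding simply_connected_def by blast
  qed
  then obtain h where h: "continuous_on ({0..1::real} \<times> {0..1}) h" "h \<in> ({0..1} \<times> {0..1}) \<rightarrow> ?R"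
    "\<And>t. t \<in> {0..1} \<Longrightarrow> h (0, t) = ?\<gamma> t" "\<And>t. t \<in> {0..1} \<Longrightarrow> h (1, t) = ?\<gamma> 0"
    "\<And>s. s \<in> {0..1} \<Longrightarrow> h (s, 1) = h (s, 0)"
    unfolding homotopic_loops by (auto simp: pathfinish_def pathstart_def)
  have posR: "\<exists>v. h z v > 0" if "z \<in> {0..1::real} \<times> {0..1::real}" for z
  proof -
    have "h z \<in> ?R" using h(2) that by blast
    then show "\<exists>v. h z v > 0" using realization_positive by metis
  qed
  obtain M where M: "M > 0" "\<forall>N\<ge>M. \<forall>i<N. \<forall>j<N.
      \<exists>v. \<forall>z\<in>{real i / N..real (Suc i) / N} \<times> {real j / N..real (Suc j) / N}. h z v > 0"
    using star_grid[OF h(1) posR] by blast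
  \<comment> \<open>A multiple of \<open>n\<close> places the parameters at which the loop passes a
    vertex on grid lines.\<close>
  define N where "N = n * M"
  have N: "N \<ge> M" "N > 0" using n M(1) unfolding N_def by auto
  have "\<forall>i j. \<exists>v. i < N \<longrightarrow> j < N \<longrightarrow>
      (\<forall>z\<in>{real i / N..real (Suc i) / N} \<times> {real j / N..real (Suc j) / N}. h z v > 0)"
    using M(2) N(1) by blast
  \<comment> \<open>\<open>L i j\<close> is the label of a grid square; the first index runs in the
    direction of the homotopy, the second along the loop.\<close>
  then obtain L where L: "\<And>i j z. i < N \<Longrightarrow> j < N \<Longrightarrow>
      z \<in> {real i / N..real (Suc i) / N} \<times> {real j / N..real (Suc j) / N} \<Longrightarrow> h z (L i j) > 0"
    by metis
  have frac: "real i / N \<in> {0..1}" if "i \<le> N" for i using that N by (auto simp: field_simps)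
  have inseg: "real k / N \<in> {real i / N..real (Suc i) / N}" if "k = i \<or> k = Suc i" for i k
    using that N by (auto simp: field_simps)
  have Lpos: "h (real k / N, real l / N) (L i j) > 0"
    if "i < N" "j < N" "k = i \<or> k = Suc i" "l = j \<or> l = Suc j" for i j k l
    using L[OF that(1,2)] inseg that(3,4) by blast
  have common: "\<exists>C\<in>K. \<forall>v. h (real k / N, real l / N) v > 0 \<longrightarrow> v \<in> C" if "k \<le> N" "l \<le> N" for k l
  proof -
    have "h (real k / N, real l / N) \<in> ?R" using h(2) frac[OF that(1)] frac[OF that(2)] by blast
    then show ?thesis by (meson realization_support)
  qed
  have Lb0: "L 0 0 = b"
    using Lpos[of 0 0 0 0] N h(3)[of 0] \<gamma>0 by simp
  have Lbend: "L 0 (N - 1) = b"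
    using Lpos[of 0 "N - 1" 0 N] N h(3)[of 1] \<gamma>0 \<gamma>1 by simp
  \<comment> \<open>The homotopy ends in the constant loop at \<open>b\<close>, where only the
    coordinate at \<open>b\<close> is positive.\<close>
  have Lblast: "L (N - 1) j = b" if "j < N" for j
    using Lpos[of "N - 1" j N j] N that h(4)[OF frac, of j] \<gamma>0 by simp
  have "\<exists>Y. Y 0 = x \<and> (\<forall>j. Y (Suc j) = transport (L 0 j) (L 0 (Suc j)) (Y j))"
    by (intro exI[of _ "rec_nat x (\<lambda>j. transport (L 0 j) (L 0 (Suc j)))"]) simp
  then obtain Y where Y: "Y 0 = x" "\<And>j. Y (Suc j) = transport (L 0 j) (L 0 (Suc j)) (Y j)" by blast
  \<comment> \<open>Only row 0 is defined along the loop. The other rows arise column by column, and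
    their consistency in the direction of the loop is a claim of its own,
    \<open>rows\<close>.\<close>
  have "\<exists>X. X 0 = Y \<and> (\<forall>i. X (Suc i) = (\<lambda>j. transport (L i j) (L (Suc i) j) (X i j)))"
    by (intro exI[of _ "rec_nat Y (\<lambda>i X j. transport (L i j) (L (Suc i) j) (X j))"]) simp
  then obtain X where X: "X 0 = Y" "\<And>i j. X (Suc i) j = transport (L i j) (L (Suc i) j) (X i j)"
    by metis
  have mem: "X i j \<in> F (L i j)" if "i < N" "j < N" for i j
    using that
  proof (induction i)
    case 0
    then show ?case
    proof (induction j)
      case 0
      then show ?case using X(1) Y(1) Lb0 x b_def by simp
    next
      case (Suc j)
      obtain C where "C \<in> K" "\<forall>v. h (real 0 / N, real (Suc j) / N) v > 0 \<longrightarrow> v \<in> C"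
        using common[of 0 "Suc j"] Suc.prems by auto
      then show ?case
        using transport_mem[of C "L 0 j" "L 0 (Suc j)"] Lpos[of 0 j 0 "Suc j"] Lpos[of 0 "Suc j" 0 "Suc j"]
          Suc X(1) Y(2) by simp
    qed
  next
    case (Suc i)
    obtain C where "C \<in> K" "\<forall>v. h (real (Suc i) / N, real j / N) v > 0 \<longrightarrow> v \<in> C"
      using common[of "Suc i" j] Suc.prems by auto
    then show ?case
      using transport_mem[of C "L i j" "L (Suc i) j"] Lpos[of i j "Suc i" j] Lpos[of "Suc i" j "Suc i" j]
        Suc X(2) by simp
  qed
  have rows: "X i (Suc j) = transport (L i j) (L i (Suc j)) (X i j)" if iN: "i < N" and jN: "Suc j < N" for i j
    using iN
  proof (induction i)
    case 0
    then show ?case using X(1) Y(2) by simp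
  next
    case (Suc i)
    obtain C where C: "C \<in> K" "\<forall>v. h (real (Suc i) / N, real (Suc j) / N) v > 0 \<longrightarrow> v \<in> C"
      using common[of "Suc i" "Suc j"] Suc.prems jN by auto
    have m: "L i j \<in> C" "L (Suc i) j \<in> C" "L i (Suc j) \<in> C" "L (Suc i) (Suc j) \<in> C"
      using C(2) Lpos[of _ _ "Suc i" "Suc j"] Suc.prems jN by auto
    have x: "X i j \<in> F (L i j)" using mem Suc.prems jN by simp
    show ?case
      using X(2)[of i "Suc j"] X(2)[of i j] Suc.IH Suc.prems
        transport_transport[OF C(1) m(1,3,4) x] transport_transport[OF C(1) m(1,2,4) x] by simp
  qed
  \<comment> \<open>Transport across the seam where the grid closes up takes the last entry of a row
    to its first entry. This is clear in the last row, where all labels are \<open>b\<close>; it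
    passes to the preceding rows because transport inside a cube is injective, hence the induction
    against the direction of the homotopy.\<close>
  have seam: "i < N \<Longrightarrow> transport (L (N - 1 - i) (N - 1)) (L (N - 1 - i) 0) (X (N - 1 - i) (N - 1)) = X (N - 1 - i) 0" for i
  proof (induction i)
    case 0
    obtain C where bC: "C \<in> K" "b \<in> C"
      using p(1)[OF n] b_def unfolding edges_def by blast
    have "X (N - 1) j = X (N - 1) 0" if "j < N" for j
      using that
    proof (induction j)
      case (Suc j)
      have j: "N - 1 < N" "j < N" using N(2) Suc.prems by auto
      have "X (N - 1) (Suc j) = transport b b (X (N - 1) j)"
        using rows[OF j(1) Suc.prems] unfolding Lblast[OF j(2)] Lblast[OF Suc.prems] .
      also have "\<dots> = X (N - 1) j"
        using transport_same[OF bC] mem[OF j] unfolding Lblast[OF j(2)] by blast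
      finally show ?case using Suc.IH[OF j(2)] by (rule trans)
    qed (rule refl)
    moreover have e: "N - 1 < N" using N(2) by simp
    ultimately have "X (N - 1) (N - 1) = X (N - 1) 0" by blast
    moreover have "transport b b (X (N - 1) 0) = X (N - 1) 0"
      using transport_same[OF bC] mem[OF e N(2)] unfolding Lblast[OF N(2)] by blast
    ultimately show ?case
      using Lblast[OF N(2)] Lblast[OF e] by (simp only: diff_zero)
  next
    case (Suc i)
    define r where "r = N - 1 - Suc i"
    have r: "N - 1 - i = Suc r" "Suc r < N" using Suc.prems unfolding r_def by auto
    obtain C where C: "C \<in> K" "\<forall>v. h (real (Suc r) / N, real 0 / N) v > 0 \<longrightarrow> v \<in> C"
      using common[of "Suc r" 0] r by auto
    have "h (real (Suc r) / N, real 0 / N) = h (real (Suc r) / N, real N / N)"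
      using h(5)[OF frac, of "Suc r"] r N(2) by simp
    then have m: "L r 0 \<in> C" "L (Suc r) 0 \<in> C" "L r (N - 1) \<in> C" "L (Suc r) (N - 1) \<in> C"
      using C(2) Lpos[of _ 0 "Suc r" 0] Lpos[of _ "N - 1" "Suc r" N] r N(2) by auto
    have x: "X r (N - 1) \<in> F (L r (N - 1))" "X r 0 \<in> F (L r 0)" using mem r N(2) by auto
    have "transport (L r 0) (L (Suc r) 0) (transport (L r (N - 1)) (L r 0) (X r (N - 1))) =
        transport (L (Suc r) (N - 1)) (L (Suc r) 0) (transport (L r (N - 1)) (L (Suc r) (N - 1)) (X r (N - 1)))"
      using transport_transport[OF C(1) m(3,1,2) x(1)] transport_transport[OF C(1) m(3,4,2) x(1)] by simp
    also have "\<dots> = X (Suc r) 0" using Suc.IH Suc.prems r X(2)[of r "N - 1"] by simp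
    also have "\<dots> = transport (L r 0) (L (Suc r) 0) (X r 0)" using X(2) by simp
    finally have "transport (L r (N - 1)) (L r 0) (X r (N - 1)) = X r 0"
      using transport_back[OF C(1) m(1,2) transport_mem[OF C(1) m(3,1) x(1)] x(2)] by blast
    then show ?case unfolding r_def .
  qed
  have Yend: "Y (N - 1) = x"
  proof -
    obtain C where bC: "C \<in> K" "b \<in> C"
      using p(1)[OF n] b_def unfolding edges_def by blast
    have "transport b b (Y (N - 1)) = x"
      using seam[of "N - 1"] N(2) X(1) Y(1) Lb0 Lbend by simp
    moreover have "Y (N - 1) \<in> F b" using mem[of 0 "N - 1"] N(2) X(1) Lbend by simp
    ultimately show ?thesis using transport_same[OF bC] by simp
  qed
  have NM: "n * (real j / N) = real j / M" for j
    using n M(1) unfolding N_def by simp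
  \<comment> \<open>Over the \<open>k\<close>-th edge the loop has positive coordinates at most at
    the two ends of this edge, so the label is one of them.\<close>
  have Lrow: "L 0 j \<in> {p k, p (Suc k)}" if j: "j < N" "k = j div M" for j k
  proof -
    have "k < n" using j unfolding N_def by (simp add: less_mult_imp_div_less)
    moreover have "real k \<le> n * (real j / N)" "n * (real j / N) \<le> real (Suc k)"
    proof -
      have "k * M \<le> j" "j \<le> Suc k * M" using j(2) M(1)
        by (auto simp: less_imp_le_nat dividend_less_div_times)
      then have "real k * real M \<le> real j" "real j \<le> real (Suc k) * real M"
        by (metis of_nat_le_iff of_nat_mult)+
      then show "real k \<le> n * (real j / N)" "n * (real j / N) \<le> real (Suc k)"
        unfolding NM using M(1) by (auto simp: field_simps)
    qed
    ultimately have "?\<gamma> (real j / N) = edge_point (p k) (p (Suc k)) (n * (real j / N) - k)"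
      by (rule hat_path_segment)
    moreover have "?\<gamma> (real j / N) (L 0 j) > 0"
      using Lpos[of 0 j 0 j] j N h(3)[OF frac, of j] by simp
    ultimately show ?thesis by (auto simp: edge_point_def split: if_splits)
  qed
  \<comment> \<open>Where the loop passes the vertex \<open>p k\<close>, both neighbouring grid
    squares must be labelled by it. This is the place where the comparison in \<open>Yalong\<close>
    changes from one edge to the next.\<close>
  have Lborder: "L 0 j = p k \<and> L 0 (Suc j) = p k" if "Suc j = k * M" "k < n" for j k
  proof -
    have j: "Suc j < N" using that M(1) n unfolding N_def by simp
    have "n * (real (Suc j) / N) = k" unfolding NM that using M(1) by simp
    then have "?\<gamma> (real (Suc j) / N) = edge_point (p k) (p (Suc k)) 0"
      using hat_path_segment[of k n "real (Suc j) / N" p] that(2) by simp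
    moreover have "?\<gamma> (real (Suc j) / N) (L 0 j) > 0" "?\<gamma> (real (Suc j) / N) (L 0 (Suc j)) > 0"
      using Lpos[of 0 _ 0 "Suc j"] j N h(3)[OF frac, of "Suc j"] by simp_all
    ultimately show ?thesis by (auto simp: edge_point_def split: if_splits)
  qed
  have am: "along p x k \<in> F (p k)" if "k \<le> n" for k using along_mem[OF p(1) x that] by simp
  \<comment> \<open>Going from label to label agrees with following the edge path, up to the offset
    from the start \<open>p (j div M)\<close> of the current edge to the current label.\<close>
  have Yalong: "Y j = transport (p (j div M)) (L 0 j) (along p x (j div M))" if "j < N" for j
    using that
  proof (induction j)
    case 0
    obtain C where bC: "C \<in> K" "b \<in> C"
      using p(1)[OF n] b_def unfolding edges_def by blast
    then show ?case using Y(1) Lb0 transport_same[OF bC] x b_def by simp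
  next
    case (Suc j)
    define k where "k = j div M"
    have kn: "k < n" using Suc.prems unfolding k_def N_def by (simp add: less_mult_imp_div_less)
    have e: "{p k, p (Suc k)} \<in> K" using p(1)[OF kn] by (simp add: edges_def)
    show ?case
    proof (cases "Suc j div M = k")
      case True
      have "L 0 j \<in> {p k, p (Suc k)}" "L 0 (Suc j) \<in> {p k, p (Suc k)}"
        using Lrow[of j k] Lrow[of "Suc j" k] Suc.prems True k_def by auto
      then show ?thesis
        using transport_transport[OF e, of "p k" "L 0 j" "L 0 (Suc j)"] am[of k] Suc Y(2)[of j] True k_def kn by simp
    next
      case False
      have d: "Suc j div M = Suc k" "M dvd Suc j"
        using False unfolding k_def by (auto simp: div_Suc split: if_splits)
      have "Suc j = Suc k * M" using dvd_div_mult_self[OF d(2)] unfolding d(1) by (rule sym)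
      note jM = this
      have "Suc k * M < n * M" using Suc.prems unfolding jM N_def .
      then have kn': "Suc k < n" unfolding mult_less_cancel2 by blast
      have L: "L 0 j = p (Suc k)" "L 0 (Suc j) = p (Suc k)" using Lborder[OF jM kn'] by auto
      have "Y j = transport (p k) (L 0 j) (along p x k)"
        using Suc.IH Suc.prems unfolding k_def by simp
      also have "\<dots> = along p x (Suc k)"
        using transport_adjacent[OF p(1)[OF kn] am[of k]] kn unfolding L along.simps by simp
      finally have "Y (Suc j) = transport (p (Suc k)) (p (Suc k)) (along p x (Suc k))"
        using Y(2)[of j] unfolding L by simp
      then show ?thesis unfolding d(1) L .
    qed
  qed
  have "(N - 1) div M = n - 1"
  proof -
    have "N - 1 = (M - 1) + (n - 1) * M" using n M(1) unfolding N_def by (cases n; cases M) auto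
    then have "(N - 1) div M = (n - 1) + (M - 1) div M" using M(1) by (simp only: div_mult_self1)
    then show ?thesis using M(1) by simp
  qed
  then have "x = transport (p (n - 1)) b (along p x (n - 1))"
    using Yalong[of "N - 1"] Yend Lbend N(2) by simp
  also have "\<dots> = along p x n"
    using transport_adjacent[OF p(1)[of "n - 1"] am[of "n - 1"]] n p(2) b_def along.simps(2)[of p x "n - 1"] by simp
  finally show ?thesis by simp
qed

end

section \<open>Distances in a CAT(0) cube complex\<close>

lemma cube_connected:
  assumes cub: "cubical_complex K" and C: "C \<in> K" "u \<in> C" "v \<in> C"
  shows "(adjacent K)\<^sup>*\<^sup>* u v"
proof -
  obtain n c where c: "cube_chart K n c C" "c {} = u" using cube_chart_at[OF cub C(1,2)] .
  obtain I where I: "I \<subseteq> {..<n}" "v = c I" using c(1) C(3) unfolding cube_chart_def by blast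
  have "finite I" using I(1) finite_subset by blast
  then have "I \<subseteq> {..<n} \<longrightarrow> (adjacent K)\<^sup>*\<^sup>* u (c I)"
  proof induction
    case empty
    then show ?case using c(2) by simp
  next
    case (insert j I)
    show ?case
    proof
      assume I: "insert j I \<subseteq> {..<n}"
      then have "adjacent K (c I) (c (insert j I))" using cube_chart_edge[OF c(1)] insert(2) by auto
      then show "(adjacent K)\<^sup>*\<^sup>* u (c (insert j I))" using insert(3) I by (auto intro: rtranclp.rtrancl_into_rtrancl)
    qed
  qed
  then show ?thesis using I by simp
qed

text \<open>The library has this only for normed vector spaces.\<close>

lemma simply_connected_imp_connected_general:
  fixes S :: "'a :: topological_space set"
  assumes "simply_connected S"
  shows "connected S"
proof (rule path_connected_imp_connected, unfold path_connected_def, intro ballI)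
  fix x y assume xy: "x \<in> S" "y \<in> S"
  then have "homotopic_loops S (\<lambda>_. x) (\<lambda>_. y)"
    using assms unfolding simply_connected_def
    by (simp add: path_def path_image_def pathstart_def pathfinish_def image_subset_iff)
  then obtain h where h: "continuous_on ({0..1::real} \<times> {0..1::real}) h" "h \<in> ({0..1} \<times> {0..1}) \<rightarrow> S"
    "\<And>t. t \<in> {0..1} \<Longrightarrow> h (0, t) = x" "\<And>t. t \<in> {0..1} \<Longrightarrow> h (1, t) = y"
    unfolding homotopic_loops by auto
  have "continuous_on {0..1} (\<lambda>s. h (s, 0))"
    by (rule continuous_on_compose2[OF h(1)]) (auto intro!: continuous_intros)
  moreover have "(\<lambda>s. h (s, 0)) ` {0..1} \<subseteq> S" using h(2) by auto
  ultimately show "\<exists>g. path g \<and> path_image g \<subseteq> S \<and> pathstart g = x \<and> pathfinish g = y"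
    using h(3)[of 0] h(4)[of 0]
    by (intro exI[of _ "\<lambda>s. h (s, 0)"]) (simp add: path_def path_image_def pathstart_def pathfinish_def)
qed

text \<open>Vertices of one cube are joined by edges, so the open stars of the vertices reachable
  from \<open>u\<close> are disjoint, inside the realization, from those of all others.
  Connectedness of the realization excludes vertices of the second kind.\<close>

lemma graph_connected:
  assumes cub: "cubical_complex K" and sc: "simply_connected (realization K)"
    and uv: "u \<in> vertices K" "v \<in> vertices K"
  shows "(adjacent K)\<^sup>*\<^sup>* u v"
proof (rule ccontr)
  assume nc: "\<not> (adjacent K)\<^sup>*\<^sup>* u v"
  let ?c = "(adjacent K)\<^sup>*\<^sup>* u"
  define S where "S W = (\<Union>w\<in>W. {p::'a \<Rightarrow> real. p w > 0})" for W
  have op: "open (S W)" for W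
    unfolding S_def by (intro open_UN ballI open_Collect_less continuous_on_const continuous_on_product_coordinates)
  have pos: "p \<in> S {w. ?c w} \<or> p \<in> S {w. \<not> ?c w}" if p: "p \<in> realization K" for p
  proof -
    obtain w where "p w > 0" using realization_positive[OF p] .
    then show ?thesis unfolding S_def by (cases "?c w") auto
  qed
  have disj: "False" if p: "p \<in> realization K" "p \<in> S {w. ?c w}" "p \<in> S {w. \<not> ?c w}" for p
  proof -
    obtain w w' where w: "?c w" "p w > 0" "\<not> ?c w'" "p w' > 0" using p(2,3) unfolding S_def by auto
    obtain C where "C \<in> K" "w \<in> C" "w' \<in> C" using realization_support[OF p(1)] w by metis
    then have "(adjacent K)\<^sup>*\<^sup>* w w'" by (rule cube_connected[OF cub])
    with w(1) have "?c w'" by (rule rtranclp_trans)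
    then show False using w(3) by blast
  qed
  have S: "edge_point w w 0 \<in> S W" if "w \<in> W" for w W
    unfolding S_def by (rule UN_I[OF that]) (simp add: edge_point_def)
  have "connected (realization K)"
    by (rule simply_connected_imp_connected_general[OF sc])
  moreover have "realization K \<subseteq> S {w. ?c w} \<union> S {w. \<not> ?c w}" using pos by blast
  moreover have "S {w. ?c w} \<inter> S {w. \<not> ?c w} \<inter> realization K = {}" using disj by blast
  ultimately have "S {w. ?c w} \<inter> realization K = {} \<or> S {w. \<not> ?c w} \<inter> realization K = {}"
    by (intro connectedD op)
  moreover have "edge_point u u 0 \<in> S {w. ?c w} \<inter> realization K"
    using vertex_point_realization[OF cub uv(1)] S[of u "{w. ?c w}"] by simp
  moreover have "edge_point v v 0 \<in> S {w. \<not> ?c w} \<inter> realization K"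
    using vertex_point_realization[OF cub uv(2)] S[of v "{w. \<not> ?c w}"] nc by simp
  ultimately show False by blast
qed

section \<open>Global flat sections\<close>

context local_system
begin

text \<open>Continuation of \<open>x\<close> along some edge path from \<open>b\<close>, kept as a
  relation because its independence of the path is only shown in
  \<open>carried_unique\<close>.\<close>

inductive carried :: "'v \<Rightarrow> 'x \<Rightarrow> 'v \<Rightarrow> 'x \<Rightarrow> bool" for b x where
  "\<lbrakk>p 0 = b; \<And>k. k < n \<Longrightarrow> adjacent K (p k) (p (Suc k))\<rbrakk> \<Longrightarrow> carried b x (p n) (along p x n)"

lemma along_cong: "(\<And>k. k \<le> n \<Longrightarrow> p k = q k) \<Longrightarrow> along p x n = along q x n"
  by (induction n) auto

lemma carried_step:
  assumes "carried b x v y" "adjacent K v w"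
  shows "carried b x w (A v w y)"
  using assms(1)
proof cases
  case (1 p n)
  define q where "q = p(Suc n := w)"
  have "along q x n = along p x n" by (rule along_cong) (simp add: q_def)
  then have "carried b x (q (Suc n)) (along q x (Suc n)) = carried b x w (A v w y)"
    using 1 by (simp add: q_def)
  moreover have "carried b x (q (Suc n)) (along q x (Suc n))"
    by (rule carried.intros) (use 1 assms(2) in \<open>auto simp: q_def less_Suc_eq\<close>)
  ultimately show ?thesis by simp
qed

lemma carried_mem:
  assumes "carried b x v y" "x \<in> F b"
  shows "y \<in> F v"
  using assms(1)
proof cases
  case (1 p n)
  then show ?thesis using along_mem[of n p x n] assms(2) by simp
qed

text \<open>One path followed by the reverse of the other is a closed edge path \<open>r\<close>, so
  continuation along it returns to \<open>x\<close>.\<close>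

lemma carried_unique:
  assumes sc: "simply_connected (realization K)" and x: "x \<in> F b"
    and c: "carried b x v y" "carried b x v y'"
  shows "y = y'"
proof -
  obtain p n where p: "p 0 = b" "p n = v" "\<And>k. k < n \<Longrightarrow> adjacent K (p k) (p (Suc k))" "along p x n = y"
    using c(1) by (auto elim: carried.cases)
  obtain q m where q: "q 0 = b" "q m = v" "\<And>k. k < m \<Longrightarrow> adjacent K (q k) (q (Suc k))" "along q x m = y'"
    using c(2) by (auto elim: carried.cases)
  define r where "r k = (if k \<le> n then p k else q (n + m - k))" for k
  have r0: "r 0 = b" and rn: "r n = v" and rm: "r (n + m) = b"
    using p q unfolding r_def by auto
  have r2: "r (n + i) = q (m - i)" for i
    using p(2) q(2) unfolding r_def by auto
  have radj: "adjacent K (r k) (r (Suc k))" if "k < n + m" for k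
  proof (cases "k < n")
    case True
    then show ?thesis using p(3) unfolding r_def by simp
  next
    case False
    define i where "i = k - n"
    have i: "k = n + i" "i < m" using False that unfolding i_def by auto
    have "adjacent K (q (m - Suc i)) (q (Suc (m - Suc i)))" using q(3) i by simp
    then have "adjacent K (q (m - Suc i)) (q (m - i))" using i by (simp add: Suc_diff_Suc)
    then show ?thesis using r2[of i] r2[of "Suc i"] i by (simp add: adjacent_sym)
  qed
  have closed_end: "along r x (n + m) = x"
  proof (cases "n + m = 0")
    case False
    then show ?thesis using along_closed[OF sc, of "n + m" r x] radj r0 rm x by simp
  qed simp
  have mem: "along r x k \<in> F (r k)" if "k \<le> n + m" for k
    using along_mem[of "n + m" r x k] radj that r0 x by simp
  have "k \<le> m \<Longrightarrow> along r x (n + (m - k)) = along q x k" for k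
  proof (induction k)
    case 0
    then show ?case using closed_end by simp
  next
    case (Suc k)
    define i where "i = n + (m - Suc k)"
    have i: "n + (m - k) = Suc i" "i < n + m" using Suc.prems unfolding i_def by auto
    have ri: "r i = q (Suc k)" "r (Suc i) = q k"
      using r2[of "m - Suc k"] r2[of "m - k"] Suc.prems i unfolding i_def by auto
    have "A (q k) (q (Suc k)) (along r x (Suc i)) = along r x i"
      using A_inv[OF radj[OF i(2)] mem] i(2) by (simp add: ri)
    then show ?case using Suc i(1) unfolding i_def[symmetric] by simp
  qed
  from this[of m] have "along r x n = y'" using q(4) by simp
  moreover have "along r x n = along p x n" by (rule along_cong) (simp add: r_def)
  ultimately show ?thesis using p(4) by simp
qed

lemma global_section:
  assumes sc: "simply_connected (realization K)" and b: "b \<in> vertices K" and x: "x \<in> F b"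
  shows "\<exists>s. s b = x \<and> (\<forall>v w. adjacent K v w \<longrightarrow> s w = A v w (s v)) \<and> (\<forall>v\<in>vertices K. s v \<in> F v)"
proof -
  have b0: "carried b x b x" using carried.intros[of "\<lambda>_. b" b 0 x] by simp
  have ex: "\<exists>y. carried b x v y" if "v \<in> vertices K" for v
    using graph_connected[OF cub sc b that]
  proof induction
    case base
    show ?case using b0 by blast
  next
    case (step v w)
    then show ?case using carried_step by blast
  qed
  define s where "s v = (SOME y. carried b x v y)" for v
  have s: "carried b x v (s v)" if "v \<in> vertices K" for v
    unfolding s_def using ex[OF that] by (rule someI_ex)
  show ?thesis
  proof (intro exI[of _ s] conjI allI impI ballI)
    show "s b = x" using carried_unique[OF sc x s[OF b] b0] .
    show "s w = A v w (s v)" if "adjacent K v w" for v w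
      using carried_unique[OF sc x s carried_step[OF s that]] adjacent_vertices[OF that] by blast
    show "s v \<in> F v" if "v \<in> vertices K" for v
      using carried_mem[OF s[OF that] x] .
  qed
qed

end

section \<open>Reduced paths as geodesics\<close>

locale CAT0 =
  fixes K :: "'v set set"
  assumes CAT0: "CAT0_cube_complex K"
begin

lemma cub: "cubical_complex K" and sc: "simply_connected (realization K)"
  and flag: "\<And>v. v \<in> vertices K \<Longrightarrow> flag_complex (vertex_link K v)"
  using CAT0 unfolding CAT0_cube_complex_def by auto

sublocale cubed_graph "adjacent K" "square K"
  using cubed_graph[OF cub flag] .

lemma local_system_fibre: "local_system K (fibre b) move"
proof
  show "cubical_complex K" by (rule cub)
  show "move v w X \<in> fibre b w" "move w v (move v w X) = X"
    if "adjacent K v w" "X \<in> fibre b v" for v w X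
    using move_fibre[OF that(2,1)] by blast+
  show "move u w (move v u X) = move a w (move v a X)"
    if "square K v u w a" "X \<in> fibre b v" for v u w a X
    using move_flat[OF that(2,1)] .
qed

lemma reduced_flip_equiv:
  assumes "b \<in> vertices K" "reduced p" "reduced q" "hd p = hd q" "last p = b" "last q = b"
  shows "flip_equiv p q"
proof -
  interpret local_system K "fibre b" move by (rule local_system_fibre)
  obtain s where s: "s b = path_class [b]" "\<forall>v w. adjacent K v w \<longrightarrow> s w = move v w (s v)"
    "\<forall>v\<in>vertices K. s v \<in> fibre b v"
    using global_section[OF sc assms(1) reduced_single_fibre] by (elim exE conjE)
  have "path_class p = path_class q"
    using section_reduced[OF s(2)[rule_format] s(1) assms(2,5)]
      section_reduced[OF s(2)[rule_format] s(1) assms(3,6)] assms(4) by simp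
  then show ?thesis using path_class_eq by blast
qed

lemma reduced_exists:
  assumes "b \<in> vertices K" "v \<in> vertices K"
  obtains p where "reduced p" "hd p = v" "last p = b"
proof -
  interpret local_system K "fibre b" move by (rule local_system_fibre)
  obtain s where s: "s b = path_class [b]" "\<forall>v w. adjacent K v w \<longrightarrow> s w = move v w (s v)"
    "\<forall>v\<in>vertices K. s v \<in> fibre b v"
    using global_section[OF sc assms(1) reduced_single_fibre] by (elim exE conjE)
  from s(3)[rule_format, OF assms(2)] show ?thesis using that unfolding fibre_def by blast
qed

abbreviation gdist :: "'v \<Rightarrow> 'v \<Rightarrow> nat" where
  "gdist \<equiv> graph_dist K"

lemma reduced_walk:
  "reduced p \<Longrightarrow> last p \<in> vertices K \<Longrightarrow> walk K p"
proof (induction rule: reduced.induct)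
  case (step v p w)
  then show ?case using adjacent_vertices[OF step(2)] by (simp add: walk_def insert_commute)
qed (simp add: walk_def)

lemma walk_Cons: "walk K (v # w # p) \<longleftrightarrow> adjacent K v w \<and> walk K (w # p)"
  unfolding walk_def by (auto dest: adjacent_vertices)

text \<open>A reduced path from the second vertex of the walk yields a reduced path from the first
  vertex by appending or deleting a single step, and by uniqueness the result is as long as
  \<open>p\<close>.\<close>

lemma reduced_shortest:
  assumes "walk K q" "reduced p" "hd p = hd q" "last p = last q"
  shows "length p \<le> length q"
  using assms
proof (induction q arbitrary: p)
  case (Cons v q)
  have b: "last (v # q) \<in> vertices K" using Cons.prems(1) unfolding walk_def
    by (metis last_in_set subsetD)
  show ?case
  proof (cases q)
    case Nil
    then have "flip_equiv p [v]"
      using Cons.prems b by (intro reduced_flip_equiv[of v]) (auto intro: reduced.single)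
    then show ?thesis using flip_equiv_length by fastforce
  next
    case (Cons w q')
    have w: "adjacent K v w" "walk K q" using Cons.prems(1) unfolding Cons walk_Cons by auto
    have lq: "last q = last (v # q)" using Cons by simp
    obtain r where r: "reduced r" "hd r = w" "last r = last q"
      using reduced_exists[of "last q" w] b lq adjacent_vertices[OF w(1)] by metis
    have len: "length r \<le> length q" using Cons.IH[OF w(2) r(1)] r Cons by simp
    obtain r' where r': "r = w # r'" using r(1,2) reduced_ne by (cases r) auto
    show ?thesis
    proof (cases "v \<in> down r")
      case False
      then have "reduced (v # r)" using r(1) r' w(1) by (auto intro: reduced.step adj_sym)
      then have "flip_equiv p (v # r)"
        using Cons.prems r r' lq by (intro reduced_flip_equiv[OF b]) auto
      then show ?thesis using flip_equiv_length len by fastforce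
    next
      case True
      then obtain t where t: "flip_equiv r (w # v # t)" unfolding down_def r(2) by auto
      have "reduced (v # t)" using reduced_tl reduced_cong[OF t r(1)] by blast
      moreover have "last (v # t) = last r" using flip_equiv_last[OF t] by simp
      ultimately have "flip_equiv p (v # t)"
        using Cons.prems r lq by (intro reduced_flip_equiv[OF b]) auto
      then show ?thesis using flip_equiv_length[OF t] flip_equiv_length[of p "v # t"] len by simp
    qed
  qed
qed (simp add: walk_def)

lemma dist_reduced:
  assumes "reduced p" "last p \<in> vertices K"
  shows "Suc (gdist (hd p) (last p)) = length p"
proof -
  have w: "walk K p" using reduced_walk assms by blast
  have ne: "p \<noteq> []" using reduced_ne assms(1) .
  have "gdist (hd p) (last p) = length p - 1"
    unfolding graph_dist_def
  proof (rule Least_equality)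
    show "\<exists>q. walk K q \<and> length q = Suc (length p - 1) \<and> hd q = hd p \<and> last q = last p"
      using w ne by (intro exI[of _ p]) auto
    fix n assume "\<exists>q. walk K q \<and> length q = Suc n \<and> hd q = hd p \<and> last q = last p"
    then show "length p - 1 \<le> n" using reduced_shortest[OF _ assms(1)] by force
  qed
  then show ?thesis using ne by simp
qed

lemma walk_rev: "walk K p \<Longrightarrow> walk K (rev p)"
  unfolding walk_def by (simp add: successively_rev insert_commute)

lemma dist_sym: "gdist x y = gdist y x"
proof -
  have "(\<exists>p. walk K p \<and> length p = Suc n \<and> hd p = y \<and> last p = x)"
    if ex: "(\<exists>p. walk K p \<and> length p = Suc n \<and> hd p = x \<and> last p = y)" for n x y
  proof -
    obtain p where "walk K p" "length p = Suc n" "hd p = x" "last p = y" using ex by blast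
    then have "walk K (rev p) \<and> length (rev p) = Suc n \<and> hd (rev p) = y \<and> last (rev p) = x"
      using walk_rev by (auto simp: hd_rev last_rev)
    then show ?thesis by blast
  qed
  then have "(\<lambda>n. \<exists>p. walk K p \<and> length p = Suc n \<and> hd p = x \<and> last p = y) =
      (\<lambda>n. \<exists>p. walk K p \<and> length p = Suc n \<and> hd p = y \<and> last p = x)"
    by (intro ext iffI) assumption+
  then show ?thesis unfolding graph_dist_def by (rule arg_cong)
qed

lemma dist_0: "x \<in> vertices K \<Longrightarrow> y \<in> vertices K \<Longrightarrow> gdist x y = 0 \<longleftrightarrow> x = y"
proof
  assume xy: "x \<in> vertices K" "y \<in> vertices K" and 0: "gdist x y = 0"
  obtain p where p: "reduced p" "hd p = x" "last p = y" using reduced_exists xy by metis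
  then have "length p = 1" using dist_reduced[of p] 0 xy by simp
  then show "x = y" using p by (cases p) auto
next
  assume "x \<in> vertices K" "x = y"
  then show "gdist x y = 0" using dist_reduced[of "[x]"] by (simp add: reduced.single)
qed

text \<open>The graph is bipartite, since a step at the endpoint either extends a reduced path or
  can be deleted from it; the distance never stays the same.\<close>

lemma dist_adjacent:
  assumes "adjacent K v w" "b \<in> vertices K"
  shows "gdist v b = Suc (gdist w b) \<or> gdist w b = Suc (gdist v b)"
proof -
  obtain r where r: "reduced r" "hd r = w" "last r = b"
    using reduced_exists[of b w] assms adjacent_vertices[OF assms(1)] by metis
  obtain r' where r': "r = w # r'" using r(1,2) reduced_ne by (cases r) auto
  show ?thesis
  proof (cases "v \<in> down r")
    case False
    then have "reduced (v # r)" using r(1) r' assms(1) by (auto intro: reduced.step adj_sym)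
    then show ?thesis using dist_reduced[of "v # r"] dist_reduced[OF r(1)] r r' assms(2) by simp
  next
    case True
    then obtain t where t: "flip_equiv r (w # v # t)" unfolding down_def r(2) by auto
    have "reduced (v # t)" using reduced_tl reduced_cong[OF t r(1)] by blast
    then show ?thesis
      using dist_reduced[of "v # t"] dist_reduced[OF r(1)] flip_equiv_length[OF t] flip_equiv_last[OF t]
        r assms(2) by simp
  qed
qed

lemma dist_down:
  assumes "v \<in> vertices K" "b \<in> vertices K" "v \<noteq> b"
  obtains u where "adjacent K v u" "gdist v b = Suc (gdist u b)"
proof -
  obtain p where p: "reduced p" "hd p = v" "last p = b"
    using reduced_exists assms(1,2) by metis
  then obtain u q where q: "p = v # u # q"
    using assms(3) reduced_ne by (metis hd_Cons_tl last_ConsL list.sel(1) neq_Nil_conv)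
  have "adjacent K v u" using p(1) unfolding q by (auto elim: reduced_CCE intro: adj_sym)
  moreover have "reduced (u # q)" using p(1) reduced_tl unfolding q by blast
  ultimately show ?thesis
    using that dist_reduced[of p] dist_reduced[of "u # q"] p q assms(2) by simp
qed

text \<open>Geodesics from \<open>w\<close> to \<open>b\<close> through \<open>u\<close> and through
  \<open>v\<close> are reduced paths with common ends. They are flip equivalent by uniqueness, and
  the diamond below \<open>w\<close> is the required square.\<close>

lemma quadrangle:
  assumes adj: "adjacent K w u" "adjacent K w v" and "u \<noteq> v" and b: "b \<in> vertices K"
    and d: "gdist w b = Suc (gdist u b)" "gdist w b = Suc (gdist v b)"
  obtains x where "square K x u w v" "gdist u b = Suc (gdist x b)" "gdist v b = Suc (gdist x b)"
proof -
  have ex: "\<exists>p'. reduced (w # t # p') \<and> last (t # p') = b" if t: "adjacent K w t" "gdist w b = Suc (gdist t b)" for t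
  proof -
    obtain r where r: "reduced r" "hd r = t" "last r = b"
      using reduced_exists[of b t] b adjacent_vertices[OF t(1)] by metis
    obtain r' where r': "r = t # r'" using r(1,2) reduced_ne by (cases r) auto
    have "w \<notin> down r"
    proof
      assume "w \<in> down r"
      then obtain q where q: "flip_equiv r (t # w # q)" unfolding down_def r(2) by auto
      have "reduced (w # q)" using reduced_tl reduced_cong[OF q r(1)] by blast
      then have "gdist t b = Suc (gdist w b)"
        using dist_reduced[of "w # q"] dist_reduced[OF r(1)] flip_equiv_length[OF q] flip_equiv_last[OF q] r b
        by simp
      then show False using t(2) by simp
    qed
    then show ?thesis using r r' t(1) by (auto intro!: exI[of _ r'] reduced.step adj_sym)
  qed
  obtain p where p: "reduced (w # u # p)" "last (u # p) = b" using ex adj(1) d(1) by blast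
  obtain q where q: "reduced (w # v # q)" "last (v # q) = b" using ex adj(2) d(2) by blast
  have "flip_equiv (w # u # p) (w # v # q)"
    using p q b by (intro reduced_flip_equiv[OF b]) auto
  then obtain x r where x: "square K x u w v" "flip_equiv (u # p) (u # x # r)" "flip_equiv (v # q) (v # x # r)"
    using flip_equiv_diamond \<open>u \<noteq> v\<close> by metis
  have red: "reduced (u # p)" using reduced_tl p by blast
  have "reduced (x # r)" using reduced_tl reduced_cong[OF x(2) red] by blast
  then have "gdist u b = Suc (gdist x b)"
    using dist_reduced[of "x # r"] dist_reduced[OF red] flip_equiv_length[OF x(2)] flip_equiv_last[OF x(2)] p b
    by simp
  then show ?thesis using that x(1) d by simp
qed

end

section \<open>Halfspaces\<close>

context CAT0
begin

text \<open>For an edge this is the halfspace containing \<open>u\<close>, expressed without the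
  gate map.\<close>

definition side :: "'v \<Rightarrow> 'v \<Rightarrow> 'v set" where
  "side u v = {x \<in> vertices K. gdist u x < gdist v x}"

lemma side_subset: "side u v \<subseteq> vertices K"
  unfolding side_def by blast

lemma side_iff:
  assumes "adjacent K u v" "x \<in> vertices K"
  shows "x \<in> side u v \<longleftrightarrow> gdist v x = Suc (gdist u x)"
    and "x \<notin> side u v \<longleftrightarrow> gdist u x = Suc (gdist v x)"
  using dist_adjacent[OF assms] assms(2) unfolding side_def by auto

lemma side_swap: "adjacent K u v \<Longrightarrow> x \<in> vertices K \<Longrightarrow> x \<in> side v u \<longleftrightarrow> x \<notin> side u v"
  using side_iff adjacent_sym by metis

lemma side_ends: "adjacent K u v \<Longrightarrow> u \<in> side u v \<and> v \<notin> side u v"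
  using adjacent_vertices[of u v K] adjacent_neq[of u v K] dist_0[of u u] dist_0[of v u] dist_0[of v v]
  unfolding side_def by auto

lemma gate_eq:
  assumes e: "adjacent K u v" and x: "x \<in> vertices K"
  shows "gate K {u, v} x = u \<longleftrightarrow> x \<in> side u v"
proof -
  let ?g = "gate K {u, v} x"
  have g: "?g \<in> {u, v}" "\<not> (\<exists>w\<in>{u, v}. gdist x w < gdist x ?g)"
    using arg_min_if_finite[of "{u, v}" "gdist x"] unfolding gate_def by auto
  show ?thesis
    using g side_iff[OF e x] dist_sym[of x u] dist_sym[of x v] adjacent_neq[OF e] by auto
qed

lemma dual_edge_iff:
  "dual_edge K e h \<longleftrightarrow> (\<exists>u v. e = {u, v} \<and> adjacent K u v \<and> h = side u v)"
proof
  assume "dual_edge K e h"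
  then obtain a where a: "e \<in> edges K" "a \<in> e" "h = {x \<in> vertices K. gate K e x = a}"
    unfolding dual_edge_def by blast
  have "card e = 2" using a(1) by (simp add: edges_def)
  then obtain b where b: "e = {a, b}" using a(2) by (metis card_2_iff doubleton_eq_iff insertE singletonD)
  have "h = side a b"
    using gate_eq[of a b] a(1) side_subset unfolding a(3) b by blast
  then show "\<exists>u v. e = {u, v} \<and> adjacent K u v \<and> h = side u v" using a(1) b by blast
next
  assume "\<exists>u v. e = {u, v} \<and> adjacent K u v \<and> h = side u v"
  then obtain u v where uv: "e = {u, v}" "adjacent K u v" "h = side u v" by blast
  have "side u v = {x \<in> vertices K. gate K {u, v} x = u}"
    using gate_eq[OF uv(2)] side_subset by blast
  then show "dual_edge K e h" unfolding dual_edge_def uv using uv(2) by blast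
qed

lemma halfspaces_iff: "h \<in> halfspaces K \<longleftrightarrow> (\<exists>u v. adjacent K u v \<and> h = side u v)"
  unfolding halfspaces_def dual_edge_iff by blast

lemma halfspace_subset: "h \<in> halfspaces K \<Longrightarrow> h \<subseteq> vertices K"
  unfolding halfspaces_iff using side_subset by blast

text \<open>If \<open>p\<close> lay on the wrong side of the second edge, then \<open>x\<close> and
  \<open>z\<close> would both be closer to \<open>p\<close> than \<open>y\<close> is. The quadrangle
  condition gives a square on \<open>x\<close>, \<open>y\<close>, \<open>z\<close> whose fourth
  corner is closer still; this corner is \<open>w\<close> by uniqueness, but \<open>w\<close> is as
  far from \<open>p\<close> as \<open>y\<close> is.\<close>

lemma square_side_subset:
  assumes sq: "square K x y z w"
  shows "side x y \<subseteq> side w z"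
proof
  fix p assume p: "p \<in> side x y"
  have adj: "adjacent K x y" "adjacent K y z" "adjacent K w z" "adjacent K w x"
    using sq unfolding square_def by (auto simp: insert_commute)
  have pV: "p \<in> vertices K" using p side_subset by blast
  show "p \<in> side w z"
  proof (rule ccontr)
    assume "p \<notin> side w z"
    then have wz: "gdist w p = Suc (gdist z p)" using side_iff[OF adj(3) pV] by simp
    have xy: "gdist y p = Suc (gdist x p)" using p side_iff[OF adj(1) pV] by simp
    have d: "gdist y p = Suc (gdist z p)" "gdist w p = gdist y p"
      using wz xy dist_adjacent[OF adj(2) pV] dist_adjacent[OF adj(4) pV] by arith+
    have "x \<noteq> z" using square_distinct[OF sq] by simp
    then obtain t where t: "square K t x y z" "gdist x p = Suc (gdist t p)"
      using quadrangle[of y x z p] adj(1,2) adjacent_sym xy d(1) pV by metis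
    have "square K x y z t" using square_rotate[OF t(1)] .
    then have "t = w" using square_unique[OF cub _ sq] by blast
    then show False using t(2) d(2) xy by simp
  qed
qed

lemma square_side:
  assumes "square K x y z w"
  shows "side x y = side w z"
proof
  show "side x y \<subseteq> side w z" using square_side_subset[OF assms] .
  have "square K w z y x" using square_rotate[OF square_reflect[OF assms]] .
  then show "side w z \<subseteq> side x y" by (rule square_side_subset)
qed

text \<open>A ladder of squares leads from any edge crossing a halfspace to the edge defining it.\<close>

lemma crossing_edge:
  assumes uv: "adjacent K u v" and xy: "adjacent K x y" "x \<notin> side u v" "y \<in> side u v"
  shows "side y x = side u v"
  using xy
proof (induction "gdist x v" arbitrary: x y)
  case 0
  have V: "x \<in> vertices K" "y \<in> vertices K" "u \<in> vertices K" "v \<in> vertices K"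
    using adjacent_vertices uv 0(2) by metis+
  have x: "x = v" using dist_0 0(1) V by simp
  have "gdist v y = Suc (gdist u y)" using side_iff[OF uv V(2)] 0(4) by simp
  moreover have "gdist v y = Suc 0"
    using dist_adjacent[OF 0(2) V(4)] 0(1) dist_sym[of v y] by auto
  ultimately have "y = u" using dist_0[of u y] V by simp
  then show ?case using x by simp
next
  case (Suc k)
  have V: "x \<in> vertices K" "y \<in> vertices K" "u \<in> vertices K" "v \<in> vertices K"
    using adjacent_vertices uv Suc(3) by metis+
  have d: "gdist x u = Suc (gdist x v)" "gdist y v = Suc (gdist y u)"
    using side_iff[OF uv V(1)] side_iff[OF uv V(2)] Suc(4,5) dist_sym by metis+
  have yu: "gdist x u = Suc (gdist y u)"
    using d dist_adjacent[OF Suc(3) V(3)] dist_adjacent[OF Suc(3) V(4)] by arith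
  have "x \<noteq> v" using Suc(2) dist_0[of v v] V by auto
  then obtain x' where x': "adjacent K x x'" "gdist x v = Suc (gdist x' v)"
    using dist_down V by metis
  have x'V: "x' \<in> vertices K" using adjacent_vertices[OF x'(1)] by simp
  have x'u: "gdist x u = Suc (gdist x' u)" "gdist x' u = Suc (gdist x' v)"
    using dist_adjacent[OF x'(1) V(3)] dist_adjacent[OF uv x'V] x'(2) d dist_sym[of x' u] dist_sym[of x' v] by arith+
  have "y \<noteq> x'" using d x'(2) yu by auto
  \<comment> \<open>The next rung: in this square the edge from \<open>x'\<close> to
    \<open>z\<close> is opposite to the edge from \<open>x\<close> to \<open>y\<close>, and it is
    one step closer to \<open>v\<close>.\<close>
  then obtain z where z: "square K z y x x'" "gdist y u = Suc (gdist z u)"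
    using quadrangle[of x y x' u] Suc(3) x'(1) V(3) yu x'u(1) by metis
  have adj: "adjacent K x' z" "adjacent K y z" using z(1) unfolding square_def by (auto simp: insert_commute)
  have zV: "z \<in> vertices K" using adjacent_vertices[OF adj(1)] by simp
  have zv: "gdist z v = Suc (gdist z u)"
    using dist_adjacent[OF adj(2) V(4)] dist_adjacent[OF uv zV] z(2) d dist_sym[of z u] dist_sym[of z v] by arith
  have "x' \<notin> side u v" "z \<in> side u v"
    using side_iff[OF uv x'V] side_iff[OF uv zV] x'u zv dist_sym by metis+
  then have "side z x' = side u v" using Suc(1)[of x' z] x'(2) Suc(2) adj(1) by simp
  moreover have "side y x = side z x'" using square_side[OF square_rotate[OF z(1)]] .
  ultimately show ?case by simp
qed

lemma halfspace_crossing: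
  assumes "h \<in> halfspaces K" "adjacent K x y" "x \<notin> h" "y \<in> h"
  shows "h = side y x"
  using assms crossing_edge unfolding halfspaces_iff by blast

section \<open>Intervals of halfspaces and their antichains\<close>

lemma hinterval_iff:
  "a \<in> vertices K \<Longrightarrow> h \<in> hinterval K a c \<longleftrightarrow> h \<in> halfspaces K \<and> c \<in> h \<and> a \<notin> h"
  unfolding hinterval_def hcompl_def by blast

text \<open>Each step of a geodesic away from \<open>a\<close> adds at most one halfspace, the one
  dual to the edge just crossed.\<close>

lemma finite_hinterval:
  assumes "a \<in> vertices K" "c \<in> vertices K"
  shows "finite (hinterval K a c)"
  using assms(2)
proof (induction "gdist c a" arbitrary: c)
  case 0
  then have "c = a" using dist_0 assms(1) by simp
  then have "hinterval K a c = {}" using hinterval_iff[OF assms(1)] by blast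
  then show ?case by simp
next
  case (Suc k)
  then have "c \<noteq> a" using dist_0[of a a] assms(1) by auto
  then obtain c' where c': "adjacent K c c'" "gdist c a = Suc (gdist c' a)"
    using dist_down Suc.prems assms(1) by metis
  have "finite (hinterval K a c')"
    using Suc(1)[of c'] Suc(2) c' adjacent_vertices[OF c'(1)] by simp
  moreover have "hinterval K a c \<subseteq> insert (side c c') (hinterval K a c')"
  proof
    fix h assume "h \<in> hinterval K a c"
    then have h: "h \<in> halfspaces K" "c \<in> h" "a \<notin> h" using hinterval_iff[OF assms(1)] by auto
    show "h \<in> insert (side c c') (hinterval K a c')"
    proof (cases "c' \<in> h")
      case True
      then show ?thesis using h hinterval_iff[OF assms(1)] by blast
    next
      case False
      then show ?thesis using halfspace_crossing[OF h(1) adjacent_sym[OF c'(1)]] h(2) by blast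
    qed
  qed
  ultimately show ?case by (meson finite_insert finite_subset)
qed

text \<open>A geodesic from \<open>x\<close> crosses \<open>g\<close> at some edge. As long as this
  is not its initial edge, maximality of \<open>g\<close> lets the crossing be pushed back through a
  square, one edge closer to \<open>x\<close>.\<close>

lemma maximal_first_edge:
  assumes xy: "x \<in> vertices K" "y \<in> vertices K" and g: "g \<in> hinterval K x y"
    and max: "\<And>h. h \<in> hinterval K x y \<Longrightarrow> \<not> g \<subset> h"
  shows "\<exists>x'. adjacent K x x' \<and> gdist x y = Suc (gdist x' y) \<and> g = side x' x"
  using xy(1) g max
proof (induction "gdist x y" arbitrary: x)
  case 0
  then have "x = y" using dist_0 xy(2) by simp
  then show ?case using hinterval_iff[OF 0(2)] 0(3) by blast
next
  case (Suc n)
  note x = Suc(3)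
  have g: "g \<in> halfspaces K" "y \<in> g" "x \<notin> g" using hinterval_iff[OF x] Suc(4) by auto
  then have "x \<noteq> y" by blast
  then obtain z where z: "adjacent K x z" "gdist x y = Suc (gdist z y)" using dist_down x xy(2) by metis
  have zV: "z \<in> vertices K" using adjacent_vertices[OF z(1)] by simp
  have sz: "y \<in> side z x" using side_iff[OF adjacent_sym[OF z(1)] xy(2)] z(2) by simp
  have sz': "side z x \<in> hinterval K x y"
    using hinterval_iff[OF x] sz side_ends[OF adjacent_sym[OF z(1)]] adjacent_sym[OF z(1)]
    unfolding halfspaces_iff by blast
  show ?case
  proof (cases "z \<in> g")
    case True
    then show ?thesis using halfspace_crossing[OF g(1) z(1) g(3)] z by blast
  next
    case False
    have sub: "h \<in> hinterval K x y" if "h \<in> hinterval K z y" for h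
    proof -
      have h: "h \<in> halfspaces K" "y \<in> h" "z \<notin> h" using that hinterval_iff[OF zV] by auto
      have "x \<notin> h"
      proof
        assume "x \<in> h"
        then have "h = side x z" using halfspace_crossing[OF h(1) adjacent_sym[OF z(1)] h(3)] by simp
        then show False using h(2) sz side_swap[OF z(1) xy(2)] by blast
      qed
      then show ?thesis using h hinterval_iff[OF x] by blast
    qed
    have "g \<in> hinterval K z y" using g(1,2) False hinterval_iff[OF zV] by blast
    moreover have "\<And>h. h \<in> hinterval K z y \<Longrightarrow> \<not> g \<subset> h" using sub Suc(5) by blast
    ultimately obtain z' where z': "adjacent K z z'" "gdist z y = Suc (gdist z' y)" "g = side z' z"
      using Suc(1)[of z] Suc(2) z(2) zV by auto
    have "g \<noteq> side z x" using False side_ends[OF adjacent_sym[OF z(1)]] by blast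
    \<comment> \<open>By maximality \<open>g\<close> is not contained in the halfspace
      \<open>side z x\<close>. Seen from a point \<open>w\<close> showing this, \<open>x\<close> and
      \<open>z'\<close> are both closer than \<open>z\<close>, so the quadrangle condition applies
      at \<open>z\<close>.\<close>
    then obtain w where w: "w \<in> g" "w \<notin> side z x" using Suc(5)[OF sz'] by blast
    have wV: "w \<in> vertices K" using w(1) halfspace_subset[OF g(1)] by blast
    have dw: "gdist z w = Suc (gdist z' w)" "gdist z w = Suc (gdist x w)"
      using side_iff[OF adjacent_sym[OF z'(1)] wV] side_iff[OF adjacent_sym[OF z(1)] wV] w z'(3) by auto
    have "x \<noteq> z'" using z(2) z'(2) by auto
    then obtain t where t: "square K t x z z'"
      using quadrangle[of z x z' w] adjacent_sym[OF z(1)] z'(1) wV dw by metis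
    have tx: "adjacent K t x" using t unfolding square_def by blast
    have "side t x = g" using square_side[OF t] z'(3) by simp
    moreover have "gdist x y = Suc (gdist t y)" using side_iff[OF tx xy(2)] calculation g(2) by simp
    ultimately show ?thesis using adjacent_sym[OF tx] by blast
  qed
qed

text \<open>If \<open>x\<close>, \<open>y\<close> is a closest pair separated by all of
  \<open>A\<close>, then every member of \<open>A\<close> is dual to an edge at \<open>x\<close>
  that begins a geodesic to \<open>y\<close>. Such edges pairwise span squares by the quadrangle
  condition, and flagness yields a cube of dimension \<open>card A\<close>.\<close>

lemma antichain_dimension:
  assumes ac: "a \<in> vertices K" "c \<in> vertices K" and A: "A \<subseteq> hinterval K a c"
    and anti: "\<And>h k. h \<in> A \<Longrightarrow> k \<in> A \<Longrightarrow> \<not> h \<subset> k"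
    and dim: "\<And>C n c. C \<in> K \<Longrightarrow> cube_chart K n c C \<Longrightarrow> n \<le> d"
  shows "card A \<le> d"
proof -
  define Q where "Q = (\<lambda>(x, y). x \<in> vertices K \<and> y \<in> vertices K \<and> A \<subseteq> hinterval K x y)"
  have "Q (a, c)" unfolding Q_def using ac A by simp
  then obtain p where "Q p" and least: "\<And>q. Q q \<Longrightarrow> case_prod gdist p \<le> case_prod gdist q"
    using ex_has_least_nat[of Q "(a, c)" "case_prod gdist"] by blast
  then obtain x y where p: "p = (x, y)" and xy: "x \<in> vertices K" "y \<in> vertices K" "A \<subseteq> hinterval K x y"
    unfolding Q_def by (cases p) auto
  have min: "gdist x y \<le> gdist x' y" if "x' \<in> vertices K" "A \<subseteq> hinterval K x' y" for x'
    using least[of "(x', y)"] that xy unfolding Q_def p by simp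
  have fin: "finite (hinterval K x y)" using finite_hinterval xy by blast
  have first: "\<exists>x'. adjacent K x x' \<and> gdist x y = Suc (gdist x' y) \<and> h = side x' x" if h: "h \<in> A" for h
  proof -
    have "h \<in> hinterval K x y" using h xy(3) by blast
    from finite_has_maximal2[OF fin this] obtain g
      where g: "g \<in> hinterval K x y" "h \<subseteq> g" "\<forall>k\<in>hinterval K x y. g \<subseteq> k \<longrightarrow> g = k"
      by blast
    have "\<not> g \<subset> k" if "k \<in> hinterval K x y" for k using g(3) that by blast
    then obtain x' where x': "adjacent K x x'" "gdist x y = Suc (gdist x' y)" "g = side x' x"
      using maximal_first_edge[OF xy(1,2) g(1)] by blast
    have x'V: "x' \<in> vertices K" using adjacent_vertices[OF x'(1)] by simp
    \<comment> \<open>Moving on to \<open>x'\<close> would give a closer pair, so some member of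
      \<open>A\<close> is lost. Only the halfspace dual to the crossed edge can be lost; hence
      \<open>g\<close> itself is in \<open>A\<close>, and the antichain condition identifies it with
      \<open>h\<close>.\<close>
    have "\<not> A \<subseteq> hinterval K x' y" using min[OF x'V] x'(2) by auto
    then obtain k where k: "k \<in> A" "k \<notin> hinterval K x' y" by blast
    then have "k \<in> halfspaces K" "x \<notin> k" "x' \<in> k"
      using xy(3) hinterval_iff[OF xy(1)] hinterval_iff[OF x'V] by blast+
    then have "k = g" using halfspace_crossing x' by metis
    then have "h = g" using anti[OF h k(1)] g(2) by blast
    then show ?thesis using x' by blast
  qed
  then obtain f where f: "\<And>h. h \<in> A \<Longrightarrow> adjacent K x (f h)" "\<And>h. h \<in> A \<Longrightarrow> gdist x y = Suc (gdist (f h) y)"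
    "\<And>h. h \<in> A \<Longrightarrow> h = side (f h) x"
    by metis
  have inj: "inj_on f A" using f(3) by (metis inj_onI)
  have finA: "finite A" using fin xy(3) finite_subset by blast
  have sqs: "\<exists>z. square K x u z v" if uv: "u \<in> f ` A" "v \<in> f ` A" "u \<noteq> v" for u v
  proof -
    obtain h k where hk: "h \<in> A" "u = f h" "k \<in> A" "v = f k" using uv by blast
    obtain z where "square K z u x v"
      by (rule quadrangle[OF f(1)[OF hk(1), folded hk(2)] f(1)[OF hk(3), folded hk(4)] uv(3) xy(2)
            f(2)[OF hk(1), folded hk(2)] f(2)[OF hk(3), folded hk(4)]])
    from square_reflect[OF square_rotate[OF square_rotate[OF this]]] show ?thesis by blast
  qed
  have nbr: "adjacent K x u" if "u \<in> f ` A" for u using that f(1) by blast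
  have "finite (f ` A)" using finA by simp
  show ?thesis
  proof (rule flag_cube[OF cub flag[OF xy(1)] \<open>finite (f ` A)\<close>])
    show "adjacent K x u" if "u \<in> f ` A" for u using nbr that .
    show "\<exists>z. square K x u z v" if "u \<in> f ` A" "v \<in> f ` A" "u \<noteq> v" for u v using sqs that .
    fix n c' C assume "C \<in> K" "cube_chart K n c' C" "card (f ` A) = n"
    then show "card A \<le> d" using dim[of C n c'] card_image[OF inj] by simp
  qed
qed

end

lemma cc_dimension_bound:
  assumes "cc_dimension K < \<infinity>"
  obtains d where "\<And>C n c. C \<in> K \<Longrightarrow> cube_chart K n c C \<Longrightarrow> n \<le> d"
proof -
  obtain d where d: "cc_dimension K = enat d" using assms by auto
  have "n \<le> d" if "C \<in> K" "cube_chart K n c C" for C n c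
  proof -
    have "enat n \<le> cc_dimension K" unfolding cc_dimension_def by (rule Sup_upper) (use that in blast)
    then show ?thesis using d by simp
  qed
  then show ?thesis using that by blast
qed

lemma staircase_length_bound:
  assumes "staircase_length K < \<infinity>"
  obtains d where "\<And>hs ks. staircase K hs ks \<Longrightarrow> length hs \<le> d"
proof -
  obtain d where d: "staircase_length K = enat d" using assms by auto
  have "length hs \<le> d" if "staircase K hs ks" for hs ks
  proof -
    have "enat (length hs) \<le> staircase_length K"
      unfolding staircase_length_def by (rule Sup_upper) (use that in blast)
    then show ?thesis using d by simp
  qed
  then show ?thesis using that by blast
qed

section \<open>Counting segments\<close>

text \<open>Ramsey's theorem for pairs in three colours. A pair is coloured by an index of a
  relation that holds for it, lower indices being preferred, so the relations may overlap; symmetry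
  lets unordered pairs be coloured.\<close>

lemma ramsey_three_relations:
  "\<exists>N. \<forall>Q :: 'q set. N \<le> card Q \<longrightarrow>
    (\<forall>x\<in>Q. \<forall>y\<in>Q. x \<noteq> y \<longrightarrow> R0 x y \<or> R1 x y \<or> R2 x y) \<longrightarrow>
    (\<forall>x y. R0 x y \<longrightarrow> R0 y x) \<longrightarrow> (\<forall>x y. R1 x y \<longrightarrow> R1 y x) \<longrightarrow> (\<forall>x y. R2 x y \<longrightarrow> R2 y x) \<longrightarrow>
    (\<exists>H\<subseteq>Q. finite H \<and> (card H = m0 \<and> pairwise R0 H \<or> card H = m1 \<and> pairwise R1 H \<or> card H = m2 \<and> pairwise R2 H))"
  for m0 m1 m2 :: nat
proof -
  obtain N :: nat where N: "partn_lst {..<N} [m0, m1, m2] 2"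
    using ramsey_full by blast
  show ?thesis
  proof (intro exI[of _ N] allI impI)
    fix Q :: "'q set"
    assume card: "N \<le> card Q"
      and R: "\<forall>x\<in>Q. \<forall>y\<in>Q. x \<noteq> y \<longrightarrow> R0 x y \<or> R1 x y \<or> R2 x y"
      and sym: "\<forall>x y. R0 x y \<longrightarrow> R0 y x" "\<forall>x y. R1 x y \<longrightarrow> R1 y x" "\<forall>x y. R2 x y \<longrightarrow> R2 y x"
    obtain Q' where Q': "Q' \<subseteq> Q" "card Q' = N" "finite Q'"
      using obtain_subset_with_card_n[OF card] by metis
    obtain g where g: "bij_betw g {..<N} Q'"
      using Q'(2,3) ex_bij_betw_nat_finite[of Q'] by (metis atLeast0LessThan)
    define f where "f S = (if \<forall>x\<in>S. \<forall>y\<in>S. x \<noteq> y \<longrightarrow> R0 (g x) (g y) then 0::nat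
        else if \<forall>x\<in>S. \<forall>y\<in>S. x \<noteq> y \<longrightarrow> R1 (g x) (g y) then 1 else 2)" for S
    have "f \<in> nsets {..<N} 2 \<rightarrow> {..<3}" by (auto simp: f_def)
    then obtain i H where i: "i < 3" and H: "H \<in> nsets {..<N} ([m0, m1, m2] ! i)" "f ` (nsets H 2) \<subseteq> {i}"
      using partn_lstE[OF N, of f 3] by (auto simp: numeral_3_eq_3)
    have HN: "H \<subseteq> {..<N}" "finite H" "card H = [m0, m1, m2] ! i"
      using H(1) unfolding nsets_def by auto
    have inj: "inj_on g H" using g HN(1) by (meson bij_betw_def inj_on_subset)
    have gQ: "g x \<in> Q" if "x \<in> H" for x using g HN(1) Q'(1) that by (auto simp: bij_betw_def)
    have col: "f {x, y} = i" if "x \<in> H" "y \<in> H" "x \<noteq> y" for x y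
    proof -
      have "{x, y} \<in> nsets H 2" using that by simp
      then show ?thesis using H(2) by blast
    qed
    have pw: "pairwise R (g ` H)" if "\<And>x y. x \<in> H \<Longrightarrow> y \<in> H \<Longrightarrow> x \<noteq> y \<Longrightarrow> R (g x) (g y)" for R
      using that unfolding pairwise_def by blast
    have "i = 0 \<or> i = 1 \<or> i = 2" using i by auto
    then have "card H = m0 \<and> pairwise R0 (g ` H) \<or> card H = m1 \<and> pairwise R1 (g ` H) \<or> card H = m2 \<and> pairwise R2 (g ` H)"
    proof (elim disjE)
      assume i: "i = 0"
      have "pairwise R0 (g ` H)"
      proof (rule pw)
        fix x y assume xy: "x \<in> H" "y \<in> H" "x \<noteq> y"
        then have "f {x, y} = 0" using col i by simp
        then show "R0 (g x) (g y)" using xy(3) unfolding f_def by (auto split: if_splits)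
      qed
      then show ?thesis using HN(3) i by simp
    next
      assume i: "i = 1"
      have "pairwise R1 (g ` H)"
      proof (rule pw)
        fix x y assume xy: "x \<in> H" "y \<in> H" "x \<noteq> y"
        then have "f {x, y} = 1" using col i by simp
        then show "R1 (g x) (g y)" using xy(3) unfolding f_def by (auto split: if_splits)
      qed
      then show ?thesis using HN(3) i by simp
    next
      assume i: "i = 2"
      have "pairwise R2 (g ` H)"
      proof (rule pw)
        fix x y assume xy: "x \<in> H" "y \<in> H" "x \<noteq> y"
        then have "f {x, y} = 2" using col i by simp
        then have "\<not> R0 (g x) (g y) \<or> \<not> R0 (g y) (g x)" "\<not> R1 (g x) (g y) \<or> \<not> R1 (g y) (g x)"
          using xy(3) unfolding f_def by (auto split: if_splits)
        moreover have "g x \<noteq> g y" using inj xy by (simp add: inj_on_eq_iff)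
        ultimately show "R2 (g x) (g y)" using R gQ[OF xy(1)] gQ[OF xy(2)] sym by blast
      qed
      then show ?thesis using HN(3) i by simp
    qed
    then show "\<exists>H\<subseteq>Q. finite H \<and> (card H = m0 \<and> pairwise R0 H \<or> card H = m1 \<and> pairwise R1 H \<or> card H = m2 \<and> pairwise R2 H)"
      using gQ card_image[OF inj] HN(2) by (intro exI[of _ "g ` H"]) auto
  qed
qed

lemma finite_chain_sorted:
  assumes "finite C" and trans: "\<And>x y z. R x y \<Longrightarrow> R y z \<Longrightarrow> R x z"
    and total: "\<And>x y. x \<in> C \<Longrightarrow> y \<in> C \<Longrightarrow> x \<noteq> y \<Longrightarrow> R x y \<or> R y x"
  shows "\<exists>xs. set xs = C \<and> distinct xs \<and> sorted_wrt R xs"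
  using assms(1,3)
proof (induction C)
  case (insert a C)
  then obtain xs where xs: "set xs = C" "distinct xs" "sorted_wrt R xs" by auto
  define ys where "ys = filter (\<lambda>x. R x a) xs @ a # filter (\<lambda>x. \<not> R x a) xs"
  have "R a x" if "x \<in> C" "\<not> R x a" for x
    using insert.prems[of a x] insert.hyps(2) that by auto
  then have "sorted_wrt R ys"
    using xs trans unfolding ys_def by (auto simp: sorted_wrt_append intro: sorted_wrt_filter)
  moreover have "set ys = insert a C" "distinct ys"
    using xs insert.hyps(2) unfolding ys_def by auto
  ultimately show ?case by blast
qed simp

text \<open>Each of the \<open>n\<close> entries after the head is one of at most \<open>d\<close>
  successors of its predecessor.\<close>

lemma card_successive_lists:
  assumes P: "finite P" and deg: "\<And>h. h \<in> P \<Longrightarrow> card {k \<in> P. R h k} \<le> d" and "h \<in> P"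
  shows "card {t. length t = Suc n \<and> set t \<subseteq> P \<and> successively R t \<and> hd t = h} \<le> d ^ n"
  using assms(3)
proof (induction n arbitrary: h)
  case 0
  have "{t. length t = Suc 0 \<and> set t \<subseteq> P \<and> successively R t \<and> hd t = h} \<subseteq> {[h]}"
    by (auto simp: length_Suc_conv)
  then have "card {t. length t = Suc 0 \<and> set t \<subseteq> P \<and> successively R t \<and> hd t = h} \<le> card {[h]}"
    by (rule card_mono[rotated]) simp
  then show ?case by simp
next
  case (Suc n)
  let ?L = "\<lambda>n h. {t. length t = Suc n \<and> set t \<subseteq> P \<and> successively R t \<and> hd t = h}"
  have finL: "finite (?L n k)" for n k
    by (rule finite_subset[OF _ finite_lists_length_eq[OF P, of "Suc n"]]) auto
  have "?L (Suc n) h \<subseteq> (\<Union>k\<in>{k \<in> P. R h k}. (#) h ` ?L n k)"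
  proof
    fix t assume "t \<in> ?L (Suc n) h"
    then have t: "length t = Suc (Suc n)" "set t \<subseteq> P" "successively R t" "hd t = h" by auto
    then obtain k r where kr: "t = h # k # r" by (cases t; cases "tl t") auto
    then have "k # r \<in> ?L n k" "k \<in> {k \<in> P. R h k}" using t by auto
    then show "t \<in> (\<Union>k\<in>{k \<in> P. R h k}. (#) h ` ?L n k)" using kr by blast
  qed
  then have "card (?L (Suc n) h) \<le> card (\<Union>k\<in>{k \<in> P. R h k}. (#) h ` ?L n k)"
    by (rule card_mono[rotated]) (use P finL in auto)
  also have "\<dots> \<le> (\<Sum>k\<in>{k \<in> P. R h k}. card ((#) h ` ?L n k))"
    by (rule card_UN_le) (use P in auto)
  also have "\<dots> \<le> (\<Sum>k\<in>{k \<in> P. R h k}. d ^ n)"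
  proof (rule sum_mono)
    fix k assume "k \<in> {k \<in> P. R h k}"
    then show "card ((#) h ` ?L n k) \<le> d ^ n"
      using Suc.IH[of k] card_image_le[OF finL, of "(#) h" n k] by auto
  qed
  also have "\<dots> \<le> d ^ Suc n" using deg[OF Suc.prems] by simp
  finally show ?case .
qed

lemma card_successive_lists_last:
  assumes P: "finite P" and deg: "\<And>h. h \<in> P \<Longrightarrow> card {k \<in> P. R k h} \<le> d" and "h \<in> P"
  shows "card {t. length t = Suc n \<and> set t \<subseteq> P \<and> successively R t \<and> last t = h} \<le> d ^ n"
proof -
  have "{t. length t = Suc n \<and> set t \<subseteq> P \<and> successively R t \<and> last t = h} =
      rev ` {t. length t = Suc n \<and> set t \<subseteq> P \<and> successively (\<lambda>x y. R y x) t \<and> hd t = h}"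
  proof (intro subset_antisym subsetI)
    fix t assume "t \<in> {t. length t = Suc n \<and> set t \<subseteq> P \<and> successively R t \<and> last t = h}"
    then show "t \<in> rev ` {t. length t = Suc n \<and> set t \<subseteq> P \<and> successively (\<lambda>x y. R y x) t \<and> hd t = h}"
      by (intro image_eqI[of _ _ "rev t"]) (auto simp: hd_rev)
  qed (auto simp: last_rev)
  moreover have "inj_on rev A" for A :: "'a list set" by (simp add: inj_on_def)
  ultimately show ?thesis
    using card_successive_lists[OF P, of "\<lambda>x y. R y x" d h n] deg assms(3) by (simp add: card_image)
qed

section \<open>Segments that straddle a vertex\<close>

context CAT0
begin

context
  fixes d \<sigma> :: nat
  assumes dim: "\<And>C n c. C \<in> K \<Longrightarrow> cube_chart K n c C \<Longrightarrow> n \<le> d"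
    and stair: "\<And>hs ks. staircase K hs ks \<Longrightarrow> length hs \<le> \<sigma>"
begin

text \<open>Two elements of \<open>steps a b c\<close> are either nested in both entries, which yields steps of a
  staircase, or they have incomparable first or second entries.\<close>

definition steps :: "'v \<Rightarrow> 'v \<Rightarrow> 'v \<Rightarrow> ('v set \<times> 'v set) set" where
  "steps a b c = {(h, k). h \<in> hinterval K a c \<and> k \<in> hinterval K a c \<and> b \<in> h \<and> b \<notin> k \<and> tightly_nested K h k}"

text \<open>Sorted by inclusion, the upper and the lower entries form the two chains of a staircase.
  For \<open>j < i\<close> the vertices \<open>a\<close>, \<open>b\<close> and \<open>c\<close>
  witness three of the four intersections required for transversality. If the fourth were empty, the
  upper entry of step \<open>i\<close> would lie strictly between the two entries of step
  \<open>j\<close>, against tightness.\<close>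

lemma steps_chain:
  assumes abc: "a \<in> vertices K" "b \<in> vertices K" "c \<in> vertices K"
    and H: "H \<subseteq> steps a b c" "finite H"
    and chain: "pairwise (\<lambda>q q'. fst q' \<subset> fst q \<and> snd q' \<subset> snd q \<or> fst q \<subset> fst q' \<and> snd q \<subset> snd q') H"
  shows "card H \<le> \<sigma>"
proof -
  define R :: "'v set \<times> 'v set \<Rightarrow> 'v set \<times> 'v set \<Rightarrow> bool"
    where "R = (\<lambda>q q'. fst q' \<subset> fst q \<and> snd q' \<subset> snd q)"
  have "\<exists>qs. set qs = H \<and> distinct qs \<and> sorted_wrt R qs"
  proof (rule finite_chain_sorted[OF H(2)])
    show "R x z" if "R x y" "R y z" for x y z using that unfolding R_def by auto
    show "R x y \<or> R y x" if "x \<in> H" "y \<in> H" "x \<noteq> y" for x y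
      using chain that unfolding pairwise_def R_def by blast
  qed
  then obtain qs where qs: "set qs = H" "distinct qs" "sorted_wrt R qs" by blast
  have q: "fst q \<in> hinterval K a c" "snd q \<in> hinterval K a c" "b \<in> fst q" "b \<notin> snd q"
    "tightly_nested K (fst q) (snd q)" if "q \<in> set qs" for q
    using that H(1) qs(1) unfolding steps_def by auto
  have half: "fst q \<in> halfspaces K" "snd q \<in> halfspaces K" "c \<in> fst q" "c \<in> snd q" "a \<notin> fst q" "a \<notin> snd q"
    if "q \<in> set qs" for q
    using q(1,2)[OF that] unfolding hinterval_iff[OF abc(1)] by blast+
  have suc: "successively R qs" using qs(3) by (rule successively_if_sorted_wrt)
  have "staircase K (map fst qs) (map snd qs)"
    unfolding staircase_def proper_chain_def
  proof (intro conjI allI impI)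
    show "length (map fst qs) = length (map snd qs)" by simp
    show "set (map fst qs) \<subseteq> halfspaces K" "set (map snd qs) \<subseteq> halfspaces K" using half by auto
    show "successively (\<lambda>h k. k \<subset> h) (map fst qs)" "successively (\<lambda>h k. k \<subset> h) (map snd qs)"
      unfolding successively_map using suc by (auto elim!: successively_mono simp: R_def)
  next
    fix i j assume ij: "i < length (map fst qs)" "j < i"
    define h k h' k' where "h = fst (qs ! i)" and "k = snd (qs ! i)" and "h' = fst (qs ! j)" and "k' = snd (qs ! j)"
    have m: "qs ! i \<in> set qs" "qs ! j \<in> set qs" using ij by auto
    have "R (qs ! j) (qs ! i)" using qs(3) ij by (simp add: sorted_wrt_nth_less)
    then have hh: "h \<subset> h'" unfolding R_def h_def h'_def by blast
    have "b \<in> h \<inter> hcompl K k'" "c \<in> h \<inter> k'" "a \<in> hcompl K h \<inter> hcompl K k'"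
      using q[OF m(1)] q[OF m(2)] half[OF m(1)] half[OF m(2)] abc
      unfolding hcompl_def h_def k'_def by auto
    moreover have "hcompl K h \<inter> k' \<noteq> {}"
    proof
      assume "hcompl K h \<inter> k' = {}"
      moreover have "k' \<subseteq> vertices K" using half(2)[OF m(2)] halfspace_subset unfolding k'_def by blast
      ultimately have "k' \<subseteq> h" unfolding hcompl_def by blast
      then have "k' \<subset> h" using q(3)[OF m(1)] q(4)[OF m(2)] unfolding h_def k'_def by blast
      then show False
        using hh q(5)[OF m(2)] half(1)[OF m(1)] unfolding tightly_nested_def h_def h'_def k'_def by blast
    qed
    ultimately show "transverse K (map fst qs ! i) (map snd qs ! j)"
      using ij unfolding transverse_def h_def k'_def by auto
  next
    fix i assume i: "i < length (map fst qs)"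
    then show "map snd qs ! i \<subset> map fst qs ! i"
      using q(5)[of "qs ! i"] unfolding tightly_nested_def by simp
  qed
  then have "length (map fst qs) \<le> \<sigma>" by (rule stair)
  then show ?thesis using distinct_card[OF qs(2)] qs(1) by simp
qed

text \<open>Tightness excludes the mixed orders. Over equal upper entries the lower ones are
  incomparable; over strictly nested upper entries, lower entries that are equal or nested the other
  way would place one upper entry strictly inside the other step.\<close>

lemma steps_cases:
  assumes "(h, k) \<in> steps a b c" "(h', k') \<in> steps a b c" "(h, k) \<noteq> (h', k')" "a \<in> vertices K"
  shows "(h' \<subset> h \<and> k' \<subset> k \<or> h \<subset> h' \<and> k \<subset> k') \<or> (h \<noteq> h' \<and> \<not> h \<subset> h' \<and> \<not> h' \<subset> h) \<or>
    (k \<noteq> k' \<and> \<not> k \<subset> k' \<and> \<not> k' \<subset> k)"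
proof -
  have hk: "tightly_nested K h k" "tightly_nested K h' k'" "h \<in> halfspaces K" "h' \<in> halfspaces K"
    "k \<in> halfspaces K" "k' \<in> halfspaces K"
    using assms(1,2) unfolding steps_def by (auto simp: hinterval_iff[OF assms(4)])
  then have sub: "k \<subset> h" "k' \<subset> h'"
    and tight: "\<And>g. g \<in> halfspaces K \<Longrightarrow> k \<subset> g \<Longrightarrow> g \<subset> h \<Longrightarrow> False"
      "\<And>g. g \<in> halfspaces K \<Longrightarrow> k' \<subset> g \<Longrightarrow> g \<subset> h' \<Longrightarrow> False"
    unfolding tightly_nested_def by blast+
  consider "h = h'" | "h' \<subset> h" | "h \<subset> h'" | "h \<noteq> h'" "\<not> h \<subset> h'" "\<not> h' \<subset> h" by blast
  then show ?thesis
  proof cases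
    case 1
    then have "k \<noteq> k'" using assms(3) by simp
    moreover have "\<not> k \<subset> k'" using tight(1)[OF hk(6)] sub 1 by blast
    moreover have "\<not> k' \<subset> k" using tight(2)[OF hk(5)] sub 1 by blast
    ultimately show ?thesis by blast
  next
    case 2
    have "\<not> k \<subseteq> k'" using tight(1)[OF hk(4)] sub 2 by blast
    then show ?thesis using 2 by blast
  next
    case 3
    have "\<not> k' \<subseteq> k" using tight(2)[OF hk(3)] sub 3 by blast
    then show ?thesis using 3 by blast
  qed blast
qed

lemma card_steps_bounded:
  "\<exists>N. \<forall>a\<in>vertices K. \<forall>b\<in>vertices K. \<forall>c\<in>vertices K. card (steps a b c) \<le> N"
proof -
  define R0 :: "'v set \<times> 'v set \<Rightarrow> 'v set \<times> 'v set \<Rightarrow> bool"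
    where "R0 = (\<lambda>q q'. fst q' \<subset> fst q \<and> snd q' \<subset> snd q \<or> fst q \<subset> fst q' \<and> snd q \<subset> snd q')"
  define R1 :: "'v set \<times> 'v set \<Rightarrow> 'v set \<times> 'v set \<Rightarrow> bool"
    where "R1 = (\<lambda>q q'. fst q \<noteq> fst q' \<and> \<not> fst q \<subset> fst q' \<and> \<not> fst q' \<subset> fst q)"
  define R2 :: "'v set \<times> 'v set \<Rightarrow> 'v set \<times> 'v set \<Rightarrow> bool"
    where "R2 = (\<lambda>q q'. snd q \<noteq> snd q' \<and> \<not> snd q \<subset> snd q' \<and> \<not> snd q' \<subset> snd q)"
  \<comment> \<open>The sizes are one too large on purpose: a homogeneous set would give a staircase
    longer than \<open>\<sigma>\<close> or an antichain of more than \<open>d\<close>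
    halfspaces.\<close>
  obtain N where N: "\<forall>Q :: ('v set \<times> 'v set) set. N \<le> card Q \<longrightarrow>
    (\<forall>x\<in>Q. \<forall>y\<in>Q. x \<noteq> y \<longrightarrow> R0 x y \<or> R1 x y \<or> R2 x y) \<longrightarrow>
    (\<forall>x y. R0 x y \<longrightarrow> R0 y x) \<longrightarrow> (\<forall>x y. R1 x y \<longrightarrow> R1 y x) \<longrightarrow> (\<forall>x y. R2 x y \<longrightarrow> R2 y x) \<longrightarrow>
    (\<exists>H\<subseteq>Q. finite H \<and> (card H = Suc \<sigma> \<and> pairwise R0 H \<or> card H = Suc d \<and> pairwise R1 H \<or> card H = Suc d \<and> pairwise R2 H))"
    using ramsey_three_relations[of R0 R1 R2 "Suc \<sigma>" "Suc d" "Suc d"] by (elim exE)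
  show ?thesis
  proof (intro exI[of _ N] ballI, rule ccontr)
    fix a b c assume abc: "a \<in> vertices K" "b \<in> vertices K" "c \<in> vertices K"
      and big: "\<not> card (steps a b c) \<le> N"
    have tri: "\<forall>x\<in>steps a b c. \<forall>y\<in>steps a b c. x \<noteq> y \<longrightarrow> R0 x y \<or> R1 x y \<or> R2 x y"
    proof (intro ballI impI)
      fix x y assume "x \<in> steps a b c" "y \<in> steps a b c" "x \<noteq> y"
      then show "R0 x y \<or> R1 x y \<or> R2 x y"
        using steps_cases[of "fst x" "snd x" a b c "fst y" "snd y"] abc(1)
        unfolding R0_def R1_def R2_def prod.collapse by blast
    qed
    have sym: "\<forall>x y. R0 x y \<longrightarrow> R0 y x" "\<forall>x y. R1 x y \<longrightarrow> R1 y x" "\<forall>x y. R2 x y \<longrightarrow> R2 y x"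
      unfolding R0_def R1_def R2_def by auto
    have "N \<le> card (steps a b c)" using big by simp
    from N[THEN spec, THEN mp, OF this, THEN mp, OF tri, THEN mp, OF sym(1), THEN mp, OF sym(2), THEN mp, OF sym(3)]
    obtain H where H: "H \<subseteq> steps a b c" "finite H" "card H = Suc \<sigma> \<and> pairwise R0 H \<or>
        card H = Suc d \<and> pairwise R1 H \<or> card H = Suc d \<and> pairwise R2 H"
      by (elim exE conjE)
    have anti: "card H \<le> d" if e: "e = fst \<or> e = snd" and pw: "pairwise (\<lambda>q q'. e q \<noteq> e q' \<and> \<not> e q \<subset> e q' \<and> \<not> e q' \<subset> e q) H"
      for e :: "'v set \<times> 'v set \<Rightarrow> 'v set"
    proof -
      have inj: "inj_on e H" using pw unfolding pairwise_def inj_on_def by blast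
      have sub: "e ` H \<subseteq> hinterval K a c" using H(1) e unfolding steps_def by auto
      have "card (e ` H) \<le> d"
      proof (rule antichain_dimension[OF abc(1,3) sub _ dim])
        fix h k assume "h \<in> e ` H" "k \<in> e ` H"
        then obtain q q' where q: "q \<in> H" "q' \<in> H" "h = e q" "k = e q'" by blast
        then show "\<not> h \<subset> k" using pw unfolding pairwise_def by (cases "q = q'") auto
      qed
      then show ?thesis using card_image[OF inj] by simp
    qed
    show False
      using H(3)
    proof (elim disjE conjE)
      assume "card H = Suc \<sigma>" "pairwise R0 H"
      then show False using steps_chain[OF abc H(1,2)] unfolding R0_def by simp
    next
      assume "card H = Suc d" "pairwise R1 H"
      then show False using anti[of fst] unfolding R1_def by simp
    next
      assume "card H = Suc d" "pairwise R2 H"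
      then show False using anti[of snd] unfolding R2_def by simp
    qed
  qed
qed

text \<open>The members containing \<open>b\<close> form an initial part of a decreasing chain, so
  there is a single place where \<open>b\<close> drops out.\<close>

lemma nested_mixed_split:
  assumes t: "successively (\<lambda>h k. k \<subset> h) t" "x \<in> set t" "b \<in> x" "y \<in> set t" "b \<notin> y"
  obtains t1 t2 where "t = t1 @ t2" "t1 \<noteq> []" "t2 \<noteq> []" "b \<in> last t1" "b \<notin> hd t2"
proof -
  define t1 t2 where "t1 = takeWhile (\<lambda>h. b \<in> h) t" and "t2 = dropWhile (\<lambda>h. b \<in> h) t"
  have tt: "t = t1 @ t2" unfolding t1_def t2_def by simp
  have t2: "t2 \<noteq> []" using t(4,5) unfolding t2_def by (auto simp: dropWhile_eq_Nil_conv)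
  have hd2: "b \<notin> hd t2" using t2 unfolding t2_def by (rule hd_dropWhile)
  have "transp (\<lambda>h k :: 'a set. k \<subset> h)" by (auto simp: transp_def)
  then have sorted: "sorted_wrt (\<lambda>h k. k \<subset> h) t" using t(1) successively_conv_sorted_wrt by blast
  have t1: "t1 \<noteq> []"
  proof
    assume "t1 = []"
    then have "t = hd t2 # tl t2" using tt t2 by simp
    then have "\<forall>z\<in>set t. z \<subseteq> hd t2" using sorted by (metis list.sel(1) psubsetE set_ConsD sorted_wrt.simps(2) subset_refl)
    then show False using t(2,3) hd2 by blast
  qed
  have "b \<in> last t1" using t1 set_takeWhileD[of "last t1" "\<lambda>h. b \<in> h" t] unfolding t1_def by (metis last_in_set)
  then show ?thesis using that tt t1 t2 hd2 by blast
qed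

text \<open>The place where \<open>b\<close> drops out of the segment is an element of
  \<open>steps a b c\<close>. From there the segment continues upwards and downwards by tight
  nesting, with bounded branching: the halfspaces of the interval tightly nested below a given one
  form an antichain, and so do those above it.\<close>

lemma mixed_segments_bounded:
  "\<exists>N. \<forall>a\<in>vertices K. \<forall>b\<in>vertices K. \<forall>c\<in>vertices K.
    card {t \<in> segments K l. set t \<subseteq> hinterval K a c \<and> (\<exists>h\<in>set t. b \<in> h) \<and> (\<exists>h\<in>set t. b \<notin> h)} \<le> N"
proof -
  obtain N where N: "\<And>a b c. a \<in> vertices K \<Longrightarrow> b \<in> vertices K \<Longrightarrow> c \<in> vertices K \<Longrightarrow> card (steps a b c) \<le> N"
    using card_steps_bounded by blast
  \<comment> \<open>At least one even if \<open>d\<close> is zero, so that \<open>D ^ i\<close> is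
    bounded by \<open>D ^ l\<close> for \<open>i \<le> l\<close>.\<close>
  define D where "D = Suc d"
  show ?thesis
  \<comment> \<open>The factors count the steps across \<open>b\<close>, their positions in the
    segment, the upper parts and the lower parts.\<close>
  proof (intro exI[of _ "N * (l * (D ^ l * D ^ l))"] ballI)
    fix a b c assume abc: "a \<in> vertices K" "b \<in> vertices K" "c \<in> vertices K"
    let ?P = "hinterval K a c" and ?T = "tightly_nested K"
    let ?M = "{t \<in> segments K l. set t \<subseteq> ?P \<and> (\<exists>h\<in>set t. b \<in> h) \<and> (\<exists>h\<in>set t. b \<notin> h)}"
    have P: "finite ?P" using finite_hinterval abc by blast
    have half: "h \<in> halfspaces K" if "h \<in> ?P" for h using that hinterval_iff[OF abc(1)] by blast
    have deg: "card {k \<in> ?P. ?T h k} \<le> D" "card {k \<in> ?P. ?T k h} \<le> D" if "h \<in> ?P" for h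
    proof -
      have "card {k \<in> ?P. ?T h k} \<le> d"
        by (rule antichain_dimension[OF abc(1,3) _ _ dim])
          (use half in \<open>auto simp: tightly_nested_def\<close>)
      moreover have "card {k \<in> ?P. ?T k h} \<le> d"
        by (rule antichain_dimension[OF abc(1,3) _ _ dim])
          (use half in \<open>auto simp: tightly_nested_def\<close>)
      ultimately show "card {k \<in> ?P. ?T h k} \<le> D" "card {k \<in> ?P. ?T k h} \<le> D" unfolding D_def by auto
    qed
    define U where "U i h = {t. length t = Suc i \<and> set t \<subseteq> ?P \<and> successively ?T t \<and> last t = h}" for i h
    define L where "L i h = {t. length t = Suc i \<and> set t \<subseteq> ?P \<and> successively ?T t \<and> hd t = h}" for i h
    have fin: "finite (U i h)" "finite (L i h)" for i h
      unfolding U_def L_def by (rule finite_subset[OF _ finite_lists_length_eq[OF P, of "Suc i"]]; auto)+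
    have cU: "card (U i h) \<le> D ^ l" "card (L i h) \<le> D ^ l" if "h \<in> ?P" "i \<le> l" for i h
    proof -
      have "D ^ i \<le> D ^ l" using that(2) unfolding D_def by (intro power_increasing) auto
      then show "card (U i h) \<le> D ^ l" "card (L i h) \<le> D ^ l"
        using card_successive_lists_last[where R = "tightly_nested K" and d = D and n = i, OF P deg(2) that(1)]
          card_successive_lists[where R = "tightly_nested K" and d = D and n = i, OF P deg(1) that(1)]
        unfolding U_def L_def by auto
    qed
    \<comment> \<open>The upper part has \<open>i + 1\<close> members, so \<open>l - 1 - i\<close>
      remain for the lower part; the parameter of \<open>L\<close> is one less than the
      length.\<close>
    define W where "W q i = (\<lambda>(t1, t2). t1 @ t2) ` (U i (fst q) \<times> L (l - 2 - i) (snd q))" for q i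
    have cW: "card (W q i) \<le> D ^ l * D ^ l" if q: "q \<in> steps a b c" and i: "i < l" for q i
    proof -
      have "card (W q i) \<le> card (U i (fst q) \<times> L (l - 2 - i) (snd q))"
        unfolding W_def by (rule card_image_le) (simp add: fin)
      also have "\<dots> \<le> D ^ l * D ^ l"
        unfolding card_cartesian_product using q i cU unfolding steps_def by (intro mult_mono) auto
      finally show ?thesis .
    qed
    have steps_fin: "finite (steps a b c)"
      by (rule finite_subset[of _ "?P \<times> ?P"]) (use P in \<open>auto simp: steps_def\<close>)
    have "?M \<subseteq> (\<Union>q\<in>steps a b c. \<Union>i\<in>{..<l}. W q i)"
    proof
      fix t assume "t \<in> ?M"
      then obtain x y where t: "length t = l" "successively ?T t" "set t \<subseteq> ?P" "x \<in> set t" "b \<in> x" "y \<in> set t" "b \<notin> y"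
        unfolding segments_def by blast
      have "successively (\<lambda>h k. k \<subset> h) t"
        using t(2) by (rule successively_mono) (simp add: tightly_nested_def)
      from nested_mixed_split[OF this t(4-7)]
      obtain t1 t2 where tt: "t = t1 @ t2" "t1 \<noteq> []" "t2 \<noteq> []" "b \<in> last t1" "b \<notin> hd t2" by metis
      have s: "successively ?T t1" "successively ?T t2" "?T (last t1) (hd t2)"
        using t(2) tt(2,3) unfolding tt(1) successively_append_iff by auto
      have P12: "set t1 \<subseteq> ?P" "set t2 \<subseteq> ?P" using t(3) tt(1) by auto
      have m: "last t1 \<in> ?P" "hd t2 \<in> ?P" using P12 tt(2,3) by (meson last_in_set hd_in_set subsetD)+
      have "(last t1, hd t2) \<in> steps a b c" unfolding steps_def using m s(3) tt(4,5) by simp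
      moreover define i where "i = length t1 - 1"
      have len: "length t1 = Suc i" "length t2 = Suc (l - 2 - i)" "i < l"
        using t(1) tt(1-3) unfolding i_def by (auto simp: Suc_leI Suc_diff_le simp flip: length_greater_0_conv)
      have "t1 \<in> U i (last t1)" "t2 \<in> L (l - 2 - i) (hd t2)" unfolding U_def L_def using len s P12 by auto
      then have "t \<in> W (last t1, hd t2) i" unfolding W_def tt(1) by force
      ultimately show "t \<in> (\<Union>q\<in>steps a b c. \<Union>i\<in>{..<l}. W q i)" using len(3) by blast
    qed
    then have "card ?M \<le> card (\<Union>q\<in>steps a b c. \<Union>i\<in>{..<l}. W q i)"
      by (rule card_mono[rotated]) (use steps_fin fin in \<open>auto simp: W_def\<close>)
    also have "\<dots> \<le> (\<Sum>q\<in>steps a b c. card (\<Union>i\<in>{..<l}. W q i))" by (rule card_UN_le[OF steps_fin])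
    also have "\<dots> \<le> (\<Sum>q\<in>steps a b c. l * (D ^ l * D ^ l))"
    proof (rule sum_mono)
      fix q assume q: "q \<in> steps a b c"
      have "card (\<Union>i\<in>{..<l}. W q i) \<le> (\<Sum>i\<in>{..<l}. card (W q i))" by (rule card_UN_le) simp
      also have "\<dots> \<le> (\<Sum>i\<in>{..<l}. D ^ l * D ^ l)" by (rule sum_mono) (use cW[OF q] in auto)
      finally show "card (\<Union>i\<in>{..<l}. W q i) \<le> l * (D ^ l * D ^ l)" by simp
    qed
    also have "\<dots> \<le> N * (l * (D ^ l * D ^ l))" using N[OF abc] by simp
    finally show "card ?M \<le> N * (l * (D ^ l * D ^ l))" .
  qed
qed

end

end

section \<open>Cochains and cup products\<close>

abbreviation omit :: "nat \<Rightarrow> 'a list \<Rightarrow> 'a list" where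
  "omit i xs \<equiv> take i xs @ drop (Suc i) xs"

lemma omit_tuples: "xs \<in> tuples K (Suc n) \<Longrightarrow> i \<le> n \<Longrightarrow> omit i xs \<in> tuples K n"
  unfolding tuples_def by (auto dest: in_set_takeD in_set_dropD)

lemma omit_omit:
  assumes "i \<le> j" "Suc j < length xs"
  shows "omit j (omit i xs) = omit i (omit (Suc j) xs)"
  using assms by (intro nth_equalityI) (auto simp: nth_append)

lemma coboundary_outside: "xs \<notin> tuples K (n + 2) \<Longrightarrow> coboundary K n f xs = 0"
  unfolding coboundary_def by simp

lemma coboundary_tuple:
  "xs \<in> tuples K (n + 2) \<Longrightarrow> coboundary K n f xs = (\<Sum>i\<le>n + 1. (-1) ^ i * f (omit i xs))"
  unfolding coboundary_def by simp

lemma cup_tuple: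
  "xs \<in> tuples K (p + q + 1) \<Longrightarrow> cup K p q f g xs = f (take (p + 1) xs) * g (drop p xs)"
  unfolding cup_def by simp

lemma cup_outside: "xs \<notin> tuples K (p + q + 1) \<Longrightarrow> cup K p q f g xs = 0"
  unfolding cup_def by simp

lemma coboundary_coboundary: "coboundary K (Suc n) (coboundary K n f) = (\<lambda>_. 0)"
proof
  fix xs
  show "coboundary K (Suc n) (coboundary K n f) xs = 0"
  proof (cases "xs \<in> tuples K (Suc n + 2)")
    case True
    then have len: "length xs = n + 3" unfolding tuples_def by simp
    define F where "F i j = (-1) ^ (i + j) * f (omit j (omit i xs))" for i j
    \<comment> \<open>Deleting the same two entries in either order gives the same tuple with
      opposite signs; this pairs the index set \<open>B\<close> with \<open>A\<close>.\<close>
    have sym: "F i j = - F (Suc j) i" if "i \<le> j" "j \<le> n + 1" for i j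
      unfolding F_def omit_omit[OF that(1)] using that len by (subst omit_omit) (auto simp: add.commute)
    define A where "A = {(i, j). i \<le> n + 2 \<and> j < i}"
    define B where "B = {(i, j). j \<le> n + 1 \<and> i \<le> j}"
    have fin: "finite A" "finite B"
      by (rule finite_subset[of _ "{..n + 2} \<times> {..n + 2}"]; auto simp: A_def B_def)+
    have AB: "{..n + 2} \<times> {..n + 1} = A \<union> B" "A \<inter> B = {}" unfolding A_def B_def by auto
    have "coboundary K (Suc n) (coboundary K n f) xs =
        (\<Sum>i\<le>n + 2. (-1) ^ i * coboundary K n f (omit i xs))"
      using True unfolding coboundary_def[of K "Suc n"] by simp
    also have "\<dots> = (\<Sum>i\<le>n + 2. \<Sum>j\<le>n + 1. F i j)"
    proof (rule sum.cong[OF refl])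
      fix i assume "i \<in> {..n + 2}"
      then have "omit i xs \<in> tuples K (n + 2)" using omit_tuples[of xs K "n + 2" i] True by simp
      then show "(-1) ^ i * coboundary K n f (omit i xs) = (\<Sum>j\<le>n + 1. F i j)"
        unfolding coboundary_def F_def by (simp only: if_True sum_distrib_left power_add mult.assoc)
    qed
    also have "\<dots> = (\<Sum>(i, j)\<in>A \<union> B. F i j)"
      unfolding AB(1)[symmetric] by (rule sum.cartesian_product)
    also have "\<dots> = (\<Sum>(i, j)\<in>A. F i j) + (\<Sum>(i, j)\<in>B. F i j)"
      by (rule sum.union_disjoint[OF fin AB(2)])
    also have "(\<Sum>(i, j)\<in>B. F i j) = (\<Sum>(i, j)\<in>A. - F i j)"
      by (rule sum.reindex_bij_witness[of _ "\<lambda>(i, j). (j, i - 1)" "\<lambda>(i, j). (Suc j, i)"])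
        (auto simp: A_def B_def sym)
    finally show ?thesis by (simp add: sum_negf split_def)
  qed (simp add: coboundary_outside)
qed

lemma coboundary_sum:
  "coboundary K n (\<lambda>xs. \<Sum>a\<in>A. F a xs) xs = (\<Sum>a\<in>A. coboundary K n (F a) xs)"
proof (cases "xs \<in> tuples K (n + 2)")
  case True
  have "(\<Sum>i\<le>n + 1. \<Sum>a\<in>A. (-1) ^ i * F a (omit i xs)) = (\<Sum>a\<in>A. \<Sum>i\<le>n + 1. (-1) ^ i * F a (omit i xs))"
    by (rule sum.swap)
  then show ?thesis unfolding coboundary_def using True by (simp only: if_True sum_distrib_left)
qed (simp add: coboundary_outside)

lemma coboundary_add: "coboundary K n (\<lambda>xs. f xs + g xs) = (\<lambda>xs. coboundary K n f xs + coboundary K n g xs)"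
  unfolding coboundary_def by (rule ext) (simp only: sum.distrib distrib_left split: if_split, simp)

lemma coboundary_scale: "coboundary K n (\<lambda>xs. c * f xs) = (\<lambda>xs. c * coboundary K n f xs)"
  unfolding coboundary_def by (rule ext) (simp only: sum_distrib_left mult.left_commute split: if_split, simp)

lemma coboundary_diff: "coboundary K n (\<lambda>xs. f xs - g xs) = (\<lambda>xs. coboundary K n f xs - coboundary K n g xs)"
  using coboundary_add[of K n f "\<lambda>xs. - 1 * g xs"] coboundary_scale[of K n "- 1" g] by simp

lemma coboundary_zero: "coboundary K n (\<lambda>_. 0) = (\<lambda>_. 0)"
  unfolding coboundary_def by auto

lemma tuples_take: "xs \<in> tuples K n \<Longrightarrow> k \<le> n \<Longrightarrow> take k xs \<in> tuples K k"
  unfolding tuples_def by (auto dest: in_set_takeD)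

lemma tuples_drop: "xs \<in> tuples K n \<Longrightarrow> k = n - m \<Longrightarrow> drop m xs \<in> tuples K k"
  unfolding tuples_def by (auto dest: in_set_dropD)

lemma coboundary_cup:
  "coboundary K (p + q) (cup K p q f g) =
    (\<lambda>xs. cup K (Suc p) q (coboundary K p f) g xs + (-1) ^ p * cup K p (Suc q) f (coboundary K q g) xs)"
proof
  fix xs
  show "coboundary K (p + q) (cup K p q f g) xs =
    cup K (Suc p) q (coboundary K p f) g xs + (-1) ^ p * cup K p (Suc q) f (coboundary K q g) xs"
  proof (cases "xs \<in> tuples K (p + q + 2)")
    case True
    then have len: "length xs = p + q + 2" unfolding tuples_def by simp
    define a where "a i = f (omit i (take (p + 2) xs)) * g (drop (p + 1) xs)" for i
    define b where "b j = f (take (p + 1) xs) * g (omit j (drop p xs))" for j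
    \<comment> \<open>Dropping the last entry of the front part and dropping the first entry of the
      back part lead to the same product. Neither is a face of the cup product, and with their
      opposite signs the two terms cancel in the Leibniz rule.\<close>
    have ab: "a (p + 1) = b 0" unfolding a_def b_def using len by (simp add: take_Suc_conv_app_nth drop_drop)
    have lo: "cup K p q f g (omit i xs) = a i" if "i \<le> p" for i
    proof -
      have "omit i xs \<in> tuples K (p + q + 1)" using omit_tuples[of xs K "p + q + 1" i] True that by simp
      moreover have "take (p + 1) (omit i xs) = omit i (take (p + 2) xs)" "drop p (omit i xs) = drop (p + 1) xs"
        using that len by (auto intro!: nth_equalityI simp: nth_append)
      ultimately show ?thesis unfolding cup_def a_def by simp
    qed
    have hi: "cup K p q f g (omit (p + j) xs) = b j" if "1 \<le> j" "j \<le> q + 1" for j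
    proof -
      have "omit (p + j) xs \<in> tuples K (p + q + 1)" using omit_tuples[of xs K "p + q + 1" "p + j"] True that by simp
      moreover have "take (p + 1) (omit (p + j) xs) = take (p + 1) xs" "drop p (omit (p + j) xs) = omit j (drop p xs)"
        using that len by (auto intro!: nth_equalityI simp: nth_append add.commute[of j p])
      ultimately show ?thesis unfolding cup_def b_def by simp
    qed
    have "coboundary K (p + q) (cup K p q f g) xs = (\<Sum>i\<le>p + q + 1. (-1) ^ i * cup K p q f g (omit i xs))"
      using True unfolding coboundary_def by simp
    also have "{..p + q + 1} = {..p} \<union> {p + 1..p + (q + 1)}" by auto
    also have "(\<Sum>i\<in>{..p} \<union> {p + 1..p + (q + 1)}. (-1) ^ i * cup K p q f g (omit i xs)) =
        (\<Sum>i\<le>p. (-1) ^ i * cup K p q f g (omit i xs)) +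
        (\<Sum>i\<in>{p + 1..p + (q + 1)}. (-1) ^ i * cup K p q f g (omit i xs))"
      by (rule sum.union_disjoint) auto
    also have "(\<Sum>i\<le>p. (-1) ^ i * cup K p q f g (omit i xs)) = (\<Sum>i\<le>p. (-1) ^ i * a i)"
      by (rule sum.cong) (simp_all add: lo)
    also have "(\<Sum>i\<in>{p + 1..p + (q + 1)}. (-1) ^ i * cup K p q f g (omit i xs)) =
        (\<Sum>j\<in>{1..q + 1}. (-1) ^ (p + j) * b j)"
      by (rule sum.reindex_bij_witness[of _ "\<lambda>j. p + j" "\<lambda>i. i - p"]) (auto simp: hi[symmetric])
    finally have L: "coboundary K (p + q) (cup K p q f g) xs =
        (\<Sum>i\<le>p. (-1) ^ i * a i) + (\<Sum>j\<in>{1..q + 1}. (-1) ^ (p + j) * b j)" .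
    have "cup K (Suc p) q (coboundary K p f) g xs = (\<Sum>i\<le>p + 1. (-1) ^ i * a i)"
    proof -
      have "take (p + 2) xs \<in> tuples K (p + 2)" by (rule tuples_take[OF True]) simp
      note t = coboundary_tuple[OF this, of f]
      have "cup K (Suc p) q (coboundary K p f) g xs = coboundary K p f (take (p + 2) xs) * g (drop (p + 1) xs)"
        using cup_tuple[of xs K "Suc p" q "coboundary K p f" g] True by simp
      then show ?thesis unfolding t a_def by (simp only: sum_distrib_right mult.assoc)
    qed
    also have "\<dots> = (\<Sum>i\<le>p. (-1) ^ i * a i) - (-1) ^ p * b 0" using ab by simp
    finally have R1: "cup K (Suc p) q (coboundary K p f) g xs = (\<Sum>i\<le>p. (-1) ^ i * a i) - (-1) ^ p * b 0" .
    have "(-1) ^ p * cup K p (Suc q) f (coboundary K q g) xs = (\<Sum>j\<le>q + 1. (-1) ^ (p + j) * b j)"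
    proof -
      have "drop p xs \<in> tuples K (q + 2)" by (rule tuples_drop[OF True]) simp
      note t = coboundary_tuple[OF this, of g]
      have "cup K p (Suc q) f (coboundary K q g) xs = f (take (p + 1) xs) * coboundary K q g (drop p xs)"
        using cup_tuple[of xs K p "Suc q" f "coboundary K q g"] True by simp
      then show ?thesis unfolding t b_def by (simp only: sum_distrib_left power_add mult.left_commute mult.assoc)
    qed
    also have "{..q + 1} = insert 0 {1..q + 1}" by auto
    also have "(\<Sum>j\<in>insert 0 {1..q + 1}. (-1) ^ (p + j) * b j) = (-1) ^ p * b 0 + (\<Sum>j\<in>{1..q + 1}. (-1) ^ (p + j) * b j)"
      by (subst sum.insert) auto
    finally show ?thesis using L R1 by simp
  next
    case False
    then show ?thesis using coboundary_outside[of xs K "p + q"] by (simp add: cup_def)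
  qed
qed

lemma cup_assoc: "cup K (p + q) r (cup K p q f g) h = cup K p (q + r) f (cup K q r g h)"
proof
  fix xs
  show "cup K (p + q) r (cup K p q f g) h xs = cup K p (q + r) f (cup K q r g h) xs"
  proof (cases "xs \<in> tuples K (p + q + r + 1)")
    case True
    then have len: "length xs = p + q + r + 1" unfolding tuples_def by simp
    have "take (p + q + 1) xs \<in> tuples K (p + q + 1)" "drop p xs \<in> tuples K (q + r + 1)"
      by (rule tuples_take[OF True] tuples_drop[OF True]; simp)+
    moreover have "drop p (take (p + q + 1) xs) = take (q + 1) (drop p xs)"
      by (simp add: take_drop add.commute add.left_commute)
    ultimately show ?thesis
      using True by (simp add: cup_def add.assoc drop_drop add.commute[of q p] min_def)
  qed (simp add: cup_def add.assoc)
qed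

section \<open>Bounded invariant cochains and their classes\<close>

context
  fixes G :: "('g, 'r) monoid_scheme" and K :: "'v set set" and \<phi> :: "'g \<Rightarrow> 'v \<Rightarrow> 'v"
  assumes act: "combinatorial_action G K \<phi>"
begin

lemma action_vertex: "g \<in> carrier G \<Longrightarrow> v \<in> vertices K \<Longrightarrow> \<phi> g v \<in> vertices K"
  using act group_action.element_image unfolding combinatorial_action_def by fast

lemma action_tuples: "g \<in> carrier G \<Longrightarrow> xs \<in> tuples K n \<Longrightarrow> map (\<phi> g) xs \<in> tuples K n"
  unfolding tuples_def using action_vertex by auto

lemma cochainsI:
  assumes "\<And>xs. xs \<notin> tuples K (n + 1) \<Longrightarrow> f xs = 0"
    and "\<And>xs. xs \<in> tuples K (n + 1) \<Longrightarrow> \<bar>f xs\<bar> \<le> B"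
    and "\<And>g xs. g \<in> carrier G \<Longrightarrow> xs \<in> tuples K (n + 1) \<Longrightarrow> f (map (\<phi> g) xs) = f xs"
  shows "f \<in> cochains G K \<phi> n"
  using assms unfolding cochains_def by blast

lemma cochainsE:
  assumes "f \<in> cochains G K \<phi> n"
  obtains B where "B \<ge> 0" "\<And>xs. \<bar>f xs\<bar> \<le> B" "\<And>xs. xs \<notin> tuples K (n + 1) \<Longrightarrow> f xs = 0"
    "\<And>g xs. g \<in> carrier G \<Longrightarrow> xs \<in> tuples K (n + 1) \<Longrightarrow> f (map (\<phi> g) xs) = f xs"
proof -
  obtain B where B: "\<And>xs. xs \<in> tuples K (n + 1) \<Longrightarrow> \<bar>f xs\<bar> \<le> B"
    using assms unfolding cochains_def by blast
  have out: "\<And>xs. xs \<notin> tuples K (n + 1) \<Longrightarrow> f xs = 0"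
    and inv: "\<And>g xs. g \<in> carrier G \<Longrightarrow> xs \<in> tuples K (n + 1) \<Longrightarrow> f (map (\<phi> g) xs) = f xs"
    using assms unfolding cochains_def by blast+
  have "\<bar>f xs\<bar> \<le> \<bar>B\<bar>" for xs using B[of xs] out[of xs] by (cases "xs \<in> tuples K (n + 1)") auto
  then show ?thesis using that[of "\<bar>B\<bar>"] out inv by auto
qed

lemma cochains_diff:
  assumes "f \<in> cochains G K \<phi> n" "h \<in> cochains G K \<phi> n"
  shows "(\<lambda>xs. f xs - h xs) \<in> cochains G K \<phi> n"
proof -
  obtain B where B: "\<And>xs. \<bar>f xs\<bar> \<le> B" "\<And>xs. xs \<notin> tuples K (n + 1) \<Longrightarrow> f xs = 0"
    "\<And>g xs. g \<in> carrier G \<Longrightarrow> xs \<in> tuples K (n + 1) \<Longrightarrow> f (map (\<phi> g) xs) = f xs"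
    using cochainsE[OF assms(1)] by metis
  obtain C where C: "\<And>xs. \<bar>h xs\<bar> \<le> C" "\<And>xs. xs \<notin> tuples K (n + 1) \<Longrightarrow> h xs = 0"
    "\<And>g xs. g \<in> carrier G \<Longrightarrow> xs \<in> tuples K (n + 1) \<Longrightarrow> h (map (\<phi> g) xs) = h xs"
    using cochainsE[OF assms(2)] by metis
  show ?thesis
  proof (rule cochainsI[where B = "B + C"])
    show "\<bar>f xs - h xs\<bar> \<le> B + C" for xs using B(1)[of xs] C(1)[of xs] by linarith
  qed (simp_all add: B(2,3) C(2,3))
qed

lemma cochains_scale:
  assumes "f \<in> cochains G K \<phi> n"
  shows "(\<lambda>xs. c * f xs) \<in> cochains G K \<phi> n"
proof -
  obtain B where B: "\<And>xs. \<bar>f xs\<bar> \<le> B" "\<And>xs. xs \<notin> tuples K (n + 1) \<Longrightarrow> f xs = 0"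
    "\<And>g xs. g \<in> carrier G \<Longrightarrow> xs \<in> tuples K (n + 1) \<Longrightarrow> f (map (\<phi> g) xs) = f xs"
    using cochainsE[OF assms(1)] by metis
  show ?thesis
    by (rule cochainsI[where B = "\<bar>c\<bar> * B"]) (use B in \<open>auto simp: abs_mult intro: mult_left_mono\<close>)
qed

lemma coboundary_invariant:
  assumes "g \<in> carrier G" "xs \<in> tuples K (n + 2)"
    "\<And>ys. ys \<in> tuples K (n + 1) \<Longrightarrow> f (map (\<phi> g) ys) = f' ys"
  shows "coboundary K n f (map (\<phi> g) xs) = coboundary K n f' xs"
proof -
  have "f (omit i (map (\<phi> g) xs)) = f' (omit i xs)" if "i \<le> n + 1" for i
    using assms(3)[OF omit_tuples[of xs K "n + 1" i]] assms(2) that by (simp add: take_map drop_map)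
  then show ?thesis using action_tuples[OF assms(1,2)] assms(2) unfolding coboundary_def by simp
qed

text \<open>The primed functions allow for families whose index is shifted together with the
  vertices; for a single invariant cochain they agree with the unprimed ones.\<close>

lemma cup_invariant:
  assumes "g \<in> carrier G" "xs \<in> tuples K (p + q + 1)"
    "\<And>ys. ys \<in> tuples K (p + 1) \<Longrightarrow> f (map (\<phi> g) ys) = f' ys"
    "\<And>ys. ys \<in> tuples K (q + 1) \<Longrightarrow> h (map (\<phi> g) ys) = h' ys"
  shows "cup K p q f h (map (\<phi> g) xs) = cup K p q f' h' xs"
  using action_tuples[OF assms(1,2)] assms(2)
    assms(3)[OF tuples_take[OF assms(2), of "p + 1"]] assms(4)[OF tuples_drop[OF assms(2), of "q + 1" p]]
  unfolding cup_def by (simp add: take_map drop_map)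

lemma cochains_coboundary:
  assumes "f \<in> cochains G K \<phi> n"
  shows "coboundary K n f \<in> cochains G K \<phi> (Suc n)"
proof -
  obtain B where B: "B \<ge> 0" "\<And>xs. \<bar>f xs\<bar> \<le> B" "\<And>xs. xs \<notin> tuples K (n + 1) \<Longrightarrow> f xs = 0"
    "\<And>g xs. g \<in> carrier G \<Longrightarrow> xs \<in> tuples K (n + 1) \<Longrightarrow> f (map (\<phi> g) xs) = f xs"
    using cochainsE[OF assms(1)] by metis
  show ?thesis
  proof (rule cochainsI[where B = "real (n + 2) * B"])
    fix xs assume "xs \<in> tuples K (Suc n + 1)"
    then have "\<bar>coboundary K n f xs\<bar> \<le> (\<Sum>i\<le>n + 1. \<bar>(-1) ^ i * f (omit i xs)\<bar>)"
      unfolding coboundary_def by (simp add: sum_abs del: sum.atMost_Suc)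
    also have "\<dots> \<le> (\<Sum>i\<le>n + 1. B)" by (rule sum_mono) (simp add: abs_mult B(2))
    finally show "\<bar>coboundary K n f xs\<bar> \<le> real (n + 2) * B" by (simp add: algebra_simps)
  next
    fix g xs assume "g \<in> carrier G" "xs \<in> tuples K (Suc n + 1)"
    then show "coboundary K n f (map (\<phi> g) xs) = coboundary K n f xs"
      using B(4) by (intro coboundary_invariant) auto
  qed (simp add: coboundary_def)
qed

lemma cochains_cup:
  assumes "f \<in> cochains G K \<phi> p" "h \<in> cochains G K \<phi> q"
  shows "cup K p q f h \<in> cochains G K \<phi> (p + q)"
proof -
  obtain B where B: "B \<ge> 0" "\<And>xs. \<bar>f xs\<bar> \<le> B"
    "\<And>g xs. g \<in> carrier G \<Longrightarrow> xs \<in> tuples K (p + 1) \<Longrightarrow> f (map (\<phi> g) xs) = f xs"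
    using cochainsE[OF assms(1)] by metis
  obtain C where C: "C \<ge> 0" "\<And>xs. \<bar>h xs\<bar> \<le> C"
    "\<And>g xs. g \<in> carrier G \<Longrightarrow> xs \<in> tuples K (q + 1) \<Longrightarrow> h (map (\<phi> g) xs) = h xs"
    using cochainsE[OF assms(2)] by metis
  show ?thesis
  proof (rule cochainsI[where B = "B * C"])
    show "\<bar>cup K p q f h xs\<bar> \<le> B * C" for xs
      unfolding cup_def using B(1,2) C(1,2) by (auto simp: abs_mult intro: mult_mono)
    fix g xs assume "g \<in> carrier G" "xs \<in> tuples K (p + q + 1)"
    then show "cup K p q f h (map (\<phi> g) xs) = cup K p q f h xs"
      using B(3) C(3) by (intro cup_invariant) auto
  qed (simp add: cup_def)
qed

lemma cochains_zero: "(\<lambda>_. 0) \<in> cochains G K \<phi> n"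
  by (rule cochainsI[where B = 0]) auto

lemma coboundaries_Suc: "coboundaries G K \<phi> (Suc n) = coboundary K n ` cochains G K \<phi> n"
  unfolding coboundaries_def by simp

lemma coboundariesI: "u \<in> cochains G K \<phi> m \<Longrightarrow> n = Suc m \<Longrightarrow> coboundary K m u \<in> coboundaries G K \<phi> n"
  using coboundaries_Suc by blast

lemma coboundaries_zero: "(\<lambda>_. 0) \<in> coboundaries G K \<phi> n"
proof (cases n)
  case (Suc m)
  then show ?thesis using cochains_zero[of m] coboundary_zero[of K m] coboundaries_Suc by (metis imageI)
qed (simp add: coboundaries_def)

lemma coboundaries_diff:
  assumes "f \<in> coboundaries G K \<phi> n" "h \<in> coboundaries G K \<phi> n"
  shows "(\<lambda>xs. f xs - h xs) \<in> coboundaries G K \<phi> n"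
proof (cases n)
  case 0
  then show ?thesis using assms by (simp add: coboundaries_def)
next
  case (Suc m)
  then obtain u v where uv: "u \<in> cochains G K \<phi> m" "v \<in> cochains G K \<phi> m"
    "f = coboundary K m u" "h = coboundary K m v"
    using assms coboundaries_Suc by blast
  then have "(\<lambda>xs. f xs - h xs) = coboundary K m (\<lambda>xs. u xs - v xs)" by (simp add: coboundary_diff)
  then show ?thesis using cochains_diff[OF uv(1,2)] Suc coboundaries_Suc by blast
qed

lemma coboundaries_scale:
  assumes "f \<in> coboundaries G K \<phi> n"
  shows "(\<lambda>xs. c * f xs) \<in> coboundaries G K \<phi> n"
proof (cases n)
  case 0
  then show ?thesis using assms by (simp add: coboundaries_def)
next
  case (Suc m)
  then obtain u where u: "u \<in> cochains G K \<phi> m" "f = coboundary K m u"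
    using assms coboundaries_Suc by blast
  then have "(\<lambda>xs. c * f xs) = coboundary K m (\<lambda>xs. c * u xs)" by (simp add: coboundary_scale)
  then show ?thesis using cochains_scale[OF u(1)] Suc coboundaries_Suc by blast
qed

lemma coboundaries_cocycles:
  assumes "f \<in> coboundaries G K \<phi> n"
  shows "f \<in> cocycles G K \<phi> n"
proof (cases n)
  case 0
  then show ?thesis using assms cochains_zero[of 0] coboundary_zero[of K 0]
    by (simp add: coboundaries_def cocycles_def)
next
  case (Suc m)
  then show ?thesis using assms cochains_coboundary coboundary_coboundary coboundaries_Suc
    unfolding cocycles_def by auto
qed

lemma cohomologous_iff:
  "(f, h) \<in> cohomologous G K \<phi> n \<longleftrightarrow>
    f \<in> cocycles G K \<phi> n \<and> h \<in> cocycles G K \<phi> n \<and> (\<lambda>xs. f xs - h xs) \<in> coboundaries G K \<phi> n"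
  unfolding cohomologous_def by simp

lemma cohomologous_sym: "(f, h) \<in> cohomologous G K \<phi> n \<Longrightarrow> (h, f) \<in> cohomologous G K \<phi> n"
  unfolding cohomologous_iff using coboundaries_scale[of "\<lambda>xs. f xs - h xs" n "-1"] by simp

lemma cohomologous_trans:
  assumes "(f, h) \<in> cohomologous G K \<phi> n" "(h, k) \<in> cohomologous G K \<phi> n"
  shows "(f, k) \<in> cohomologous G K \<phi> n"
proof -
  have "(\<lambda>xs. (f xs - h xs) - (k xs - h xs)) \<in> coboundaries G K \<phi> n"
    using coboundaries_diff[of "\<lambda>xs. f xs - h xs" n "\<lambda>xs. k xs - h xs"]
      assms(1) cohomologous_sym[OF assms(2)] unfolding cohomologous_iff by blast
  then show ?thesis using assms unfolding cohomologous_iff by simp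
qed

lemma coclass_null:
  assumes "f \<in> coboundaries G K \<phi> n"
  shows "coclass G K \<phi> n f = null_class G K \<phi> n"
proof -
  have z: "(\<lambda>_. 0) \<in> cocycles G K \<phi> n" using coboundaries_cocycles[OF coboundaries_zero] .
  then have f0: "(f, \<lambda>_. 0) \<in> cohomologous G K \<phi> n"
    using assms coboundaries_cocycles unfolding cohomologous_iff by simp
  show ?thesis
    unfolding null_class_def coclass_def
    using f0 cohomologous_sym[OF f0] cohomologous_trans by blast
qed

lemma cohomology_cohomologous:
  assumes "a \<in> cohomology G K \<phi> n" "f \<in> a" "h \<in> a"
  shows "(f, h) \<in> cohomologous G K \<phi> n"
proof -
  obtain k where "a = cohomologous G K \<phi> n `` {k}"
    using assms(1) unfolding cohomology_def by (auto elim: quotientE)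
  then have "(k, f) \<in> cohomologous G K \<phi> n" "(k, h) \<in> cohomologous G K \<phi> n" using assms by auto
  then show ?thesis using cohomologous_sym cohomologous_trans by blast
qed

lemma coclass_cohomology: "f \<in> cocycles G K \<phi> n \<Longrightarrow> coclass G K \<phi> n f \<in> cohomology G K \<phi> n"
  unfolding coclass_def cohomology_def by (rule quotientI)

lemma coclass_self: "f \<in> cocycles G K \<phi> n \<Longrightarrow> f \<in> coclass G K \<phi> n f"
  unfolding coclass_def using coboundaries_zero by (simp add: cohomologous_iff)

lemma cup_zero: "cup K p q (\<lambda>_. 0) g = (\<lambda>_. 0)" "cup K p q f (\<lambda>_. 0) = (\<lambda>_. 0)"
  unfolding cup_def by auto

text \<open>The class of a product is a union over all pairs of representatives. Another pair
  changes the product by coboundaries only, so one pair with exact product settles all of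
  them.\<close>

lemma cup_class_null:
  assumes a: "a \<in> cohomology G K \<phi> p" "\<kappa> \<in> a" and b: "b \<in> cohomology G K \<phi> q" "\<omega> \<in> b"
    and pq: "p > 0" "q > 0" and cup: "cup K p q \<kappa> \<omega> \<in> coboundaries G K \<phi> (p + q)"
  shows "cup_class G K \<phi> p q a b = null_class G K \<phi> (p + q)"
proof -
  have "coclass G K \<phi> (p + q) (cup K p q f g) = null_class G K \<phi> (p + q)" if fg: "f \<in> a" "g \<in> b" for f g
  proof (rule coclass_null)
    obtain p' q' where p': "p = Suc p'" "q = Suc q'" using pq by (metis gr0_implies_Suc)
    have "(\<kappa>, f) \<in> cohomologous G K \<phi> p" "(\<omega>, g) \<in> cohomologous G K \<phi> q"
      using cohomology_cohomologous a b fg by blast+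
    then obtain u v where u: "u \<in> cochains G K \<phi> p'" "\<And>xs. \<kappa> xs - f xs = coboundary K p' u xs"
      and v: "v \<in> cochains G K \<phi> q'" "\<And>xs. \<omega> xs - g xs = coboundary K q' v xs"
      and cyc: "\<kappa> \<in> cocycles G K \<phi> p" "g \<in> cocycles G K \<phi> q"
      unfolding cohomologous_iff p' coboundaries_Suc by (metis (no_types, lifting) imageE)
    \<comment> \<open>\<open>f\<close> is expanded around the given representative, but the given
      \<open>\<omega>\<close> around the arbitrary \<open>g\<close>. In the product each correction
      term then has a closed partner, \<open>g\<close> or \<open>\<kappa>\<close>, and is exact by
      the Leibniz rule.\<close>
    have f: "f = (\<lambda>xs. \<kappa> xs - coboundary K p' u xs)" and g: "\<omega> = (\<lambda>xs. g xs + coboundary K q' v xs)"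
      using u(2) v(2) by (auto simp: fun_eq_iff algebra_simps)
    have 1: "coboundary K (p' + q) (cup K p' q u g) = cup K p q (coboundary K p' u) g"
      using cyc(2) unfolding coboundary_cup cocycles_def p' by (simp add: cup_zero)
    have 2: "coboundary K (p + q') (cup K p q' \<kappa> v) = (\<lambda>xs. (-1) ^ p * cup K p q \<kappa> (coboundary K q' v) xs)"
      using cyc(1) unfolding coboundary_cup cocycles_def p' by (simp add: cup_zero)
    have c: "cup K p' q u g \<in> cochains G K \<phi> (p' + q)" "cup K p q' \<kappa> v \<in> cochains G K \<phi> (p + q')"
      using cochains_cup u(1) v(1) cyc unfolding cocycles_def by auto
    have "cup K p q (coboundary K p' u) g \<in> coboundaries G K \<phi> (p + q)"
      "(\<lambda>xs. (-1) ^ p * cup K p q \<kappa> (coboundary K q' v) xs) \<in> coboundaries G K \<phi> (p + q)"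
      unfolding 1[symmetric] 2[symmetric] by (rule c[THEN coboundariesI]; simp add: p')+
    note cb = this(1) coboundaries_scale[OF this(2), of "(-1) ^ p"]
    have "(\<lambda>xs. (cup K p q \<kappa> \<omega> xs - (-1) ^ p * ((-1) ^ p * cup K p q \<kappa> (coboundary K q' v) xs)) -
        cup K p q (coboundary K p' u) g xs) \<in> coboundaries G K \<phi> (p + q)"
      using coboundaries_diff[OF coboundaries_diff[OF cup cb(2)] cb(1)] .
    moreover have "(\<lambda>xs. (cup K p q \<kappa> \<omega> xs - (-1) ^ p * ((-1) ^ p * cup K p q \<kappa> (coboundary K q' v) xs)) -
        cup K p q (coboundary K p' u) g xs) = cup K p q f g"
      unfolding f g cup_def by (auto simp: fun_eq_iff algebra_simps simp flip: power_add mult.assoc)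
    ultimately show "cup K p q f g \<in> coboundaries G K \<phi> (p + q)" by simp
  qed
  then show ?thesis unfolding cup_class_def using a(2) b(2) by blast
qed

end

section \<open>The orbit of a segment\<close>

locale CAT0_action = CAT0 K for K :: "'v set set" +
  fixes G :: "('g, 'r) monoid_scheme" and \<phi> :: "'g \<Rightarrow> 'v \<Rightarrow> 'v" and l :: nat and s :: "'v set list"
  assumes act: "combinatorial_action G K \<phi>"
    and l: "l > 0" and s: "s \<in> segments K l"
begin

abbreviation shift :: "'g \<Rightarrow> 'v set list \<Rightarrow> 'v set list" where
  "shift g \<equiv> map ((`) (\<phi> g))"

lemma action_inverse:
  assumes "g \<in> carrier G"
  obtains g' where "g' \<in> carrier G" "\<And>v. v \<in> vertices K \<Longrightarrow> \<phi> g' (\<phi> g v) = v"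
    "\<And>v. v \<in> vertices K \<Longrightarrow> \<phi> g (\<phi> g' v) = v"
proof -
  interpret group_action G "vertices K" \<phi> using act unfolding combinatorial_action_def by blast
  interpret group G using group_hom group_hom.axioms(1) by blast
  have i: "\<phi> (inv\<^bsub>G\<^esub> g) (\<phi> g v) = v" if "g \<in> carrier G" "v \<in> vertices K" for g v
    using orbit_sym_aux[OF that] by simp
  have "\<phi> g (\<phi> (inv\<^bsub>G\<^esub> g) v) = v" if "v \<in> vertices K" for v
    using i[of "inv\<^bsub>G\<^esub> g" v] assms that by simp
  then show ?thesis using that[of "inv\<^bsub>G\<^esub> g"] i assms by simp
qed

lemma action_vertex': "g \<in> carrier G \<Longrightarrow> v \<in> vertices K \<Longrightarrow> \<phi> g v \<in> vertices K"
  by (rule action_vertex[OF act])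

lemma action_inj: "g \<in> carrier G \<Longrightarrow> inj_on (\<phi> g) (vertices K)"
  using act group_action.inj_prop unfolding combinatorial_action_def by fast

lemma action_adjacent:
  assumes "g \<in> carrier G" "adjacent K u v"
  shows "adjacent K (\<phi> g u) (\<phi> g v)"
proof -
  have uv: "u \<in> vertices K" "v \<in> vertices K" "u \<noteq> v"
    using adjacent_vertices[OF assms(2)] adjacent_neq[OF assms(2)] by auto
  have "\<phi> g ` {u, v} \<in> K" using act assms unfolding combinatorial_action_def edges_def by blast
  moreover have "\<phi> g u \<noteq> \<phi> g v" using action_inj[OF assms(1)] uv by (meson inj_on_eq_iff)
  ultimately show ?thesis by (simp add: edges_def)
qed

lemma action_dist_le:
  assumes g: "g \<in> carrier G" and uv: "u \<in> vertices K" "v \<in> vertices K"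
  shows "gdist (\<phi> g u) (\<phi> g v) \<le> gdist u v"
proof -
  obtain p where p: "reduced p" "hd p = u" "last p = v" using reduced_exists[OF uv(2,1)] by blast
  have w: "walk K p" using reduced_walk p uv by simp
  have ne: "p \<noteq> []" using reduced_ne p(1) .
  have len: "length p = Suc (gdist u v)" using dist_reduced[OF p(1)] p uv by simp
  have "successively (\<lambda>u v. adjacent K (\<phi> g u) (\<phi> g v)) p"
    using w unfolding walk_def by (auto elim!: successively_mono intro: action_adjacent[OF g])
  then have "walk K (map (\<phi> g) p)"
    using w action_vertex'[OF g] unfolding walk_def by (auto simp: successively_map)
  then have "walk K (map (\<phi> g) p) \<and> length (map (\<phi> g) p) = Suc (gdist u v) \<and>
      hd (map (\<phi> g) p) = \<phi> g u \<and> last (map (\<phi> g) p) = \<phi> g v"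
    using len p ne by (simp add: hd_map last_map)
  then have "\<exists>q. walk K q \<and> length q = Suc (gdist u v) \<and> hd q = \<phi> g u \<and> last q = \<phi> g v" by blast
  then show ?thesis unfolding graph_dist_def[of K "\<phi> g u"] by (rule Least_le)
qed

lemma action_dist:
  assumes g: "g \<in> carrier G" and uv: "u \<in> vertices K" "v \<in> vertices K"
  shows "gdist (\<phi> g u) (\<phi> g v) = gdist u v"
proof -
  obtain g' where g': "g' \<in> carrier G" "\<And>v. v \<in> vertices K \<Longrightarrow> \<phi> g' (\<phi> g v) = v"
    using action_inverse[OF g] by metis
  have "gdist (\<phi> g' (\<phi> g u)) (\<phi> g' (\<phi> g v)) \<le> gdist (\<phi> g u) (\<phi> g v)"
    using action_dist_le[OF g'(1)] action_vertex'[OF g] uv by blast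
  then show ?thesis using action_dist_le[OF g uv] g'(2) uv by simp
qed

lemma action_side:
  assumes g: "g \<in> carrier G" and uv: "adjacent K u v"
  shows "\<phi> g ` side u v = side (\<phi> g u) (\<phi> g v)"
proof -
  obtain g' where g': "g' \<in> carrier G" "\<And>v. v \<in> vertices K \<Longrightarrow> \<phi> g' (\<phi> g v) = v"
    "\<And>v. v \<in> vertices K \<Longrightarrow> \<phi> g (\<phi> g' v) = v"
    using action_inverse[OF g] by metis
  have uvV: "u \<in> vertices K" "v \<in> vertices K" using adjacent_vertices[OF uv] by auto
  have m: "\<phi> g x \<in> side (\<phi> g u) (\<phi> g v) \<longleftrightarrow> x \<in> side u v" if "x \<in> vertices K" for x
    using that uvV action_dist[OF g] action_vertex'[OF g] unfolding side_def by simp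
  show ?thesis
  proof (intro subset_antisym subsetI)
    fix y assume "y \<in> \<phi> g ` side u v"
    then show "y \<in> side (\<phi> g u) (\<phi> g v)" using m side_subset by blast
  next
    fix y assume y: "y \<in> side (\<phi> g u) (\<phi> g v)"
    then have yV: "y \<in> vertices K" using side_subset by blast
    then have "\<phi> g' y \<in> side u v" using m[of "\<phi> g' y"] g'(3)[OF yV] action_vertex'[OF g'(1) yV] y by simp
    then show "y \<in> \<phi> g ` side u v" using g'(3)[OF yV] by (metis imageI)
  qed
qed

lemma action_halfspace: "g \<in> carrier G \<Longrightarrow> h \<in> halfspaces K \<Longrightarrow> \<phi> g ` h \<in> halfspaces K"
  unfolding halfspaces_iff using action_side action_adjacent by blast

lemma action_image_mem:
  assumes "g \<in> carrier G" "x \<in> vertices K" "h \<in> halfspaces K"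
  shows "\<phi> g x \<in> \<phi> g ` h \<longleftrightarrow> x \<in> h"
  using inj_on_image_mem_iff[OF action_inj[OF assms(1)] assms(2) halfspace_subset[OF assms(3)]] .

lemma action_hinterval:
  assumes "g \<in> carrier G" "x \<in> vertices K" "y \<in> vertices K" "h \<in> halfspaces K"
  shows "\<phi> g ` h \<in> hinterval K (\<phi> g x) (\<phi> g y) \<longleftrightarrow> h \<in> hinterval K x y"
  using hinterval_iff[OF action_vertex'[OF assms(1,2)], of "\<phi> g ` h"] hinterval_iff[OF assms(2), of h]
    action_halfspace[OF assms(1,4)] action_image_mem[OF assms(1) _ assms(4)] assms by blast

lemma action_image_inverse:
  assumes "\<And>v. v \<in> vertices K \<Longrightarrow> \<phi> g' (\<phi> g v) = v" "h \<subseteq> vertices K"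
  shows "\<phi> g' ` (\<phi> g ` h) = h"
proof -
  have "(\<lambda>v. \<phi> g' (\<phi> g v)) ` h = (\<lambda>v. v) ` h" by (rule image_cong) (use assms in auto)
  then show ?thesis by (simp add: image_image)
qed

lemma action_psubset:
  assumes "g \<in> carrier G" "h \<subseteq> vertices K" "k \<subseteq> vertices K" "k \<subset> h"
  shows "\<phi> g ` k \<subset> \<phi> g ` h"
proof -
  obtain g' where g': "\<And>v. v \<in> vertices K \<Longrightarrow> \<phi> g' (\<phi> g v) = v"
    using action_inverse[OF assms(1)] by metis
  have "\<phi> g ` k \<noteq> \<phi> g ` h"
    using action_image_inverse[OF g' assms(2)] action_image_inverse[OF g' assms(3)] assms(4) by auto
  moreover have "\<phi> g ` k \<subseteq> \<phi> g ` h" using assms(4) by (intro image_mono) simp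
  ultimately show ?thesis by simp
qed

lemma action_tightly_nested:
  assumes g: "g \<in> carrier G" and hk: "h \<in> halfspaces K" "k \<in> halfspaces K" "tightly_nested K h k"
  shows "tightly_nested K (\<phi> g ` h) (\<phi> g ` k)"
proof -
  obtain g' where g': "g' \<in> carrier G" "\<And>v. v \<in> vertices K \<Longrightarrow> \<phi> g' (\<phi> g v) = v"
    using action_inverse[OF g] by metis
  note V = halfspace_subset
  have "k \<subset> h" using hk(3) unfolding tightly_nested_def by (rule conjunct1)
  then have "\<phi> g ` k \<subset> \<phi> g ` h" using action_psubset[OF g V[OF hk(1)] V[OF hk(2)]] by blast
  moreover have False if m: "m \<in> halfspaces K" "\<phi> g ` k \<subset> m" "m \<subset> \<phi> g ` h" for m
  proof -
    have "\<phi> g' ` (\<phi> g ` k) \<subset> \<phi> g' ` m" "\<phi> g' ` m \<subset> \<phi> g' ` (\<phi> g ` h)"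
      using action_psubset[OF g'(1) V[OF m(1)] V[OF action_halfspace[OF g hk(2)]] m(2)]
        action_psubset[OF g'(1) V[OF action_halfspace[OF g hk(1)]] V[OF m(1)] m(3)] by simp_all
    then have "k \<subset> \<phi> g' ` m" "\<phi> g' ` m \<subset> h"
      using action_image_inverse[OF g'(2)] V hk by simp_all
    then show False using hk(3) action_halfspace[OF g'(1) m(1)] unfolding tightly_nested_def by blast
  qed
  ultimately show ?thesis unfolding tightly_nested_def by blast
qed

lemma action_segments:
  assumes g: "g \<in> carrier G" and t: "t \<in> segments K l"
  shows "shift g t \<in> segments K l"
proof -
  have h: "set t \<subseteq> halfspaces K" and suc: "successively (tightly_nested K) t" and len: "length t = l"
    using t unfolding segments_def by auto
  have "successively (\<lambda>h k. tightly_nested K (\<phi> g ` h) (\<phi> g ` k)) t"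
    using suc by (rule successively_mono) (use action_tightly_nested[OF g] h in blast)
  then show ?thesis
    using h len action_halfspace[OF g] unfolding segments_def by (auto simp: successively_map)
qed

section \<open>The translates of the segment and their heads\<close>

abbreviation orb :: "'v set list set" where
  "orb \<equiv> translates G \<phi> s"

lemma orb_def': "orb = {shift g s |g. g \<in> carrier G}"
  unfolding translates_def orbit_def by simp

lemma orb_segments: "t \<in> orb \<Longrightarrow> t \<in> segments K l"
  unfolding orb_def' using action_segments s by blast

lemma orb_halfspaces: "t \<in> orb \<Longrightarrow> set t \<subseteq> halfspaces K"
  using orb_segments unfolding segments_def by blast

lemma orb_nonempty: "t \<in> orb \<Longrightarrow> t \<noteq> []"
  using orb_segments l unfolding segments_def by force

lemma orb_shift:
  assumes g: "g \<in> carrier G" and t: "t \<in> orb"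
  shows "shift g t \<in> orb"
proof -
  interpret group_action G "vertices K" \<phi> using act unfolding combinatorial_action_def by blast
  interpret group G using group_hom group_hom.axioms(1) by blast
  obtain g1 where g1: "g1 \<in> carrier G" "t = shift g1 s" using t unfolding orb_def' by blast
  have "\<phi> g ` (\<phi> g1 ` h) = \<phi> (g \<otimes>\<^bsub>G\<^esub> g1) ` h" if "h \<in> set s" for h
  proof -
    have "h \<subseteq> vertices K" using s that halfspace_subset unfolding segments_def by blast
    then show ?thesis unfolding image_image
      by (intro image_cong refl) (use composition_rule g g1 in auto)
  qed
  then have "shift g t = shift (g \<otimes>\<^bsub>G\<^esub> g1) s" unfolding g1(2) by simp
  then show ?thesis unfolding orb_def' using g g1(1) by blast
qed

text \<open>Shifting permutes the orbit, which allows sums over translates to be reindexed.\<close>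

lemma orb_shift_bij:
  assumes g: "g \<in> carrier G"
  shows "inj_on (shift g) orb" and "t \<in> orb \<Longrightarrow> \<exists>t'\<in>orb. t = shift g t'"
proof -
  obtain g' where g': "g' \<in> carrier G" "\<And>v. v \<in> vertices K \<Longrightarrow> \<phi> g' (\<phi> g v) = v"
    "\<And>v. v \<in> vertices K \<Longrightarrow> \<phi> g (\<phi> g' v) = v"
    using action_inverse[OF g] by metis
  have V: "h \<subseteq> vertices K" if "t \<in> orb" "h \<in> set t" for t h
    using orb_halfspaces[OF that(1)] that(2) halfspace_subset by blast
  have "shift g' (shift g t) = t" if "t \<in> orb" for t
    using action_image_inverse[OF g'(2) V[OF that]] by (simp add: map_idI)
  then show "inj_on (shift g) orb" by (rule inj_on_inverseI)
  show "\<exists>t'\<in>orb. t = shift g t'" if t: "t \<in> orb"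
  proof
    show "shift g' t \<in> orb" using orb_shift[OF g'(1) t] .
    show "t = shift g (shift g' t)"
      using action_image_inverse[OF g'(3) V[OF t]] by (simp add: map_idI)
  qed
qed

lemma heads_exist: "t \<in> orb \<Longrightarrow> heads K t \<noteq> {}"
proof -
  assume t: "t \<in> orb"
  then have "hd t \<in> halfspaces K" using orb_halfspaces orb_nonempty hd_in_set by blast
  then obtain u v where uv: "adjacent K u v" "hd t = side u v" unfolding halfspaces_iff by blast
  have "v \<in> hcompl K (hd t)"
    using side_ends[OF uv(1)] adjacent_vertices[OF uv(1)] uv(2) unfolding hcompl_def by blast
  then show ?thesis unfolding heads_def dual_edge_iff using uv by blast
qed

lemma heads_vertex: "z \<in> heads K t \<Longrightarrow> z \<in> vertices K"
  unfolding heads_def hcompl_def by blast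

lemma heads_shift:
  assumes g: "g \<in> carrier G" and t: "t \<in> orb" and z: "z \<in> heads K t"
  shows "\<phi> g z \<in> heads K (shift g t)"
proof -
  have hd: "hd (shift g t) = \<phi> g ` hd t" using orb_nonempty[OF t] by (simp add: hd_map)
  have half: "hd t \<in> halfspaces K" using t orb_halfspaces orb_nonempty hd_in_set by blast
  obtain u v where uv: "adjacent K u v" "hd t = side u v" "z \<in> {u, v}"
    using z unfolding heads_def dual_edge_iff by blast
  have zV: "z \<in> vertices K" "z \<notin> hd t" using z unfolding heads_def hcompl_def by auto
  have "\<phi> g z \<in> hcompl K (\<phi> g ` hd t)"
    using action_image_mem[OF g zV(1) half] zV action_vertex'[OF g] unfolding hcompl_def by blast
  moreover have "dual_edge K {\<phi> g u, \<phi> g v} (\<phi> g ` hd t)"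
    unfolding dual_edge_iff using action_adjacent[OF g uv(1)] action_side[OF g uv(1)] uv(2) by auto
  ultimately show ?thesis unfolding heads_def hd using uv(3) by blast
qed

text \<open>\<open>\<mu> t\<close> is the contribution of the single translate \<open>t\<close> to the median quasimorphism.\<close>

definition \<mu> :: "'v set list \<Rightarrow> 'v \<Rightarrow> 'v \<Rightarrow> real" where
  "\<mu> t x y = of_bool (set t \<subseteq> hinterval K x y) - of_bool (set t \<subseteq> hinterval K y x)"

definition mixed :: "'v set list \<Rightarrow> 'v \<Rightarrow> bool" where
  "mixed t b \<longleftrightarrow> (\<exists>h\<in>set t. b \<in> h) \<and> (\<exists>h\<in>set t. b \<notin> h)"

lemma subset_hinterval_iff:
  "t \<in> orb \<Longrightarrow> x \<in> vertices K \<Longrightarrow> set t \<subseteq> hinterval K x y \<longleftrightarrow> (\<forall>h\<in>set t. x \<notin> h \<and> y \<in> h)"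
  using hinterval_iff orb_halfspaces by blast

text \<open>A vertex that is not mixed lies in all halfspaces of \<open>t\<close> or in none. On
  such vertices \<open>\<mu> t\<close> is the difference of the values of a zero-one function, so
  its coboundary vanishes.\<close>

lemma \<mu>_additive:
  assumes t: "t \<in> orb" and V: "x \<in> vertices K" "y \<in> vertices K" "z \<in> vertices K"
    and pure: "\<not> mixed t x" "\<not> mixed t y" "\<not> mixed t z"
  shows "\<mu> t y z - \<mu> t x z + \<mu> t x y = 0"
proof -
  have h: "hd t \<in> set t" using orb_nonempty[OF t] by (rule hd_in_set)
  define inn where "inn v \<longleftrightarrow> (\<forall>h\<in>set t. v \<in> h)" for v
  have out: "(\<forall>h\<in>set t. v \<notin> h) \<longleftrightarrow> \<not> inn v" if "\<not> mixed t v" for v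
    using that h unfolding mixed_def inn_def by meson
  have sub: "set t \<subseteq> hinterval K u v \<longleftrightarrow> \<not> inn u \<and> inn v" if "u \<in> vertices K" "\<not> mixed t u" for u v
    unfolding subset_hinterval_iff[OF t that(1)] out[OF that(2), symmetric] unfolding inn_def by meson
  show ?thesis
    unfolding \<mu>_def sub[OF V(1) pure(1)] sub[OF V(2) pure(2)] sub[OF V(3) pure(3)]
    by (cases "inn x"; cases "inn y"; cases "inn z") simp_all
qed

text \<open>Two independent reasons: without a mixed vertex the sum vanishes by
  \<open>\<mu>_additive\<close>, and a nonzero summand places \<open>t\<close> in an
  interval.\<close>

lemma \<mu>_cocycle_support:
  assumes t: "t \<in> orb" and V: "x \<in> vertices K" "y \<in> vertices K" "z \<in> vertices K"
    and nz: "\<mu> t y z - \<mu> t x z + \<mu> t x y \<noteq> 0"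
  shows "\<exists>(a, b, c)\<in>{x, y, z} \<times> {x, y, z} \<times> {x, y, z}. set t \<subseteq> hinterval K a c \<and> mixed t b"
proof -
  have "\<exists>b\<in>{x, y, z}. mixed t b" using \<mu>_additive[OF t V] nz by blast
  moreover have "\<exists>a\<in>{x, y, z}. \<exists>c\<in>{x, y, z}. set t \<subseteq> hinterval K a c"
  proof (rule ccontr)
    assume "\<not> (\<exists>a\<in>{x, y, z}. \<exists>c\<in>{x, y, z}. set t \<subseteq> hinterval K a c)"
    then show False using nz unfolding \<mu>_def by simp
  qed
  ultimately show ?thesis by blast
qed

lemma finite_segments_hinterval:
  assumes "a \<in> vertices K" "c \<in> vertices K"
  shows "finite {t \<in> segments K l. set t \<subseteq> hinterval K a c}"
  by (rule finite_subset[OF _ finite_lists_length_eq[OF finite_hinterval[OF assms], of l]])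
    (auto simp: segments_def)

lemma \<mu>_cocycle_bounded:
  assumes "cc_dimension K < \<infinity>" "staircase_length K < \<infinity>"
  obtains N where "\<And>x y z. x \<in> vertices K \<Longrightarrow> y \<in> vertices K \<Longrightarrow> z \<in> vertices K \<Longrightarrow>
    card {t \<in> orb. \<mu> t y z - \<mu> t x z + \<mu> t x y \<noteq> 0} \<le> N"
proof -
  obtain d where d: "\<And>C n c. C \<in> K \<Longrightarrow> cube_chart K n c C \<Longrightarrow> n \<le> d"
    using cc_dimension_bound[OF assms(1)] by blast
  obtain \<sigma> where \<sigma>: "\<And>hs ks. staircase K hs ks \<Longrightarrow> length hs \<le> \<sigma>"
    using staircase_length_bound[OF assms(2)] by blast
  have "\<exists>N. \<forall>a\<in>vertices K. \<forall>b\<in>vertices K. \<forall>c\<in>vertices K.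
    card {t \<in> segments K l. set t \<subseteq> hinterval K a c \<and> (\<exists>h\<in>set t. b \<in> h) \<and> (\<exists>h\<in>set t. b \<notin> h)} \<le> N"
    by (rule mixed_segments_bounded[of d \<sigma> l]) (fact d, fact \<sigma>)
  then obtain N where N: "\<forall>a\<in>vertices K. \<forall>b\<in>vertices K. \<forall>c\<in>vertices K.
    card {t \<in> segments K l. set t \<subseteq> hinterval K a c \<and> mixed t b} \<le> N"
    unfolding mixed_def by blast
  show ?thesis
  \<comment> \<open>There are at most \<open>3 * 3 * 3\<close> triples consisting of the two ends of
    the interval and the mixed vertex.\<close>
  proof (rule that[of "27 * N"])
    fix x y z assume V: "x \<in> vertices K" "y \<in> vertices K" "z \<in> vertices K"
    define I where "I = {x, y, z} \<times> {x, y, z} \<times> {x, y, z}"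
    define M where "M = (\<lambda>(a, b, c). {t \<in> segments K l. set t \<subseteq> hinterval K a c \<and> mixed t b})"
    have finI: "finite I" unfolding I_def by simp
    have I: "a \<in> vertices K" "b \<in> vertices K" "c \<in> vertices K" if "(a, b, c) \<in> I" for a b c
      using that V unfolding I_def by auto
    have finM: "finite (M i)" if "i \<in> I" for i
    proof -
      obtain a b c where i: "i = (a, b, c)" by (cases i) auto
      show ?thesis unfolding M_def i prod.case
        by (rule finite_subset[OF _ finite_segments_hinterval[of a c]]) (use I that i in auto)
    qed
    have "{t \<in> orb. \<mu> t y z - \<mu> t x z + \<mu> t x y \<noteq> 0} \<subseteq> (\<Union>i\<in>I. M i)"
    proof
      fix t assume "t \<in> {t \<in> orb. \<mu> t y z - \<mu> t x z + \<mu> t x y \<noteq> 0}"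
      then have t: "t \<in> orb" "\<mu> t y z - \<mu> t x z + \<mu> t x y \<noteq> 0" by auto
      from \<mu>_cocycle_support[OF t(1) V t(2)] obtain i where i: "i \<in> I"
        "case i of (a, b, c) \<Rightarrow> set t \<subseteq> hinterval K a c \<and> mixed t b"
        unfolding I_def by (elim bexE)
      then have "t \<in> M i"
        using orb_segments[OF t(1)] unfolding M_def by (cases i) simp
      then show "t \<in> (\<Union>i\<in>I. M i)" using i(1) by (rule UN_I[rotated])
    qed
    then have "card {t \<in> orb. \<mu> t y z - \<mu> t x z + \<mu> t x y \<noteq> 0} \<le> card (\<Union>i\<in>I. M i)"
      by (rule card_mono[rotated]) (use finI finM in blast)
    also have "\<dots> \<le> (\<Sum>i\<in>I. card (M i))" by (rule card_UN_le[OF finI])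
    also have "\<dots> \<le> (\<Sum>i\<in>I. N)"
    proof (rule sum_mono)
      fix i assume i: "i \<in> I"
      obtain a b c where abc: "i = (a, b, c)" by (cases i) auto
      show "card (M i) \<le> N" using N I i unfolding abc M_def by simp
    qed
    also have "\<dots> = card I * N" by simp
    also have "\<dots> \<le> 27 * N"
    proof -
      have "card {x, y, z} \<le> 3" by (simp add: card_insert_if)
      then have "card {x, y, z} * (card {x, y, z} * card {x, y, z}) \<le> 3 * (3 * 3)"
        by (intro mult_le_mono)
      then show ?thesis unfolding I_def card_cartesian_product by simp
    qed
    finally show "card {t \<in> orb. \<mu> t y z - \<mu> t x z + \<mu> t x y \<noteq> 0} \<le> 27 * N" .
  qed
qed

lemma \<mu>_shift:
  assumes g: "g \<in> carrier G" and t: "t \<in> orb" and V: "x \<in> vertices K" "y \<in> vertices K"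
  shows "\<mu> (shift g t) (\<phi> g x) (\<phi> g y) = \<mu> t x y"
proof -
  have "set (shift g t) \<subseteq> hinterval K (\<phi> g u) (\<phi> g v) \<longleftrightarrow> set t \<subseteq> hinterval K u v"
    if "u \<in> vertices K" "v \<in> vertices K" for u v
    using action_hinterval[OF g that] orb_halfspaces[OF t] by auto
  then show ?thesis unfolding \<mu>_def using V by simp
qed

end

section \<open>Trivial products\<close>

context CAT0_action
begin

section \<open>Locally finite sums over the orbit\<close>

definition near :: "'v set \<Rightarrow> 'v set list set" where
  "near X = {t \<in> orb. \<exists>x\<in>X. \<exists>y\<in>X. set t \<subseteq> hinterval K x y}"

text \<open>Stands for the sum over the whole orbit, which may be infinite. The restriction to
  \<open>near (set xs)\<close> makes it finite and loses nothing for the families singled out by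
  \<open>local_family\<close>.\<close>

definition orbit_sum :: "('v set list \<Rightarrow> 'v list \<Rightarrow> real) \<Rightarrow> 'v list \<Rightarrow> real" where
  "orbit_sum F xs = (\<Sum>t\<in>near (set xs). F t xs)"

definition local_family :: "nat \<Rightarrow> ('v set list \<Rightarrow> 'v list \<Rightarrow> real) \<Rightarrow> bool" where
  "local_family n F \<longleftrightarrow> (\<forall>t xs. xs \<notin> tuples K (n + 1) \<longrightarrow> F t xs = 0) \<and>
     (\<forall>t\<in>orb. \<forall>xs. t \<notin> near (set xs) \<longrightarrow> F t xs = 0)"

lemma near_mono: "X \<subseteq> Y \<Longrightarrow> near X \<subseteq> near Y"
  unfolding near_def by blast

lemma near_orb: "near X \<subseteq> orb"
  unfolding near_def by blast

lemma finite_near: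
  assumes "finite X" "X \<subseteq> vertices K"
  shows "finite (near X)"
proof (rule finite_subset)
  show "near X \<subseteq> (\<Union>x\<in>X. \<Union>y\<in>X. {t \<in> segments K l. set t \<subseteq> hinterval K x y})"
    unfolding near_def using orb_segments by blast
  show "finite (\<Union>x\<in>X. \<Union>y\<in>X. {t \<in> segments K l. set t \<subseteq> hinterval K x y})"
    by (intro finite_UN_I assms(1) finite_segments_hinterval) (use assms(2) in auto)
qed

lemma finite_near_tuple: "xs \<in> tuples K n \<Longrightarrow> finite (near (set xs))"
  by (rule finite_near) (auto simp: tuples_def)

lemma local_familyD:
  assumes "local_family n F"
  shows "xs \<notin> tuples K (n + 1) \<Longrightarrow> F t xs = 0"
    and "t \<in> orb \<Longrightarrow> t \<notin> near (set xs) \<Longrightarrow> F t xs = 0"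
  using assms unfolding local_family_def by blast+

text \<open>A part of a tuple has its own, possibly smaller, set of near translates. Passing to the
  index set of the whole tuple is what allows coboundaries and cup products to be taken
  termwise.\<close>

lemma orbit_sum_subset:
  assumes F: "local_family n F" and ys: "set ys \<subseteq> set xs" and xs: "xs \<in> tuples K k"
  shows "orbit_sum F ys = (\<Sum>t\<in>near (set xs). F t ys)"
  unfolding orbit_sum_def
  by (rule sum.mono_neutral_left[OF finite_near_tuple[OF xs] near_mono[OF ys]])
    (use near_orb local_familyD(2)[OF F] in blast)

lemma omit_subset: "set (omit i xs) \<subseteq> set xs"
  by (auto dest: in_set_takeD in_set_dropD)

lemma orbit_sum_coboundary:
  assumes F: "local_family n F"
  shows "coboundary K n (orbit_sum F) = orbit_sum (\<lambda>t. coboundary K n (F t))"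
proof
  fix xs
  show "coboundary K n (orbit_sum F) xs = orbit_sum (\<lambda>t. coboundary K n (F t)) xs"
  proof (cases "xs \<in> tuples K (n + 2)")
    case True
    have "coboundary K n (orbit_sum F) xs = coboundary K n (\<lambda>ys. \<Sum>t\<in>near (set xs). F t ys) xs"
      unfolding coboundary_tuple[OF True] by (simp only: orbit_sum_subset[OF F omit_subset True])
    then show ?thesis unfolding coboundary_sum orbit_sum_def .
  qed (simp add: coboundary_outside orbit_sum_def)
qed

lemma orbit_sum_cup_left:
  assumes F: "local_family q F"
  shows "cup K p q f (orbit_sum F) = orbit_sum (\<lambda>t. cup K p q f (F t))"
proof
  fix xs
  show "cup K p q f (orbit_sum F) xs = orbit_sum (\<lambda>t. cup K p q f (F t)) xs"
  proof (cases "xs \<in> tuples K (p + q + 1)")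
    case True
    show ?thesis
      unfolding cup_tuple[OF True] orbit_sum_subset[OF F set_drop_subset True]
      by (simp add: orbit_sum_def cup_tuple[OF True, simplified] sum_distrib_left)
  qed (simp add: cup_outside orbit_sum_def)
qed

lemma orbit_sum_cup_right:
  assumes F: "local_family p F"
  shows "cup K p q (orbit_sum F) h = orbit_sum (\<lambda>t. cup K p q (F t) h)"
proof
  fix xs
  show "cup K p q (orbit_sum F) h xs = orbit_sum (\<lambda>t. cup K p q (F t) h) xs"
  proof (cases "xs \<in> tuples K (p + q + 1)")
    case True
    show ?thesis
      unfolding cup_tuple[OF True] orbit_sum_subset[OF F set_take_subset True]
      by (simp add: orbit_sum_def cup_tuple[OF True, simplified] sum_distrib_right)
  qed (simp add: cup_outside orbit_sum_def)
qed

lemma orbit_sum_cong: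
  assumes "\<And>t. t \<in> orb \<Longrightarrow> F t = F' t"
  shows "orbit_sum F = orbit_sum F'"
proof
  fix xs
  have "F t xs = F' t xs" if "t \<in> near (set xs)" for t
    using assms[OF subsetD[OF near_orb that]] by simp
  then show "orbit_sum F xs = orbit_sum F' xs" unfolding orbit_sum_def by (rule sum.cong[OF refl])
qed

lemma local_family_coboundary:
  assumes F: "local_family n F"
  shows "local_family (Suc n) (\<lambda>t. coboundary K n (F t))"
  unfolding local_family_def
proof (intro conjI allI impI ballI)
  fix t xs assume "xs \<notin> tuples K (Suc n + 1)"
  then show "coboundary K n (F t) xs = 0" by (simp add: coboundary_def)
next
  fix t xs assume t: "t \<in> orb" "t \<notin> near (set xs)"
  have "F t (omit i xs) = 0" for i
    using local_familyD(2)[OF F t(1)] t(2) near_mono[OF omit_subset] by blast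
  then show "coboundary K n (F t) xs = 0" by (simp add: coboundary_def)
qed

lemma local_family_cup_left:
  assumes "local_family q F"
  shows "local_family (p + q) (\<lambda>t. cup K p q (f t) (F t))"
  unfolding local_family_def
proof (intro conjI allI impI ballI)
  fix t xs assume t: "t \<in> orb" "t \<notin> near (set xs)"
  have "F t (drop p xs) = 0"
    using local_familyD(2)[OF assms t(1)] t(2) near_mono[OF set_drop_subset] by blast
  then show "cup K p q (f t) (F t) xs = 0" by (simp add: cup_def)
qed (simp add: cup_def)

lemma local_family_cup_right:
  assumes "local_family p F"
  shows "local_family (p + q) (\<lambda>t. cup K p q (F t) (f t))"
  unfolding local_family_def
proof (intro conjI allI impI ballI)
  fix t xs assume t: "t \<in> orb" "t \<notin> near (set xs)"
  have "F t (take (p + 1) xs) = 0"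
    using local_familyD(2)[OF assms t(1)] t(2) near_mono[OF set_take_subset] by blast
  then show "cup K p q (F t) (f t) xs = 0" by (simp add: cup_def)
qed (simp add: cup_def)

lemma near_shift:
  assumes g: "g \<in> carrier G" and X: "X \<subseteq> vertices K"
  shows "near (\<phi> g ` X) = shift g ` near X"
proof -
  have iff: "shift g t \<in> near (\<phi> g ` X) \<longleftrightarrow> t \<in> near X" if t: "t \<in> orb" for t
  proof -
    have "set (shift g t) \<subseteq> hinterval K (\<phi> g u) (\<phi> g v) \<longleftrightarrow> set t \<subseteq> hinterval K u v"
      if "u \<in> X" "v \<in> X" for u v
    proof -
      have "u \<in> vertices K" "v \<in> vertices K" using X that by auto
      then have "\<forall>h\<in>set t. \<phi> g ` h \<in> hinterval K (\<phi> g u) (\<phi> g v) \<longleftrightarrow> h \<in> hinterval K u v"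
        using action_hinterval[OF g] orb_halfspaces[OF t] by blast
      then show ?thesis by auto
    qed
    then show ?thesis unfolding near_def using t orb_shift[OF g t] by simp
  qed
  show ?thesis
  proof (intro subset_antisym subsetI)
    fix t assume t: "t \<in> near (\<phi> g ` X)"
    then obtain t' where "t' \<in> orb" "t = shift g t'" using orb_shift_bij(2)[OF g] near_orb by blast
    then show "t \<in> shift g ` near X" using iff t by blast
  next
    fix t assume "t \<in> shift g ` near X"
    then show "t \<in> near (\<phi> g ` X)" using iff near_orb by blast
  qed
qed

text \<open>The near translates are finite in number for each tuple, but boundedness needs the
  uniform bound \<open>N\<close> on the nonzero terms. Invariance is the reindexing of the sum by
  the shift of the orbit.\<close>

lemma orbit_sum_cochain:
  assumes F: "local_family n F"
    and inv: "\<And>g t xs. g \<in> carrier G \<Longrightarrow> t \<in> orb \<Longrightarrow> xs \<in> tuples K (n + 1) \<Longrightarrow>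
      F (shift g t) (map (\<phi> g) xs) = F t xs"
    and bound: "\<And>t xs. t \<in> orb \<Longrightarrow> \<bar>F t xs\<bar> \<le> B" and B: "B \<ge> 0"
    and supp: "\<And>xs. xs \<in> tuples K (n + 1) \<Longrightarrow> card {t \<in> orb. F t xs \<noteq> 0} \<le> N"
  shows "orbit_sum F \<in> cochains G K \<phi> n"
proof (rule cochainsI[OF act, where B = "real N * B"])
  show "orbit_sum F xs = 0" if "xs \<notin> tuples K (n + 1)" for xs
    unfolding orbit_sum_def using local_familyD(1)[OF F that] by simp
next
  fix xs assume xs: "xs \<in> tuples K (n + 1)"
  let ?S = "{t \<in> orb. F t xs \<noteq> 0}"
  have S: "?S \<subseteq> near (set xs)" using local_familyD(2)[OF F] by blast
  have "orbit_sum F xs = (\<Sum>t\<in>?S. F t xs)"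
    unfolding orbit_sum_def
    by (rule sum.mono_neutral_right[OF finite_near_tuple[OF xs] S]) (use near_orb in blast)
  then have "\<bar>orbit_sum F xs\<bar> \<le> (\<Sum>t\<in>?S. \<bar>F t xs\<bar>)" by (simp add: sum_abs)
  also have "\<dots> \<le> (\<Sum>t\<in>?S. B)" by (rule sum_mono) (use bound in auto)
  also have "\<dots> = real (card ?S) * B" by simp
  also have "\<dots> \<le> real N * B" using supp[OF xs] B by (intro mult_right_mono) auto
  finally show "\<bar>orbit_sum F xs\<bar> \<le> real N * B" .
next
  fix g xs assume g: "g \<in> carrier G" and xs: "xs \<in> tuples K (n + 1)"
  have "set xs \<subseteq> vertices K" using xs by (simp add: tuples_def)
  then have "orbit_sum F (map (\<phi> g) xs) = (\<Sum>t\<in>shift g ` near (set xs). F t (map (\<phi> g) xs))"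
    unfolding orbit_sum_def using near_shift[OF g] by simp
  also have "\<dots> = (\<Sum>t\<in>near (set xs). F (shift g t) (map (\<phi> g) xs))"
    by (rule sum.reindex[OF inj_on_subset[OF orb_shift_bij(1)[OF g] near_orb], unfolded comp_def])
  also have "\<dots> = orbit_sum F xs"
    unfolding orbit_sum_def by (rule sum.cong) (use inv[OF g _ xs] near_orb in auto)
  finally show "orbit_sum F (map (\<phi> g) xs) = orbit_sum F xs" .
qed

section \<open>The median cocycle as an orbit sum\<close>

definition \<mu>_cochain :: "'v set list \<Rightarrow> 'v list \<Rightarrow> real" where
  "\<mu>_cochain t xs = (if xs \<in> tuples K 2 then \<mu> t (xs ! 0) (xs ! 1) else 0)"

definition d\<mu> :: "'v set list \<Rightarrow> 'v list \<Rightarrow> real" where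
  "d\<mu> t = coboundary K 1 (\<mu>_cochain t)"

lemma local_\<mu>_cochain: "local_family 1 \<mu>_cochain"
  unfolding local_family_def
proof (intro conjI allI impI ballI)
  fix t xs assume "xs \<notin> tuples K (1 + 1)"
  then show "\<mu>_cochain t xs = 0" by (simp add: \<mu>_cochain_def numeral_2_eq_2)
next
  fix t xs assume t: "t \<in> orb" "t \<notin> near (set xs)"
  show "\<mu>_cochain t xs = 0"
  proof (cases "xs \<in> tuples K 2")
    case True
    then have "xs ! 0 \<in> set xs" "xs ! 1 \<in> set xs" unfolding tuples_def by auto
    then have "\<not> set t \<subseteq> hinterval K (xs ! 0) (xs ! 1)" "\<not> set t \<subseteq> hinterval K (xs ! 1) (xs ! 0)"
      using t unfolding near_def by blast+
    then show ?thesis unfolding \<mu>_cochain_def \<mu>_def by simp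
  qed (simp add: \<mu>_cochain_def)
qed

lemma orbit_sum_\<mu>: "orbit_sum \<mu>_cochain = median_cochain G K \<phi> s"
proof
  fix xs
  show "orbit_sum \<mu>_cochain xs = median_cochain G K \<phi> s xs"
  proof (cases "xs \<in> tuples K 2")
    case True
    define x y where "x = xs ! 0" and "y = xs ! 1"
    have xy: "x \<in> set xs" "y \<in> set xs" using True unfolding tuples_def x_def y_def by auto
    have c: "(\<Sum>t\<in>near (set xs). of_bool (set t \<subseteq> hinterval K u v)) =
        real (card {t \<in> orb. set t \<subseteq> hinterval K u v})" if "u \<in> set xs" "v \<in> set xs" for u v
    proof -
      have "near (set xs) \<inter> {t. set t \<subseteq> hinterval K u v} = {t \<in> orb. set t \<subseteq> hinterval K u v}"
        using that unfolding near_def by blast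
      then show ?thesis
        using finite_near_tuple[OF True] by simp
    qed
    have "orbit_sum \<mu>_cochain xs = (\<Sum>t\<in>near (set xs). \<mu> t x y)"
      unfolding orbit_sum_def \<mu>_cochain_def x_def y_def using True by simp
    also have "\<dots> = median_quasimorphism G K \<phi> s x y"
      unfolding \<mu>_def median_quasimorphism_def sum_subtractf c[OF xy] c[OF xy(2,1)] ..
    finally show ?thesis unfolding median_cochain_def x_def y_def using True by simp
  qed (simp add: orbit_sum_def \<mu>_cochain_def median_cochain_def)
qed

lemma local_d\<mu>: "local_family 2 d\<mu>"
  using local_family_coboundary[OF local_\<mu>_cochain] unfolding d\<mu>_def[abs_def] by (simp add: numeral_2_eq_2)

lemma orbit_sum_d\<mu>: "orbit_sum d\<mu> = coboundary K 1 (median_cochain G K \<phi> s)"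
  unfolding orbit_sum_\<mu>[symmetric] orbit_sum_coboundary[OF local_\<mu>_cochain] d\<mu>_def[abs_def] ..

lemma coboundary_d\<mu>: "coboundary K 2 (d\<mu> t) = (\<lambda>_. 0)"
  unfolding d\<mu>_def using coboundary_coboundary[of K 1] by (simp add: numeral_2_eq_2)

lemma d\<mu>_eq:
  assumes "[x, y, z] \<in> tuples K 3"
  shows "d\<mu> t [x, y, z] = \<mu> t y z - \<mu> t x z + \<mu> t x y"
proof -
  have "[y, z] \<in> tuples K 2" "[x, z] \<in> tuples K 2" "[x, y] \<in> tuples K 2"
    using assms unfolding tuples_def by auto
  moreover have "{..Suc (Suc 0)} = {0, 1, 2}" by auto
  ultimately show ?thesis
    using assms unfolding d\<mu>_def coboundary_def \<mu>_cochain_def by (simp add: numeral_3_eq_3)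
qed

lemma tuples_3E:
  assumes "xs \<in> tuples K 3"
  obtains x y z where "xs = [x, y, z]" "x \<in> vertices K" "y \<in> vertices K" "z \<in> vertices K"
  using assms unfolding tuples_def by (auto simp: numeral_3_eq_3 length_Suc_conv)

lemma d\<mu>_bound: "\<bar>d\<mu> t xs\<bar> \<le> 3"
proof (cases "xs \<in> tuples K 3")
  case True
  then obtain x y z where xyz: "xs = [x, y, z]" by (rule tuples_3E)
  have "\<bar>\<mu> t u v\<bar> \<le> 1" for u v unfolding \<mu>_def by simp
  from this[of y z] this[of x z] this[of x y] show ?thesis
    using d\<mu>_eq[of x y z t] True unfolding xyz by linarith
next
  case False
  then show ?thesis unfolding d\<mu>_def by (simp add: coboundary_def numeral_3_eq_3)
qed

lemma d\<mu>_shift: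
  assumes g: "g \<in> carrier G" and t: "t \<in> orb" and xs: "xs \<in> tuples K 3"
  shows "d\<mu> (shift g t) (map (\<phi> g) xs) = d\<mu> t xs"
proof -
  obtain x y z where xyz: "xs = [x, y, z]" "x \<in> vertices K" "y \<in> vertices K" "z \<in> vertices K"
    using xs by (rule tuples_3E)
  have "map (\<phi> g) xs \<in> tuples K 3" by (rule action_tuples[OF act g xs])
  then show ?thesis using xs \<mu>_shift[OF g t] xyz d\<mu>_eq by simp
qed

section \<open>Cones with apex at a head\<close>

definition chosen_head :: "'v set list \<Rightarrow> 'v" where
  "chosen_head t = (SOME z. z \<in> heads K t)"

lemma chosen_head: "t \<in> orb \<Longrightarrow> chosen_head t \<in> heads K t"
  unfolding chosen_head_def using heads_exist some_in_eq by blast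

text \<open>Coning off a cocycle with a head of the translate \<open>t\<close> yields a primitive.  The choice of the
  head does not matter by non-transversality, so the primitives are equivariant in \<open>t\<close>.\<close>

definition cone :: "('v list \<Rightarrow> real) \<Rightarrow> nat \<Rightarrow> 'v set list \<Rightarrow> 'v list \<Rightarrow> real" where
  "cone \<kappa> n t xs = (if xs \<in> tuples K (Suc n) then \<kappa> (chosen_head t # xs) else 0)"

text \<open>The cocycle identity at \<open>chosen_head t # xs\<close> equates
  \<open>\<kappa> xs\<close>, the face without the apex, with the alternating sum of the faces that
  keep it.\<close>

lemma coboundary_cone:
  assumes \<kappa>: "\<kappa> \<in> cocycles G K \<phi> (Suc n)" and t: "t \<in> orb"
  shows "coboundary K n (cone \<kappa> n t) = \<kappa>"
proof
  fix xs
  let ?z = "chosen_head t"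
  show "coboundary K n (cone \<kappa> n t) xs = \<kappa> xs"
  proof (cases "xs \<in> tuples K (n + 2)")
    case True
    then have zxs: "?z # xs \<in> tuples K (Suc n + 2)"
      using heads_vertex[OF chosen_head[OF t]] unfolding tuples_def by simp
    have "coboundary K (Suc n) \<kappa> (?z # xs) = 0" using \<kappa> unfolding cocycles_def by simp
    then have "(\<Sum>i\<le>Suc (n + 1). (-1) ^ i * \<kappa> (omit i (?z # xs))) = 0"
      unfolding coboundary_tuple[OF zxs] by simp
    then have "\<kappa> xs - (\<Sum>i\<le>n + 1. (-1) ^ i * \<kappa> (?z # omit i xs)) = 0"
      unfolding sum.atMost_Suc_shift[of _ "n + 1"] by (simp add: sum_negf del: sum.atMost_Suc)
    moreover have "cone \<kappa> n t (omit i xs) = \<kappa> (?z # omit i xs)" if "i \<le> n + 1" for i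
      unfolding cone_def using omit_tuples[of xs K "n + 1" i] True that by simp
    ultimately show ?thesis unfolding coboundary_tuple[OF True] by simp
  next
    case False
    then show ?thesis using \<kappa> coboundary_outside unfolding cocycles_def cochains_def by force
  qed
qed

text \<open>The action takes the chosen head of \<open>t\<close> to a head of the shifted translate,
  though not necessarily to the chosen one. Non-transversality to the shifted translate permits the
  exchange, and invariance of \<open>\<kappa>\<close> does the rest.\<close>

lemma cone_shift:
  assumes \<kappa>: "\<kappa> \<in> cocycles G K \<phi> (Suc n)" and nt: "\<And>t. t \<in> orb \<Longrightarrow> non_transverse K (Suc n) \<kappa> t"
    and g: "g \<in> carrier G" and t: "t \<in> orb" and xs: "xs \<in> tuples K (Suc n)"
  shows "cone \<kappa> n (shift g t) (map (\<phi> g) xs) = cone \<kappa> n t xs"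
proof -
  have xs': "map (\<phi> g) xs \<in> tuples K (Suc n)" by (rule action_tuples[OF act g xs])
  have gt: "shift g t \<in> orb" using orb_shift[OF g t] .
  have "\<kappa> (chosen_head (shift g t) # map (\<phi> g) xs) = \<kappa> (\<phi> g (chosen_head t) # map (\<phi> g) xs)"
    using nt[OF gt] xs' chosen_head[OF gt] heads_shift[OF g t chosen_head[OF t]]
    unfolding non_transverse_def by blast
  also have "\<dots> = \<kappa> (map (\<phi> g) (chosen_head t # xs))" by simp
  also have "\<dots> = \<kappa> (chosen_head t # xs)"
  proof -
    have "chosen_head t # xs \<in> tuples K (Suc n + 1)"
      using xs heads_vertex[OF chosen_head[OF t]] unfolding tuples_def by simp
    then show ?thesis using \<kappa> g unfolding cocycles_def cochains_def by blast
  qed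
  finally show ?thesis unfolding cone_def using xs xs' by simp
qed

text \<open>A product with a factor \<open>d\<mu> t\<close> evaluated at the entries
  \<open>ys\<close> inherits the bound on the number of contributing translates.\<close>

lemma cup_d\<mu>_support:
  assumes N: "\<And>xs. xs \<in> tuples K 3 \<Longrightarrow> card {t \<in> orb. d\<mu> t xs \<noteq> 0} \<le> N"
    and fin: "ys \<in> tuples K 3" and sub: "\<And>t. t \<in> orb \<Longrightarrow> d\<mu> t ys = 0 \<Longrightarrow> F t = (0::real)"
  shows "card {t \<in> orb. F t \<noteq> 0} \<le> N"
proof -
  have "{t \<in> orb. F t \<noteq> 0} \<subseteq> {t \<in> orb. d\<mu> t ys \<noteq> 0}" using sub by blast
  moreover have "finite {t \<in> orb. d\<mu> t ys \<noteq> 0}"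
    by (rule finite_subset[OF _ finite_near_tuple[OF fin]]) (use local_familyD(2)[OF local_d\<mu>] in blast)
  ultimately show ?thesis using card_mono N[OF fin] le_trans by blast
qed

text \<open>The cocycles have degrees \<open>Suc n\<close> and \<open>Suc m\<close>, so their cones
  have degrees \<open>n\<close> and \<open>m\<close>. The three cochains are produced together
  because the Massey product involves the very primitives \<open>\<beta>1\<close> and
  \<open>\<beta>2\<close> chosen for the two cup products.\<close>

lemma products_trivial:
  assumes fin: "cc_dimension K < \<infinity>" "staircase_length K < \<infinity>"
    and \<kappa>1: "\<kappa>1 \<in> cocycles G K \<phi> (Suc n)" "\<And>t. t \<in> orb \<Longrightarrow> non_transverse K (Suc n) \<kappa>1 t"
    and \<kappa>2: "\<kappa>2 \<in> cocycles G K \<phi> (Suc m)" "\<And>t. t \<in> orb \<Longrightarrow> non_transverse K (Suc m) \<kappa>2 t"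
  defines "\<omega> \<equiv> coboundary K 1 (median_cochain G K \<phi> s)"
  shows "\<omega> \<in> cocycles G K \<phi> 2"
    and "\<exists>\<beta>1\<in>cochains G K \<phi> (n + 2). \<exists>\<beta>2\<in>cochains G K \<phi> (2 + m). \<exists>\<eta>\<in>cochains G K \<phi> (n + 2 + m).
      coboundary K (n + 2) \<beta>1 = cup K (Suc n) 2 \<kappa>1 \<omega> \<and>
      coboundary K (2 + m) \<beta>2 = cup K 2 (Suc m) \<omega> \<kappa>2 \<and>
      coboundary K (n + 2 + m) \<eta> = (\<lambda>xs. cup K (Suc n) (2 + m) \<kappa>1 \<beta>2 xs +
        (-1) ^ n * cup K (n + 2) (Suc m) \<beta>1 \<kappa>2 xs)"
proof -
  obtain N where N: "\<And>x y z. x \<in> vertices K \<Longrightarrow> y \<in> vertices K \<Longrightarrow> z \<in> vertices K \<Longrightarrow>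
    card {t \<in> orb. \<mu> t y z - \<mu> t x z + \<mu> t x y \<noteq> 0} \<le> N"
    using \<mu>_cocycle_bounded[OF fin] by blast
  have supp: "card {t \<in> orb. d\<mu> t xs \<noteq> 0} \<le> N" if xs: "xs \<in> tuples K 3" for xs
  proof -
    obtain x y z where xyz: "xs = [x, y, z]" "x \<in> vertices K" "y \<in> vertices K" "z \<in> vertices K"
      using xs by (rule tuples_3E)
    show ?thesis unfolding xyz(1) d\<mu>_eq[OF xs[unfolded xyz(1)]] using N[OF xyz(2-4)] .
  qed
  have \<omega>: "\<omega> = orbit_sum d\<mu>" unfolding \<omega>_def orbit_sum_d\<mu> ..
  have "orbit_sum d\<mu> \<in> cochains G K \<phi> 2"
    by (rule orbit_sum_cochain[OF local_d\<mu>, where B = 3 and N = N])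
      (use d\<mu>_shift d\<mu>_bound supp in \<open>auto simp: numeral_3_eq_3\<close>)
  moreover have "coboundary K 2 \<omega> = (\<lambda>_. 0)"
    unfolding \<omega>_def using coboundary_coboundary[of K 1] by (simp add: numeral_2_eq_2)
  ultimately show "\<omega> \<in> cocycles G K \<phi> 2" unfolding \<omega> cocycles_def by simp
  define C1 where "C1 = cone \<kappa>1 n"
  define C2 where "C2 = cone \<kappa>2 m"
  define F1 where "F1 t = cup K n 2 (C1 t) (d\<mu> t)" for t
  define F2 where "F2 t = cup K 2 m (d\<mu> t) (C2 t)" for t
  define F3 where "F3 t = cup K (n + 2) m (F1 t) (C2 t)" for t
  have loc: "local_family (n + 2) F1" "local_family (2 + m) F2" "local_family (n + 2 + m) F3"
    unfolding F1_def F2_def F3_def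
    by (intro local_family_cup_left local_family_cup_right local_d\<mu>)+
  have dC: "coboundary K n (C1 t) = \<kappa>1" "coboundary K m (C2 t) = \<kappa>2" if "t \<in> orb" for t
    unfolding C1_def C2_def using coboundary_cone \<kappa>1(1) \<kappa>2(1) that by auto
  have dF1: "coboundary K (n + 2) (F1 t) = cup K (Suc n) 2 \<kappa>1 (d\<mu> t)" if t: "t \<in> orb" for t
    unfolding F1_def coboundary_cup coboundary_d\<mu> dC[OF t] cup_zero[OF act] by simp
  have dF2: "coboundary K (2 + m) (F2 t) = cup K 2 (Suc m) (d\<mu> t) \<kappa>2" if t: "t \<in> orb" for t
    unfolding F2_def coboundary_cup coboundary_d\<mu> dC[OF t] cup_zero[OF act] by simp
  \<comment> \<open>The middle factor is closed, so the coboundary falls on one of the cones: on the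
    left it leaves \<open>\<kappa>1\<close> times \<open>F2 t\<close>, on the right
    \<open>F1 t\<close> times \<open>\<kappa>2\<close>. The sign \<open>(-1) ^ (n + 2)\<close> of
    the second term is \<open>(-1) ^ n\<close>.\<close>
  have dF3: "coboundary K (n + 2 + m) (F3 t) = (\<lambda>xs. cup K (Suc n) (2 + m) \<kappa>1 (F2 t) xs +
      (-1) ^ n * cup K (n + 2) (Suc m) (F1 t) \<kappa>2 xs)" if t: "t \<in> orb" for t
  proof -
    have "cup K (Suc (n + 2)) m (cup K (Suc n) 2 \<kappa>1 (d\<mu> t)) (C2 t) = cup K (Suc n) (2 + m) \<kappa>1 (F2 t)"
      using cup_assoc[of K "Suc n" 2 m \<kappa>1 "d\<mu> t" "C2 t"] unfolding F2_def by simp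
    then show ?thesis unfolding F3_def coboundary_cup dF1[OF t] dC[OF t] by simp
  qed
  have bounded: "\<exists>B\<ge>0. \<forall>xs. \<bar>\<kappa> xs\<bar> \<le> B" if "\<kappa> \<in> cocycles G K \<phi> k" for \<kappa> k
  proof -
    have "\<kappa> \<in> cochains G K \<phi> k" using that unfolding cocycles_def by blast
    then show ?thesis by (rule cochainsE[OF act]) (intro exI conjI allI)
  qed
  obtain B1 where B1: "B1 \<ge> 0" "\<And>xs. \<bar>\<kappa>1 xs\<bar> \<le> B1" using bounded[OF \<kappa>1(1)] by auto
  obtain B2 where B2: "B2 \<ge> 0" "\<And>xs. \<bar>\<kappa>2 xs\<bar> \<le> B2" using bounded[OF \<kappa>2(1)] by auto
  have bC: "\<bar>C1 t xs\<bar> \<le> B1" "\<bar>C2 t xs\<bar> \<le> B2" for t xs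
    unfolding C1_def C2_def cone_def using B1 B2 by auto
  have bF1: "\<bar>F1 t xs\<bar> \<le> B1 * 3" for t xs
    unfolding F1_def cup_def using bC(1) d\<mu>_bound B1(1) by (auto simp: abs_mult intro: mult_mono)
  have bF2: "\<bar>F2 t xs\<bar> \<le> 3 * B2" for t xs
    unfolding F2_def cup_def using bC(2) d\<mu>_bound B2(1) by (auto simp: abs_mult intro: mult_mono)
  have bF3: "\<bar>F3 t xs\<bar> \<le> B1 * 3 * B2" for t xs
    unfolding F3_def cup_def using bC(2) bF1 B1(1) B2(1) by (auto simp: abs_mult intro: mult_mono)
  have sC1: "C1 (shift g t) (map (\<phi> g) xs) = C1 t xs"
    if "g \<in> carrier G" "t \<in> orb" "xs \<in> tuples K (n + 1)" for g t xs
    unfolding C1_def using cone_shift[OF \<kappa>1(1) \<kappa>1(2) that(1,2)] that(3) by simp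
  have sC2: "C2 (shift g t) (map (\<phi> g) xs) = C2 t xs"
    if "g \<in> carrier G" "t \<in> orb" "xs \<in> tuples K (m + 1)" for g t xs
    unfolding C2_def using cone_shift[OF \<kappa>2(1) \<kappa>2(2) that(1,2)] that(3) by simp
  have sd: "d\<mu> (shift g t) (map (\<phi> g) xs) = d\<mu> t xs"
    if "g \<in> carrier G" "t \<in> orb" "xs \<in> tuples K (2 + 1)" for g t xs
    using d\<mu>_shift[OF that(1,2)] that(3) by simp
  have sF1: "F1 (shift g t) (map (\<phi> g) xs) = F1 t xs"
    if "g \<in> carrier G" "t \<in> orb" "xs \<in> tuples K (n + 2 + 1)" for g t xs
    unfolding F1_def by (rule cup_invariant[OF act that(1,3)]) (use sC1 sd that in blast)+
  have sF2: "F2 (shift g t) (map (\<phi> g) xs) = F2 t xs"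
    if "g \<in> carrier G" "t \<in> orb" "xs \<in> tuples K (2 + m + 1)" for g t xs
    unfolding F2_def by (rule cup_invariant[OF act that(1,3)]) (use sC2 sd that in blast)+
  have sF3: "F3 (shift g t) (map (\<phi> g) xs) = F3 t xs"
    if "g \<in> carrier G" "t \<in> orb" "xs \<in> tuples K (n + 2 + m + 1)" for g t xs
    unfolding F3_def by (rule cup_invariant[OF act that(1,3)]) (use sC2 sF1 that in blast)+
  have suppF1: "card {t \<in> orb. F1 t xs \<noteq> 0} \<le> N" if xs: "xs \<in> tuples K (n + 2 + 1)" for xs
    by (rule cup_d\<mu>_support[OF supp, of "drop n xs"])
      (use tuples_drop[OF xs, of 3 n] in \<open>auto simp: F1_def cup_def\<close>)
  have suppF2: "card {t \<in> orb. F2 t xs \<noteq> 0} \<le> N" if xs: "xs \<in> tuples K (2 + m + 1)" for xs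
    by (rule cup_d\<mu>_support[OF supp, of "take (2 + 1) xs"])
      (use tuples_take[OF xs, of 3] in \<open>auto simp: F2_def cup_def\<close>)
  have suppF3: "card {t \<in> orb. F3 t xs \<noteq> 0} \<le> N" if xs: "xs \<in> tuples K (n + 2 + m + 1)" for xs
  \<comment> \<open>These are the three entries at which the middle factor of \<open>F3\<close> is
    evaluated.\<close>
  proof (rule cup_d\<mu>_support[OF supp, of "drop n (take (n + 2 + 1) xs)"])
    have "take (n + 2 + 1) xs \<in> tuples K (n + 2 + 1)" by (rule tuples_take[OF xs]) simp
    then show "drop n (take (n + 2 + 1) xs) \<in> tuples K 3" by (rule tuples_drop) simp
    show "F3 t xs = 0" if "d\<mu> t (drop n (take (n + 2 + 1) xs)) = 0" for t
      unfolding F3_def F1_def cup_def that by simp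
  qed
  have coch: "orbit_sum F1 \<in> cochains G K \<phi> (n + 2)" "orbit_sum F2 \<in> cochains G K \<phi> (2 + m)"
    "orbit_sum F3 \<in> cochains G K \<phi> (n + 2 + m)"
    using orbit_sum_cochain[OF loc(1) sF1 bF1 _ suppF1] orbit_sum_cochain[OF loc(2) sF2 bF2 _ suppF2]
      orbit_sum_cochain[OF loc(3) sF3 bF3 _ suppF3] B1(1) B2(1) by simp_all
  have d1: "coboundary K (n + 2) (orbit_sum F1) = cup K (Suc n) 2 \<kappa>1 \<omega>"
    unfolding orbit_sum_coboundary[OF loc(1)] \<omega> orbit_sum_cup_left[OF local_d\<mu>]
    by (rule orbit_sum_cong) (rule dF1)
  have d2: "coboundary K (2 + m) (orbit_sum F2) = cup K 2 (Suc m) \<omega> \<kappa>2"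
    unfolding orbit_sum_coboundary[OF loc(2)] \<omega> orbit_sum_cup_right[OF local_d\<mu>]
    by (rule orbit_sum_cong) (rule dF2)
  have d3: "coboundary K (n + 2 + m) (orbit_sum F3) = (\<lambda>xs. cup K (Suc n) (2 + m) \<kappa>1 (orbit_sum F2) xs +
        (-1) ^ n * cup K (n + 2) (Suc m) (orbit_sum F1) \<kappa>2 xs)"
  proof -
    have "coboundary K (n + 2 + m) (orbit_sum F3) = orbit_sum (\<lambda>t xs. cup K (Suc n) (2 + m) \<kappa>1 (F2 t) xs +
      (-1) ^ n * cup K (n + 2) (Suc m) (F1 t) \<kappa>2 xs)"
      unfolding orbit_sum_coboundary[OF loc(3)] by (rule orbit_sum_cong) (rule dF3)
    also have "\<dots> = (\<lambda>xs. orbit_sum (\<lambda>t. cup K (Suc n) (2 + m) \<kappa>1 (F2 t)) xs +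
        (-1) ^ n * orbit_sum (\<lambda>t. cup K (n + 2) (Suc m) (F1 t) \<kappa>2) xs)"
      unfolding orbit_sum_def by (simp add: sum.distrib sum_distrib_left)
    finally show ?thesis unfolding orbit_sum_cup_left[OF loc(2)] orbit_sum_cup_right[OF loc(1)] .
  qed
  show "\<exists>\<beta>1\<in>cochains G K \<phi> (n + 2). \<exists>\<beta>2\<in>cochains G K \<phi> (2 + m). \<exists>\<eta>\<in>cochains G K \<phi> (n + 2 + m).
      coboundary K (n + 2) \<beta>1 = cup K (Suc n) 2 \<kappa>1 \<omega> \<and>
      coboundary K (2 + m) \<beta>2 = cup K 2 (Suc m) \<omega> \<kappa>2 \<and>
      coboundary K (n + 2 + m) \<eta> = (\<lambda>xs. cup K (Suc n) (2 + m) \<kappa>1 \<beta>2 xs +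
        (-1) ^ n * cup K (n + 2) (Suc m) \<beta>1 \<kappa>2 xs)"
    using coch d1 d2 d3 by blast
qed

end

theorem theorem5p22:
  fixes G :: "('g, 'r) monoid_scheme"
    and K :: "'v set set"
    and \<phi> :: "'g \<Rightarrow> 'v \<Rightarrow> 'v"
    and l n m :: nat
    and s :: "'v set list"
    and \<alpha>1 \<alpha>2 :: "('v list \<Rightarrow> real) set"
  assumes "CAT0_cube_complex K"
    and "cc_dimension K < \<infinity>"
    and "staircase_length K < \<infinity>"
    and "combinatorial_action G K \<phi>"
    and "l > 0"
    and "s \<in> segments K l"
    and "n > 0" and "m > 0"
    and "\<alpha>1 \<in> cohomology G K \<phi> n"
    and "\<alpha>2 \<in> cohomology G K \<phi> m"
    and "non_transverse_class K n \<alpha>1 (translates G \<phi> s)"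
    and "non_transverse_class K m \<alpha>2 (translates G \<phi> s)"
  shows "cup_class G K \<phi> n 2 \<alpha>1 (median_class G K \<phi> s) = null_class G K \<phi> (n + 2)
       \<and> cup_class G K \<phi> 2 m (median_class G K \<phi> s) \<alpha>2 = null_class G K \<phi> (2 + m)
       \<and> null_class G K \<phi> (n + m + 2 - 1)
           \<in> massey G K \<phi> n 2 m \<alpha>1 (median_class G K \<phi> s) \<alpha>2"
proof -
  interpret CAT0_action K G \<phi> l s
    by unfold_locales (fact assms)+
  note act = \<open>combinatorial_action G K \<phi>\<close>
  obtain n' m' where nm: "n = Suc n'" "m = Suc m'" using assms(7,8) by (metis gr0_implies_Suc)
  obtain \<kappa>1 where \<kappa>1: "\<kappa>1 \<in> \<alpha>1" "\<And>t. t \<in> translates G \<phi> s \<Longrightarrow> non_transverse K (Suc n') \<kappa>1 t"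
    using assms(11) unfolding non_transverse_class_def nm by blast
  obtain \<kappa>2 where \<kappa>2: "\<kappa>2 \<in> \<alpha>2" "\<And>t. t \<in> translates G \<phi> s \<Longrightarrow> non_transverse K (Suc m') \<kappa>2 t"
    using assms(12) unfolding non_transverse_class_def nm by blast
  have c: "\<kappa>1 \<in> cocycles G K \<phi> (Suc n')" "\<kappa>2 \<in> cocycles G K \<phi> (Suc m')"
    using cohomology_cohomologous[OF act assms(9) \<kappa>1(1) \<kappa>1(1)]
      cohomology_cohomologous[OF act assms(10) \<kappa>2(1) \<kappa>2(1)]
    unfolding cohomologous_iff[OF act] nm by auto
  define \<omega> where "\<omega> = coboundary K 1 (median_cochain G K \<phi> s)"
  have \<omega>c: "\<omega> \<in> cocycles G K \<phi> 2"
    unfolding \<omega>_def by (rule products_trivial(1)[OF assms(2,3) c(1) \<kappa>1(2) c(2) \<kappa>2(2)])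
  have cls: "median_class G K \<phi> s \<in> cohomology G K \<phi> 2" "\<omega> \<in> median_class G K \<phi> s"
    unfolding median_class_def \<omega>_def[symmetric]
    using coclass_cohomology[OF act \<omega>c] coclass_self[OF act \<omega>c] by auto
  have "\<exists>\<beta>1\<in>cochains G K \<phi> (n' + 2). \<exists>\<beta>2\<in>cochains G K \<phi> (2 + m'). \<exists>\<eta>\<in>cochains G K \<phi> (n' + 2 + m').
      coboundary K (n' + 2) \<beta>1 = cup K (Suc n') 2 \<kappa>1 \<omega> \<and>
      coboundary K (2 + m') \<beta>2 = cup K 2 (Suc m') \<omega> \<kappa>2 \<and>
      coboundary K (n' + 2 + m') \<eta> = (\<lambda>xs. cup K (Suc n') (2 + m') \<kappa>1 \<beta>2 xs +
        (-1) ^ n' * cup K (n' + 2) (Suc m') \<beta>1 \<kappa>2 xs)"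
    unfolding \<omega>_def by (rule products_trivial(2)[OF assms(2,3) c(1) \<kappa>1(2) c(2) \<kappa>2(2)])
  then obtain \<beta>1 \<beta>2 \<eta> where
    \<beta>: "\<beta>1 \<in> cochains G K \<phi> (n' + 2)" "\<beta>2 \<in> cochains G K \<phi> (2 + m')" "\<eta> \<in> cochains G K \<phi> (n' + 2 + m')"
    and d: "coboundary K (n' + 2) \<beta>1 = cup K (Suc n') 2 \<kappa>1 \<omega>"
      "coboundary K (2 + m') \<beta>2 = cup K 2 (Suc m') \<omega> \<kappa>2"
      "coboundary K (n' + 2 + m') \<eta> = (\<lambda>xs. cup K (Suc n') (2 + m') \<kappa>1 \<beta>2 xs +
        (-1) ^ n' * cup K (n' + 2) (Suc m') \<beta>1 \<kappa>2 xs)"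
    by blast
  have "cup K n 2 \<kappa>1 \<omega> \<in> coboundaries G K \<phi> (n + 2)"
    using coboundariesI[OF act \<beta>(1), of "n + 2"] d(1) nm by simp
  then have 1: "cup_class G K \<phi> n 2 \<alpha>1 (median_class G K \<phi> s) = null_class G K \<phi> (n + 2)"
    by (intro cup_class_null[OF act assms(9) \<kappa>1(1) cls assms(7)]) auto
  have "cup K 2 m \<omega> \<kappa>2 \<in> coboundaries G K \<phi> (2 + m)"
    using coboundariesI[OF act \<beta>(2), of "2 + m"] d(2) nm by simp
  then have 2: "cup_class G K \<phi> 2 m (median_class G K \<phi> s) \<alpha>2 = null_class G K \<phi> (2 + m)"
    by (intro cup_class_null[OF act cls assms(10) \<kappa>2(1) _ assms(8)]) auto
  define f where "f = (\<lambda>xs. (-1) ^ 2 * ((-1) ^ n * cup K n (2 + m - 1) \<kappa>1 \<beta>2 xs - cup K (n + 2 - 1) m \<beta>1 \<kappa>2 xs))"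
  have deg: "n + 2 - 1 = n' + 2" "2 + m - 1 = 2 + m'" "n + m + 2 - 1 = Suc (n' + 2 + m')"
    unfolding nm by simp_all
  have sq: "(-1) ^ k * ((-1) ^ k * x) = x" for k and x :: real
    by (metis mult.assoc mult_1 power_mult_distrib mult_minus1 minus_minus power_one)
  \<comment> \<open>As \<open>n\<close> is \<open>n' + 1\<close>, the factor \<open>(-1) ^ n\<close>
    turns the sign \<open>(-1) ^ n'\<close> of the second term into \<open>-1\<close>, as the Massey
    product demands.\<close>
  have "f = (\<lambda>xs. (-1) ^ n * coboundary K (n' + 2 + m') \<eta> xs)"
    unfolding f_def d(3) deg unfolding nm by (rule ext) (simp add: algebra_simps sq)
  moreover have "coboundary K (n' + 2 + m') \<eta> \<in> coboundaries G K \<phi> (n + m + 2 - 1)"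
    by (rule coboundariesI[OF act \<beta>(3) deg(3)])
  ultimately have "f \<in> coboundaries G K \<phi> (n + m + 2 - 1)"
    using coboundaries_scale[OF act] by simp
  then have null: "null_class G K \<phi> (n + m + 2 - 1) = coclass G K \<phi> (n + m + 2 - 1) f"
    using coclass_null[OF act] by simp
  have 3: "null_class G K \<phi> (n + m + 2 - 1) \<in> massey G K \<phi> n 2 m \<alpha>1 (median_class G K \<phi> s) \<alpha>2"
    unfolding massey_def mem_Collect_eq null f_def
  proof (intro exI conjI)
    show "\<kappa>1 \<in> \<alpha>1" "\<omega> \<in> median_class G K \<phi> s" "\<kappa>2 \<in> \<alpha>2" using \<kappa>1(1) \<kappa>2(1) cls(2) by auto
    show "\<beta>1 \<in> cochains G K \<phi> (n + 2 - 1)" "\<beta>2 \<in> cochains G K \<phi> (2 + m - 1)"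
      unfolding deg using \<beta> by auto
    show "coboundary K (n + 2 - 1) \<beta>1 = cup K n 2 \<kappa>1 \<omega>" "coboundary K (2 + m - 1) \<beta>2 = cup K 2 m \<omega> \<kappa>2"
      unfolding deg using d nm by auto
  qed (simp add: add.commute)
  show ?thesis using 1 2 3 by blast
qed

end
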